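(* Let $f\in B(J^2)$, $1\le p<\infty$, and let $m,n\in\mathbb N$ be relatively prime. Then $$\|f-\mathcal{L}_{m,n}f\|_{L_{p,w}(J^2)}\le C_pK_p(m,n)\,\widetilde{E}(f,\Pi^{\mathcal L}_{m,n})_{L_{p,w}(J^2)},$$ where $C_p$ is a positive constant depending only on $p$.
   Context: $J=[-1,1]$. $B(J^2)$ is the set of real-valued bounded measurable functions on $J^2$. For a weight $u\ge0$, $\|g\|_{L_{p,u}(J^2)}=\big(\int_{J^2}|g u|^p\big)^{1/p}$; $w(x,y)=\big(\sqrt{1-x^2}\sqrt{1-y^2}\big)^{-1/p}$. $x_k=\cos(k\pi/m)$, $y_l=\cos(l\pi/n)$. For relatively prime $m,n$: $\mathrm{LC}_{m,n}=\{(x_i,y_j):(i,j)\in\mathbb{Z}_+^2,\ 0\le i\le m,\ 0\le j\le n,\ i+j \text{ even}\}$. $C_k(x)=\cos(k\arccos x)$; $\Pi_{m,n}^{\mathcal L}=\mathrm{span}\{C_k(x)C_l(y):(k,l)\in\mathbb Z_+^2,\ \frac km+\frac ln<1\text{ or }(k,l)=(0,n)\}$. $\mathcal{L}_{m,n}f$ is the unique polynomial in $\Pi^{\mathcal L}_{m,n}$ with $\mathcal{L}_{m,n}f=f$ on $\mathrm{LC}_{m,n}$. $K_p(m,n)=\log(m+1)\log(n+1)$ if $p=1$, and $=1$ if $1<p<\infty$. Best one-sided approximation: $\widetilde E(f,\Pi)_{L_{p,w}(J^2)}=\inf\{\|Q-q\|_{L_{p,w}(J^2)}: q,Q\in\Pi,\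 q(x,y)\le f(x,y)\le Q(x,y)\text{ for all }(x,y)\in J^2\}$. *)

theory Defs
  imports "HOL-Analysis.Analysis"
begin

definition J :: "real set" where "J = {-1..1}"

definition J2 :: "(real \<times> real) set" where "J2 = J \<times> J"

definition cheb :: "nat \<Rightarrow> real \<Rightarrow> real" where
  "cheb k x = cos (real k * arccos x)"

definition node :: "nat \<Rightarrow> nat \<Rightarrow> real" where
  "node m k = cos (real k * pi / real m)"

definition LC :: "nat \<Rightarrow> nat \<Rightarrow> (real \<times> real) set" where
  "LC m n = {(node m i, node n j) | i j. i \<le> m \<and> j \<le> n \<and> even (i + j)}"

definition idxL :: "nat \<Rightarrow> nat \<Rightarrow> (nat \<times> nat) set" where
  "idxL m n = {(k, l). real k / real m + real l / real n < 1 \<or> (k, l) = (0, n)}"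

definition PiL :: "nat \<Rightarrow> nat \<Rightarrow> (real \<times> real \<Rightarrow> real) set" where
  "PiL m n = {g. \<exists>c :: nat \<times> nat \<Rightarrow> real.
      \<forall>x y. g (x, y) = (\<Sum>(k, l)\<in>idxL m n. c (k, l) * cheb k x * cheb l y)}"

definition Lint :: "nat \<Rightarrow> nat \<Rightarrow> (real \<times> real \<Rightarrow> real) \<Rightarrow> (real \<times> real \<Rightarrow> real)" where
  "Lint m n f = (THE q. q \<in> PiL m n \<and> (\<forall>z\<in>LC m n. q z = f z))"

definition Bfun :: "(real \<times> real \<Rightarrow> real) set" where
  "Bfun = {f. f \<in> borel_measurable (lebesgue_on J2) \<and> bounded (f ` J2)}"

definition wgt :: "real \<Rightarrow> real \<times> real \<Rightarrow> real" where
  "wgt p z = (sqrt (1 - (fst z)\<^sup>2) * sqrt (1 - (snd z)\<^sup>2)) powr (- 1 / p)"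

definition normLpw :: "real \<Rightarrow> (real \<times> real \<Rightarrow> real) \<Rightarrow> real" where
  "normLpw p g = (integral\<^sup>L (lebesgue_on J2) (\<lambda>z. \<bar>g z * wgt p z\<bar> powr p)) powr (1 / p)"

definition onesidedE :: "real \<Rightarrow> (real \<times> real \<Rightarrow> real) \<Rightarrow> (real \<times> real \<Rightarrow> real) set \<Rightarrow> real" where
  "onesidedE p f P = Inf {normLpw p (\<lambda>z. Q z - q z) | q Q.
      q \<in> P \<and> Q \<in> P \<and> (\<forall>z\<in>J2. q z \<le> f z \<and> f z \<le> Q z)}"

definition Kp :: "real \<Rightarrow> nat \<Rightarrow> nat \<Rightarrow> real" where
  "Kp p m n = (if p = 1 then ln (real m + 1) * ln (real n + 1) else 1)"

end

theory Submission
  imports Defs "HOL-Complex_Analysis.Complex_Analysis"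
begin

text \<open>
  Put \<open>x = cos \<theta>\<close>, \<open>y = cos \<phi>\<close>. The weighted norm becomes the \<open>L\<^sub>p\<close> norm on the torus, and the nodes
  become a lattice \<open>\<Lambda>\<close> of \<open>2 m n\<close> points, for whose dual lattice the rhombus \<open>\<bar>k\<bar> / m + \<bar>l\<bar> / n < 1\<close>
  together with one boundary point is a fundamental domain. Hence, up to symmetrisation in \<open>\<plusminus> \<theta>\<close> and
  \<open>\<plusminus> \<phi>\<close>, the interpolant of \<open>g\<close> is the rhombic partial sum of the measure that \<open>g\<close> induces on \<open>\<Lambda>\<close>.
  If \<open>q \<le> f \<le> Q\<close> then the error is \<open>(f - q) - L (f - q)\<close> with \<open>0 \<le> f - q \<le> Q - q\<close>, so it is enough to bound
  the \<open>L\<^sub>p\<close> norm of \<open>L g\<close> by the discrete norm of \<open>g\<close> on \<open>\<Lambda>\<close>, and the discrete norm of \<open>Q - q\<close> by its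
  \<open>L\<^sub>p\<close> norm. The second is a Marcinkiewicz--Zygmund inequality, proved with de la Vallee Poussin kernels.
  For the first, smooth the measure with the same kernels; if \<open>p > 1\<close>, the rhombus is an intersection of
  four half planes, and a half-plane multiplier reduces along lines to M. Riesz's theorem on analytic
  projections. If \<open>p = 1\<close>, the \<open>L\<^sub>1\<close> norm of the rhombic Dirichlet kernel is \<open>O (log (m + 1) log (n + 1))\<close>.
\<close>

section \<open>Means of periodic functions\<close>

text \<open>The weighted norm of \<open>f\<close> does not control its values at the nodes, so no
  bound of \<open>L\<close> by the norm of \<open>f\<close> alone is possible. A majorant that is
  itself a polynomial, \<open>Q - q\<close>, is what allows a passage from node values back to the
  norm. All constants must be uniform in \<open>m\<close> and \<open>n\<close>. Fejer kernels are
  positive, so Jensen's inequality applies, but they do not reproduce polynomials; Dirichlet kernels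
  reproduce them, but their mean modulus is unbounded. The combination \<open>2 F_2K - F_K\<close>
  of Fejer kernels has both advantages. For \<open>p > 1\<close> the sides of the rhombus have
  slopes that vary with \<open>m\<close> and \<open>n\<close>; this is harmless because the
  half-plane constant depends on neither direction nor offset. M. Riesz's theorem fails at
  \<open>p = 1\<close>. There the kernel is estimated directly, and the obstacle is that the rows of
  the rhombus end at integer parts \<open>n * k div m\<close>, so that the kernel is not built from
  products of Dirichlet kernels.\<close>

definition tmean :: "(real \<Rightarrow> real) \<Rightarrow> real" where
  "tmean g = integral {0..2*pi} g / (2*pi)"

section \<open>Inequalities for p-th powers and Jensen's inequality\<close>

lemma powr_add_le:
  fixes a b p :: real
  assumes "0 \<le> a" "0 \<le> b" "0 \<le> p"
  shows "(a + b) powr p \<le> 2 powr p * (a powr p + b powr p)"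
proof -
  have "(a + b) powr p \<le> (2 * max a b) powr p"
    using assms by (intro powr_mono2) auto
  also have "\<dots> = 2 powr p * (max a b) powr p"
    using assms by (simp add: powr_mult)
  also have "\<dots> \<le> 2 powr p * (a powr p + b powr p)"
    by (intro mult_left_mono) (auto simp: max_def)
  finally show ?thesis .
qed

lemma two_powr_mult_self: "2 powr p * 2 powr p = 4 powr (p::real)"
  by (simp flip: powr_mult)

lemma powr_le_add:
  fixes a b p z :: real
  assumes "0 \<le> z" "z \<le> a + b" "0 \<le> a" "0 \<le> b" "0 \<le> p"
  shows "z powr p \<le> 2 powr p * (a powr p + b powr p)"
  using powr_mono2[OF assms(5,1,2)] powr_add_le[OF assms(3-5)] by linarith

lemma powr_le_twice_add:
  fixes a b p z :: real
  assumes "0 \<le> z" "z \<le> 2 * (a + b)" "0 \<le> a" "0 \<le> b" "0 \<le> p"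
  shows "z powr p \<le> 4 powr p * (a powr p + b powr p)"
proof -
  have "z powr p \<le> 2 powr p * ((2 * a) powr p + (2 * b) powr p)"
    using assms by (intro powr_le_add) auto
  also have "\<dots> = 4 powr p * (a powr p + b powr p)"
    by (simp only: powr_mult distrib_left mult.assoc[symmetric] two_powr_mult_self)
  finally show ?thesis .
qed

text \<open>A convex function lies above its tangent at \<open>b\<close>. The point \<open>0\<close>
  is separate: at \<open>b = 0\<close> both terms on the left vanish because
  \<open>0 powr c = 0\<close>, and at \<open>a = 0\<close> the claim reduces to
  \<open>1 \<le> p\<close>.\<close>

lemma powr_tangent:
  fixes a b p :: real
  assumes "0 \<le> a" "0 \<le> b" "1 \<le> p"
  shows "b powr p + p * b powr (p - 1) * (a - b) \<le> a powr p"
proof (cases "b = 0")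
  case False
  with assms have b: "b > 0" by simp
  have der: "((\<lambda>x. x powr p) has_real_derivative p * b powr (p - 1)) (at b)"
    using b by (auto intro!: derivative_eq_intros)
  show ?thesis
  proof (cases "a = 0")
    case True
    have "b powr (p - 1) * b = b powr p"
      using b by (simp add: powr_diff)
    then have "p * b powr (p - 1) * (a - b) = - p * b powr p"
      using True by (simp add: mult.assoc)
    also have "\<dots> \<le> - (b powr p)" using mult_right_mono[of 1 p "b powr p"] assms by simp
    finally show ?thesis using True by simp
  next
    case False
    with assms have a: "a > 0" by simp
    have "(\<lambda>x. x powr p) a - (\<lambda>x. x powr p) b \<ge> p * b powr (p - 1) * (a - b)"
      using powr_convex[OF assms(3)]
      by (rule convex_on_imp_above_tangent)
        (use a b der in \<open>auto intro!: has_field_derivative_at_within connectedI simp: interior_open\<close>)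
    then show ?thesis by simp
  qed
qed (use assms in auto)

text \<open>Averaging the tangent at the weighted mean \<open>b\<close> against weights of total
  mass 1 cancels the linear term and leaves \<open>b powr p\<close>.\<close>

lemma jensen_sum_powr:
  fixes w a :: "'a \<Rightarrow> real"
  assumes "finite A" "\<And>i. i \<in> A \<Longrightarrow> 0 \<le> w i" "(\<Sum>i\<in>A. w i) = 1" "\<And>i. i \<in> A \<Longrightarrow> 0 \<le> a i" "1 \<le> p"
  shows "(\<Sum>i\<in>A. w i * a i) powr p \<le> (\<Sum>i\<in>A. w i * a i powr p)"
proof -
  define b where "b = (\<Sum>i\<in>A. w i * a i)"
  have b: "b \<ge> 0" unfolding b_def using assms by (intro sum_nonneg) auto
  have "b powr p = (\<Sum>i\<in>A. w i * (b powr p + p * b powr (p - 1) * (a i - b)))"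
  proof -
    have "(\<Sum>i\<in>A. w i * (b powr p + p * b powr (p - 1) * (a i - b)))
      = (\<Sum>i\<in>A. w i) * b powr p + p * b powr (p - 1) * ((\<Sum>i\<in>A. w i * a i) - (\<Sum>i\<in>A. w i) * b)"
      by (simp add: algebra_simps sum.distrib sum_subtractf sum_distrib_left sum_distrib_right)
    then show ?thesis using assms by (simp add: b_def)
  qed
  also have "\<dots> \<le> (\<Sum>i\<in>A. w i * a i powr p)"
    using assms b by (intro sum_mono mult_left_mono powr_tangent) auto
  finally show ?thesis by (simp add: b_def)
qed

text \<open>The tangent argument again, with a probability density in place of weights; the density
  will be a normalised Fejer kernel or the constant 1.\<close>

lemma jensen_tmean_powr:
  fixes w a :: "real \<Rightarrow> real"
  assumes w: "continuous_on {0..2*pi} w" "\<And>t. 0 \<le> w t" "tmean w = 1"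
    and a: "continuous_on {0..2*pi} a" "\<And>t. 0 \<le> a t" and p: "1 \<le> p"
  shows "tmean (\<lambda>t. w t * a t) powr p \<le> tmean (\<lambda>t. w t * a t powr p)"
proof -
  define b where "b = tmean (\<lambda>t. w t * a t)"
  have "b \<ge> 0" unfolding b_def tmean_def
    by (intro divide_nonneg_nonneg integral_nonneg integrable_continuous_real continuous_intros)
      (use assms in auto)
  have [continuous_intros]: "continuous_on {0..2*pi} (\<lambda>t. a t powr p)"
    using a p by (intro continuous_on_powr') auto
  note [continuous_intros] = w(1) a(1)
  have iw: "integral {0..2*pi} w = 2*pi" using w(3) by (simp add: tmean_def)
  have ib: "integral {0..2*pi} (\<lambda>t. w t * a t) = b * (2*pi)" by (simp add: b_def tmean_def)
  define c where "c = p * b powr (p - 1)"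
  have "((\<lambda>t. w t * (b powr p + c * (a t - b))) has_integral (2*pi) * (b powr p)) {0..2*pi}"
  proof -
    have 1: "(w has_integral 2*pi) {0..2*pi}"
      using iw w(1) by (metis integrable_continuous_real integrable_integral)
    have 2: "((\<lambda>t. w t * a t) has_integral b * (2*pi)) {0..2*pi}"
      unfolding ib[symmetric] by (intro integrable_integral integrable_continuous_real continuous_intros)
    have "((\<lambda>t. w t * (b powr p - c * b) + (w t * a t) * c) has_integral (2*pi) * (b powr p - c * b) + b * (2*pi) * c) {0..2*pi}"
      by (intro has_integral_add has_integral_mult_left 1 2)
    then show ?thesis by (simp add: algebra_simps)
  qed
  then have "(2*pi) * (b powr p) = integral {0..2*pi} (\<lambda>t. w t * (b powr p + c * (a t - b)))"
    by (simp add: integral_unique)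
  also have "\<dots> \<le> integral {0..2*pi} (\<lambda>t. w t * a t powr p)"
    unfolding c_def
    by (intro integral_le integrable_continuous_real continuous_intros mult_left_mono powr_tangent)
      (use a w p \<open>b \<ge> 0\<close> in auto)
  finally show ?thesis unfolding b_def[symmetric] by (simp add: tmean_def field_simps)
qed

section \<open>Invariance of periodic means, monotonicity, linearity and interchange\<close>

lemma integral_periodic_shift:
  fixes g :: "real \<Rightarrow> real"
  assumes "continuous_on UNIV g" "\<And>x. g (x + 2*pi) = g x"
  shows "integral {a..a+2*pi} g = integral {0..2*pi} g"
proof -
  define G where "G = (\<lambda>x. integral {0..2*pi} (\<lambda>t. g (t + x)))"
  have int: "g integrable_on {x..y}" for x y
    using assms(1) by (intro integrable_continuous_real) (auto intro: continuous_on_subset)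
  \<comment> \<open>A signed primitive based at 0, so that \<open>H y - H x\<close> is the integral
    over \<open>{x..y}\<close> whatever the signs of \<open>x\<close> and \<open>y\<close>. By
    periodicity \<open>H (a + 2*pi) - H a\<close> then has derivative 0 in \<open>a\<close>.\<close>
  define H where "H = (\<lambda>x. if x \<ge> 0 then integral {0..x} g else - integral {x..0} g)"
  have H: "integral {x..y} g = H y - H x" if "x \<le> y" for x y
    using that int Henstock_Kurzweil_Integration.integral_combine[of x 0 y g]
      Henstock_Kurzweil_Integration.integral_combine[of 0 x y g]
      Henstock_Kurzweil_Integration.integral_combine[of x y 0 g]
    by (auto simp: H_def not_le)
  have der: "(H has_real_derivative g x) (at x)" for x
  proof -
    have "((\<lambda>u. integral {x-1..u} g) has_vector_derivative g x) (at x within {x-1..x+1})"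
      by (rule integral_has_vector_derivative) (use assms(1) in \<open>auto intro: continuous_on_subset\<close>)
    then have *: "((\<lambda>u. integral {x-1..u} g) has_real_derivative g x) (at x)"
      by (simp add: has_real_derivative_iff_has_vector_derivative at_within_Icc_at)
    have "((\<lambda>u. H u - H (x-1)) has_real_derivative g x) (at x)"
      by (rule has_field_derivative_transform_within[OF *, of 1]) (auto simp: H dist_real_def)
    from DERIV_add[OF this DERIV_const[of "H (x-1)"]] show ?thesis by simp
  qed
  have "((\<lambda>a. H (a + 2*pi) - H a) has_real_derivative 0) (at x)" for x
  proof -
    have "((\<lambda>a. H (a + 2*pi)) has_real_derivative g (x + 2*pi)) (at x)"
      using der[of "x + 2*pi"] by (simp add: DERIV_shift)
    from DERIV_diff[OF this der[of x]] show ?thesis by (simp add: assms)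
  qed
  then have "H (a + 2*pi) - H a = H (0 + 2*pi) - H 0"
    using DERIV_isconst_all by blast
  then show ?thesis by (simp add: H)
qed

lemma tmean_shift:
  assumes "continuous_on UNIV g" "\<And>x. g (x + 2*pi) = g x"
  shows "tmean (\<lambda>t. g (t + c)) = tmean g"
proof -
  have "integral {0..2*pi} (\<lambda>t. g (t + c)) = integral {c..c+2*pi} g"
    using integral_shift_real_ivl[of c c "c + 2*pi" g] by simp
  then show ?thesis using integral_periodic_shift[OF assms] by (simp add: tmean_def)
qed

lemma tmean_minus:
  assumes "continuous_on UNIV g" "\<And>x. g (x + 2*pi) = g x"
  shows "tmean (\<lambda>t. g (- t)) = tmean g"
proof -
  have "integral {0..2*pi} (\<lambda>t. g (- t)) = integral {-(2*pi)..0} g"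
    using Henstock_Kurzweil_Integration.integral_reflect_real[of "2*pi" 0 "\<lambda>t. g (- t)"] by simp
  then show ?thesis using integral_periodic_shift[OF assms, of "-(2*pi)"] by (simp add: tmean_def)
qed

lemma tmean_mono:
  assumes "continuous_on {0..2*pi} f" "continuous_on {0..2*pi} g" "\<And>t. f t \<le> g t"
  shows "tmean f \<le> tmean g"
  unfolding tmean_def
  by (intro divide_right_mono integral_le integrable_continuous_real) (use assms in auto)

lemma tmean_nonneg:
  assumes "continuous_on {0..2*pi} f" "\<And>t. 0 \<le> f t"
  shows "0 \<le> tmean f"
  unfolding tmean_def
  by (intro divide_nonneg_nonneg integral_nonneg integrable_continuous_real) (use assms in auto)

lemma tmean_add:
  assumes "continuous_on {0..2*pi} f" "continuous_on {0..2*pi} g"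
  shows "tmean (\<lambda>t. f t + g t) = tmean f + tmean g"
  unfolding tmean_def using assms
  by (simp add: Henstock_Kurzweil_Integration.integral_add integrable_continuous_real add_divide_distrib)

lemma tmean_cmult: "tmean (\<lambda>t. c * f t) = c * tmean f"
  unfolding tmean_def by simp

lemma tmean_const [simp]: "tmean (\<lambda>t. c) = c"
  unfolding tmean_def by simp

lemma tmean_sum:
  assumes "finite A" "\<And>i. i \<in> A \<Longrightarrow> continuous_on {0..2*pi} (f i)"
  shows "tmean (\<lambda>t. \<Sum>i\<in>A. f i t) = (\<Sum>i\<in>A. tmean (f i))"
  unfolding tmean_def using assms
  by (simp add: Henstock_Kurzweil_Integration.integral_sum integrable_continuous_real sum_divide_distrib)

lemma tmean_swap:
  assumes "continuous_on UNIV (\<lambda>(x, y). f x y)"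
  shows "tmean (\<lambda>x. tmean (\<lambda>y. f x y)) = tmean (\<lambda>y. tmean (\<lambda>x. f x y))"
proof -
  have "integral (cbox 0 (2*pi)) (\<lambda>x. integral (cbox 0 (2*pi)) (f x)) =
     integral (cbox 0 (2*pi)) (\<lambda>y. integral (cbox 0 (2*pi)) (\<lambda>x. f x y))"
    by (rule integral_swap_continuous) (use assms in \<open>auto intro: continuous_on_subset\<close>)
  then show ?thesis by (simp add: tmean_def)
qed

lemma continuous_on_tmean:
  fixes f :: "'a::topological_space \<Rightarrow> real \<Rightarrow> real"
  assumes "continuous_on UNIV (\<lambda>(x, y). f x y)"
  shows "continuous_on UNIV (\<lambda>x. tmean (f x))"
proof -
  have "continuous_on UNIV (\<lambda>x. integral (cbox 0 (2*pi)) (f x))"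
    by (rule integral_continuous_on_param) (use assms in \<open>auto intro: continuous_on_subset\<close>)
  then show ?thesis unfolding tmean_def by (auto intro!: continuous_intros)
qed

section \<open>Fejer and de la Vallee Poussin kernels\<close>

definition fcoef :: "(real \<Rightarrow> complex) \<Rightarrow> int \<Rightarrow> complex" where
  "fcoef a k = integral {0..2*pi} (\<lambda>s. a s * cis (- (of_int k * s))) / (2*pi)"

text \<open>\<open>dsq M / M\<close> is the Fejer kernel of order \<open>M\<close>, and \<open>fsum M a / M\<close> the Fejer mean of \<open>a\<close>.\<close>

definition dsq :: "nat \<Rightarrow> real \<Rightarrow> real" where
  "dsq M x = (cmod (\<Sum>j<M. cis (real j * x)))\<^sup>2"

definition fsum :: "nat \<Rightarrow> (real \<Rightarrow> complex) \<Rightarrow> real \<Rightarrow> complex" where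
  "fsum M a t = (\<Sum>i<M. \<Sum>j<M. fcoef a (int i - int j) * cis (of_int (int i - int j) * t))"

lemma sum_rotate: "(\<Sum>i\<in>A. \<Sum>j\<in>B. \<Sum>k\<in>C. f i j k) = (\<Sum>k\<in>C. \<Sum>i\<in>A. \<Sum>j\<in>B. f i j k)"
proof -
  have "(\<Sum>i\<in>A. \<Sum>j\<in>B. \<Sum>k\<in>C. f i j k) = (\<Sum>i\<in>A. \<Sum>k\<in>C. \<Sum>j\<in>B. f i j k)"
    by (intro sum.cong[OF refl] sum.swap)
  also have "\<dots> = (\<Sum>k\<in>C. \<Sum>i\<in>A. \<Sum>j\<in>B. f i j k)" by (rule sum.swap)
  finally show ?thesis .
qed

lemma continuous_on_cis' [continuous_intros]:
  "continuous_on A f \<Longrightarrow> continuous_on A (\<lambda>x. cis (f x))"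
  unfolding cis_conv_exp by (intro continuous_intros)

lemma continuous_on_dsq [continuous_intros]:
  "continuous_on A f \<Longrightarrow> continuous_on A (\<lambda>x. dsq M (f x))"
  unfolding dsq_def by (intro continuous_intros)

lemma dsq_nonneg [simp]: "0 \<le> dsq M x"
  by (simp add: dsq_def)

lemma dsq_minus: "dsq M (- x) = dsq M x"
proof -
  have "(\<Sum>j<M. cis (real j * (- x))) = cnj (\<Sum>j<M. cis (real j * x))"
    by (simp add: cis_cnj)
  then show ?thesis unfolding dsq_def by (metis complex_mod_cnj)
qed

lemma cis_2pi_int: "cis (of_int k * (t + 2*pi)) = cis (of_int k * t)"
proof -
  have "cis (of_int k * (t + 2*pi)) = cis (of_int k * t) * cis (2 * pi * of_int k)"
    by (simp add: cis_mult algebra_simps)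
  also have "cis (2 * pi * of_int k) = 1" by (rule cis_multiple_2pi) simp
  finally show ?thesis by simp
qed

text \<open>Among the differences \<open>i - j\<close> the frequency \<open>k\<close> with
  \<open>\<bar>k\<bar> \<le> M\<close> occurs \<open>M - \<bar>k\<bar>\<close> times. The triangular
  Fejer weights are kept in this double-sum form throughout, which spares any explicit formula for
  them and matches \<open>fsum\<close> term by term.\<close>

lemma dsq_expand:
  "of_real (dsq M x) = (\<Sum>i<M. \<Sum>j<M. cis (of_int (int i - int j) * x))"
proof -
  have "of_real (dsq M x) = (\<Sum>i<M. cis (real i * x)) * cnj (\<Sum>j<M. cis (real j * x))"
    by (simp add: dsq_def complex_norm_square flip: of_real_power)
  also have "\<dots> = (\<Sum>i<M. \<Sum>j<M. cis (real i * x) * cis (- (real j * x)))"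
    by (simp add: sum_product cis_cnj)
  finally show ?thesis by (simp add: cis_mult algebra_simps)
qed

lemma integral_cis_int:
  "integral {0..2*pi} (\<lambda>s. cis (of_int k * s)) = (if k = 0 then 2*pi else 0)"
proof (cases "k = 0")
  case False
  have "((\<lambda>s. cis (of_int k * s)) has_integral
      (cis (of_int k * (2*pi)) / (\<i> * of_int k) - cis (of_int k * 0) / (\<i> * of_int k))) {0..2*pi}"
  proof (rule fundamental_theorem_of_calculus)
    fix x :: real
    have "((\<lambda>z. exp (\<i> * of_int k * z) / (\<i> * of_int k)) has_field_derivative exp (\<i> * of_int k * of_real x))
        (at (of_real x) within of_real ` {0..2*pi})"
      using False by (auto intro!: derivative_eq_intros)
    then have "((\<lambda>z. exp (\<i> * of_int k * z) / (\<i> * of_int k)) \<circ> of_real has_vector_derivative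
        (1 * exp (\<i> * of_int k * of_real x))) (at x within {0..2*pi})"
      by (intro field_vector_diff_chain_within) (auto intro!: derivative_eq_intros)
    then show "((\<lambda>x. cis (of_int k * x) / (\<i> * of_int k)) has_vector_derivative cis (of_int k * x)) (at x within {0..2*pi})"
      by (simp add: cis_conv_exp o_def mult.assoc)
  qed simp
  moreover have "cis (of_int k * (2*pi)) = 1"
    using cis_2pi_int[of k 0] by simp
  ultimately show ?thesis using False by (simp add: integral_unique)
qed (simp add: scaleR_conv_of_real)

lemma fcoef_cis: "fcoef (\<lambda>s. cis (of_int j * s)) k = (if j = k then 1 else 0)"
proof -
  have "(\<lambda>s. cis (of_int j * s) * cis (- (of_int k * s))) = (\<lambda>s. cis (of_int (j - k) * s))"
    by (simp add: cis_mult algebra_simps)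
  then show ?thesis by (simp add: fcoef_def integral_cis_int del: of_int_diff)
qed

lemma fcoef_cmult: "fcoef (\<lambda>s. c * a s) k = c * fcoef a k"
  by (simp add: fcoef_def mult.assoc)

lemma fcoef_sum:
  assumes "finite A" "\<And>x. x \<in> A \<Longrightarrow> continuous_on {0..2*pi} (a x)"
  shows "fcoef (\<lambda>s. \<Sum>x\<in>A. a x s) k = (\<Sum>x\<in>A. fcoef (a x) k)"
  unfolding fcoef_def sum_distrib_right
  by (subst Henstock_Kurzweil_Integration.integral_sum)
     (use assms in \<open>auto intro!: integrable_continuous_real continuous_intros simp: sum_divide_distrib\<close>)

lemma fcoef_cnj_real:
  fixes a :: "real \<Rightarrow> real"
  shows "fcoef (\<lambda>s. of_real (a s)) (- k) = cnj (fcoef (\<lambda>s. of_real (a s)) k)"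
proof -
  have "cnj (integral {0..2*pi} (\<lambda>s. of_real (a s) * cis (- (of_int k * s))))
      = integral {0..2*pi} (\<lambda>s. cnj (of_real (a s) * cis (- (of_int k * s))))"
    by (rule integral_cnj)
  then show ?thesis by (simp add: fcoef_def cis_cnj)
qed

lemma fcoef_0_real:
  assumes "continuous_on {0..2*pi} a"
  shows "fcoef (\<lambda>s. of_real (a s)) 0 = of_real (tmean a)"
proof -
  have "(a has_integral integral {0..2*pi} a) {0..2*pi}"
    using assms by (intro integrable_integral integrable_continuous_real)
  then have "((\<lambda>s. complex_of_real (a s)) has_integral of_real (integral {0..2*pi} a)) {0..2*pi}"
    by (rule has_integral_of_real)
  then show ?thesis by (simp add: fcoef_def tmean_def integral_unique)
qed

lemma integral_of_real_complex:
  assumes "continuous_on {0..2*pi} a"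
  shows "integral {0..2*pi} (\<lambda>s. complex_of_real (a s)) = of_real (integral {0..2*pi} a)"
  using assms by (intro integral_unique has_integral_of_real integrable_integral integrable_continuous_real)

lemma fsum_conv:
  assumes [continuous_intros]: "continuous_on {0..2*pi} a"
  shows "fsum M a t = integral {0..2*pi} (\<lambda>s. a s * of_real (dsq M (t - s))) / (2*pi)"
proof -
  have *: "(\<lambda>s. a s * of_real (dsq M (t - s))) =
      (\<lambda>s. \<Sum>i<M. \<Sum>j<M. (a s * cis (- (of_int (int i - int j) * s))) * cis (of_int (int i - int j) * t))"
    by (simp only: dsq_expand sum_distrib_left mult.assoc cis_mult)
       (simp add: algebra_simps)
  have "integral {0..2*pi} (\<lambda>s. a s * of_real (dsq M (t - s))) = (\<Sum>i<M. \<Sum>j<M. integral {0..2*pi} (\<lambda>s. a s * cis (- (of_int (int i - int j) * s))) * cis (of_int (int i - int j) * t))"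
  proof -
    have "integral {0..2*pi} (\<lambda>s. \<Sum>j<M. (a s * cis (- (of_int (int i - int j) * s))) * cis (of_int (int i - int j) * t))
      = (\<Sum>j<M. integral {0..2*pi} (\<lambda>s. a s * cis (- (of_int (int i - int j) * s))) * cis (of_int (int i - int j) * t))" for i
      by (subst Henstock_Kurzweil_Integration.integral_sum)
         (auto intro!: integrable_continuous_real continuous_intros)
    then show ?thesis unfolding *
      by (subst Henstock_Kurzweil_Integration.integral_sum)
         (auto intro!: integrable_continuous_real continuous_intros)
  qed
  then show ?thesis
    by (simp add: fsum_def fcoef_def sum_divide_distrib)
qed

lemma fsum_real:
  assumes [continuous_intros]: "continuous_on {0..2*pi} a"
  shows "fsum M (\<lambda>s. of_real (a s)) t = of_real (tmean (\<lambda>s. a s * dsq M (t - s)))"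
proof -
  have "integral {0..2*pi} (\<lambda>s. complex_of_real (a s * dsq M (t - s))) = of_real (integral {0..2*pi} (\<lambda>s. a s * dsq M (t - s)))"
    by (intro integral_of_real_complex continuous_intros)
  moreover have "fsum M (\<lambda>s. of_real (a s)) t = integral {0..2*pi} (\<lambda>s. complex_of_real (a s) * complex_of_real (dsq M (t - s))) / (2*pi)"
    by (intro fsum_conv continuous_intros)
  ultimately show ?thesis by (simp add: tmean_def)
qed

lemma norm_fsum_le:
  assumes [continuous_intros]: "continuous_on {0..2*pi} a"
  shows "cmod (fsum M a t) \<le> tmean (\<lambda>s. cmod (a s) * dsq M (t - s))"
proof -
  have "cmod (integral {0..2*pi} (\<lambda>s. a s * of_real (dsq M (t - s)))) \<le>
      integral {0..2*pi} (\<lambda>s. cmod (a s) * dsq M (t - s))"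
    by (rule integral_norm_bound_integral)
       (auto intro!: integrable_continuous_real continuous_intros simp: norm_mult)
  then show ?thesis
    by (simp add: fsum_conv[OF assms] tmean_def norm_divide divide_right_mono)
qed

lemma tmean_dsq: "tmean (\<lambda>s. dsq M (t - s)) = real M"
proof -
  have "fcoef (\<lambda>s. 1) k = (if k = 0 then 1 else 0)" for k
    using fcoef_cis[of 0 k] by auto
  then have "fsum M (\<lambda>s. of_real 1) t = (\<Sum>i<M. \<Sum>j<M. if i = j then 1 else 0)"
    unfolding fsum_def by (intro sum.cong) auto
  also have "\<dots> = of_nat M" by simp
  finally have "of_real (tmean (\<lambda>s. 1 * dsq M (t - s))) = (of_nat M :: complex)"
    by (subst (asm) fsum_real) auto
  then have "of_real (tmean (\<lambda>s. dsq M (t - s))) = (of_real (real M) :: complex)" by simp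
  then show ?thesis by (simp only: of_real_eq_iff)
qed

lemma tmean_dsq': "tmean (\<lambda>s. dsq M (s - t)) = real M"
  using tmean_dsq[of M t] dsq_minus[of M "t - _"] by simp

lemma jensen_dsq:
  assumes a [continuous_intros]: "continuous_on {0..2*pi} a" "\<And>s. 0 \<le> a s" and p: "1 \<le> p" and M: "M > 0"
  shows "(tmean (\<lambda>s. a s * dsq M (t - s)) / M) powr p \<le> tmean (\<lambda>s. a s powr p * dsq M (t - s)) / M"
proof -
  have "tmean (\<lambda>s. (dsq M (t - s) / M) * a s) powr p \<le> tmean (\<lambda>s. (dsq M (t - s) / M) * a s powr p)"
  proof (rule jensen_tmean_powr)
    show "tmean (\<lambda>s. dsq M (t - s) / real M) = 1"
      using tmean_cmult[of "1/M" "\<lambda>s. dsq M (t - s)"] M by (simp add: tmean_dsq)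
  qed (use a p M in \<open>auto intro!: continuous_intros\<close>)
  moreover have "(\<lambda>s. (dsq M (t - s) / M) * f s) = (\<lambda>s. (1/M) * (f s * dsq M (t - s)))" for f
    by (auto simp: field_simps)
  ultimately have "tmean (\<lambda>s. (1/M) * (a s * dsq M (t - s))) powr p \<le> tmean (\<lambda>s. (1/M) * (a s powr p * dsq M (t - s)))"
    by simp
  then show ?thesis unfolding tmean_cmult by simp
qed

section \<open>Sums over equispaced points\<close>

lemma sum_cis_grid:
  assumes "N > 0" "\<not> int N dvd k"
  shows "(\<Sum>s<N. cis (of_int k * (x + 2*pi*real s/real N))) = 0"
proof -
  define w where "w = cis (of_int k * (2*pi/real N))"
  have "w \<noteq> 1"
  proof
    assume "w = 1"
    then have "cos (of_int k * (2*pi/real N)) = 1" by (simp add: w_def complex_eq_iff)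
    then obtain j :: int where j: "of_int k * (2*pi/real N) = of_int j * 2 * pi"
      by (auto simp: cos_one_2pi_int)
    then have "of_int k = of_int j * real N" using assms by (simp add: field_simps)
    then have "k = j * int N" by (metis of_int_eq_iff of_int_mult of_int_of_nat_eq)
    then show False using assms by simp
  qed
  have "w ^ N = 1"
  proof -
    have "w ^ N = cis (real N * (of_int k * (2*pi/real N)))" by (simp only: w_def Complex.DeMoivre)
    also have "real N * (of_int k * (2*pi/real N)) = of_int k * (0 + 2*pi)" using assms by simp
    finally show ?thesis by (simp only: cis_2pi_int) simp
  qed
  have "(\<Sum>s<N. cis (of_int k * (x + 2*pi*real s/real N))) = cis (of_int k * x) * (\<Sum>s<N. w ^ s)"
    by (simp only: w_def Complex.DeMoivre sum_distrib_left cis_mult) (simp add: algebra_simps)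
  also have "(\<Sum>s<N. w ^ s) = 0"
    using \<open>w \<noteq> 1\<close> \<open>w ^ N = 1\<close> by (simp add: geometric_sum)
  finally show ?thesis by simp
qed

text \<open>The frequencies of \<open>dsq M\<close> are smaller than \<open>M \<le> N\<close> in
  modulus, so none except 0 is a multiple of \<open>N\<close>: the grid average equals the mean
  \<open>M\<close> exactly, wherever the grid starts.\<close>

lemma sum_dsq_grid:
  assumes "M \<le> N" "N > 0"
  shows "(\<Sum>s<N. dsq M (x + 2*pi*real s/real N)) = real N * real M"
proof -
  have "of_real (\<Sum>s<N. dsq M (x + 2*pi*real s/real N)) =
     (\<Sum>s<N. \<Sum>i<M. \<Sum>j<M. cis (of_int (int i - int j) * (x + 2*pi*real s/real N)))"
    by (simp only: of_real_sum dsq_expand)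
  also have "\<dots> = (\<Sum>i<M. \<Sum>j<M. \<Sum>s<N. cis (of_int (int i - int j) * (x + 2*pi*real s/real N)))"
    by (rule sum_rotate[symmetric])
  also have "\<dots> = (\<Sum>i<M. \<Sum>j<M. if i = j then of_nat N else 0)"
  proof (intro sum.cong refl)
    fix i j assume "i \<in> {..<M}" "j \<in> {..<M}"
    then have "\<not> int N dvd (int i - int j)" if "i \<noteq> j"
      using that assms dvd_imp_le_int[of "int i - int j" "int N"] by auto
    then show "(\<Sum>s<N. cis (of_int (int i - int j) * (x + 2*pi*real s/real N))) = (if i = j then of_nat N else 0)"
      using sum_cis_grid[OF assms(2), of "int i - int j" x] by (cases "i = j") auto
  qed
  also have "\<dots> = of_real (real N * real M)" by simp
  finally show ?thesis by (simp only: of_real_eq_iff)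
qed

text \<open>Enlarging the square of index pairs by one row and one column adds each difference from
  \<open>-M\<close> to \<open>M\<close> exactly once. Once \<open>M\<close> is past the support of
  \<open>g\<close>, every enlargement therefore adds the whole sum of \<open>g\<close>.\<close>

lemma sum_diff_Suc:
  fixes g :: "int \<Rightarrow> complex"
  shows "(\<Sum>i<Suc M. \<Sum>j<Suc M. g (int i - int j)) =
     (\<Sum>i<M. \<Sum>j<M. g (int i - int j)) + (\<Sum>k\<in>{-int M..int M}. g k)"
proof -
  have 1: "(\<Sum>i<M. g (int i - int M)) = (\<Sum>k\<in>{-int M..-1}. g k)"
    by (rule sum.reindex_bij_witness[where i = "\<lambda>k. nat (k + int M)" and j = "\<lambda>i. int i - int M"]) auto
  have 2: "(\<Sum>j<M. g (int M - int j)) = (\<Sum>k\<in>{1..int M}. g k)"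
    by (rule sum.reindex_bij_witness[where i = "\<lambda>k. nat (int M - k)" and j = "\<lambda>i. int M - int i"]) auto
  have "{-int M..int M} = {-int M..-1} \<union> ({0} \<union> {1..int M})" by auto
  then have "(\<Sum>k\<in>{-int M..int M}. g k) = (\<Sum>k\<in>{-int M..-1}. g k) + (g 0 + (\<Sum>k\<in>{1..int M}. g k))"
    by (simp only:) (subst sum.union_disjoint; force)+
  then show ?thesis by (simp add: sum.distrib flip: 1 2)
qed

text \<open>Up to a factor, \<open>2 F\<^bsub>2K\<^esub> - F\<^bsub>K\<^esub>\<close> reproduces all frequencies up to \<open>K\<close>.\<close>

lemma vallee_poussin_sum:
  fixes g :: "int \<Rightarrow> complex"
  assumes "\<And>k. \<bar>k\<bar> > int K \<Longrightarrow> g k = 0"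
  shows "(\<Sum>i<2*K. \<Sum>j<2*K. g (int i - int j)) - (\<Sum>i<K. \<Sum>j<K. g (int i - int j))
     = of_nat K * (\<Sum>k\<in>{-int K..int K}. g k)"
proof -
  have "(\<Sum>i<K+r. \<Sum>j<K+r. g (int i - int j)) - (\<Sum>i<K. \<Sum>j<K. g (int i - int j))
     = of_nat r * (\<Sum>k\<in>{-int K..int K}. g k)" for r
  proof (induction r)
    case (Suc r)
    have "(\<Sum>k\<in>{-int (K+r)..int (K+r)}. g k) = (\<Sum>k\<in>{-int K..int K}. g k)"
      using assms by (intro sum.mono_neutral_right) auto
    then show ?case using Suc sum_diff_Suc[of g "K + r"] by (simp add: algebra_simps)
  qed simp
  from this[of K] show ?thesis by (simp add: mult_2)
qed

text \<open>The de la Vallee Poussin kernel: as \<open>dsq M / M\<close> is the Fejer kernel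
  \<open>F_M\<close>, this is \<open>2 F_2K - F_K\<close>. Its coefficients are 1 for
  \<open>\<bar>k\<bar> \<le> K\<close> and fall linearly to 0 at
  \<open>\<bar>k\<bar> = 2K\<close>.\<close>

definition vp :: "nat \<Rightarrow> real \<Rightarrow> real" where
  "vp K x = (dsq (2*K) x - dsq K x) / real K"

lemma fcoef_trig:
  fixes c :: "int \<Rightarrow> complex"
  assumes T: "\<And>t. T t = (\<Sum>k\<in>{-int K..int K}. c k * cis (of_int k * t))"
  shows "fcoef T k = (if \<bar>k\<bar> \<le> int K then c k else 0)"
proof -
  have "T = (\<lambda>t. \<Sum>k\<in>{-int K..int K}. c k * cis (of_int k * t))"
    using T by auto
  then have "fcoef T k = (\<Sum>j\<in>{-int K..int K}. fcoef (\<lambda>t. c j * cis (of_int j * t)) k)"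
    by (simp only:) (intro fcoef_sum continuous_intros finite_atLeastAtMost_int)
  also have "\<dots> = (\<Sum>j\<in>{-int K..int K}. if j = k then c j else 0)"
    by (simp add: fcoef_cmult fcoef_cis if_distrib cong: if_cong)
  finally show ?thesis by auto
qed

lemma continuous_on_trig:
  fixes c :: "int \<Rightarrow> complex"
  assumes T: "\<And>t. T t = (\<Sum>k\<in>{-int K..int K}. c k * cis (of_int k * t))"
  shows "continuous_on A T"
proof -
  have "T = (\<lambda>t. \<Sum>k\<in>{-int K..int K}. c k * cis (of_int k * t))"
    using T by auto
  then show ?thesis by (simp only:) (intro continuous_intros)
qed

text \<open>The factor \<open>h\<close> is carried along so that one identity serves twice:
  \<open>h = 1\<close> reproduces \<open>T\<close>, and the indicator of \<open>k \<ge> 0\<close>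
  reproduces its analytic part.\<close>

lemma vallee_poussin_filter:
  fixes c h :: "int \<Rightarrow> complex"
  assumes T: "\<And>t. T t = (\<Sum>k\<in>{-int K..int K}. c k * cis (of_int k * t))"
  shows "(\<Sum>i<2*K. \<Sum>j<2*K. h (int i - int j) * fcoef T (int i - int j) * cis (of_int (int i - int j) * t))
    - (\<Sum>i<K. \<Sum>j<K. h (int i - int j) * fcoef T (int i - int j) * cis (of_int (int i - int j) * t))
    = of_nat K * (\<Sum>k\<in>{-int K..int K}. h k * c k * cis (of_int k * t))"
proof -
  have "(\<Sum>i<2*K. \<Sum>j<2*K. h (int i - int j) * fcoef T (int i - int j) * cis (of_int (int i - int j) * t))
    - (\<Sum>i<K. \<Sum>j<K. h (int i - int j) * fcoef T (int i - int j) * cis (of_int (int i - int j) * t))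
    = of_nat K * (\<Sum>k\<in>{-int K..int K}. h k * fcoef T k * cis (of_int k * t))"
    by (rule vallee_poussin_sum[where g = "\<lambda>k. h k * fcoef T k * cis (of_int k * t)"])
       (use fcoef_trig[OF T] in auto)
  also have "(\<Sum>k\<in>{-int K..int K}. h k * fcoef T k * cis (of_int k * t)) = (\<Sum>k\<in>{-int K..int K}. h k * c k * cis (of_int k * t))"
    by (intro sum.cong refl) (auto simp: fcoef_trig[OF T])
  finally show ?thesis .
qed

text \<open>The reproducing kernel \<open>2 F_2K - F_K\<close> changes sign, so Jensen's inequality
  is applied to its two positive pieces separately, at the price of the factor
  \<open>4 powr p\<close>.\<close>

lemma norm_trig_powr_le:
  fixes c :: "int \<Rightarrow> complex"
  assumes T: "\<And>t. T t = (\<Sum>k\<in>{-int K..int K}. c k * cis (of_int k * t))"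
    and K: "K > 0" and p: "1 \<le> p"
  shows "cmod (T t) powr p \<le> 4 powr p * (tmean (\<lambda>s. cmod (T s) powr p * dsq (2*K) (t - s)) / real (2*K)
     + tmean (\<lambda>s. cmod (T s) powr p * dsq K (t - s)) / real K)"
proof -
  define Y where "Y = (\<lambda>M. tmean (\<lambda>s. cmod (T s) * dsq M (t - s)) / real M)"
  note [continuous_intros] = continuous_on_trig[OF T]
  have Y0: "Y M \<ge> 0" for M
    unfolding Y_def by (intro divide_nonneg_nonneg tmean_nonneg continuous_intros) auto
  have "of_nat K * T t = fsum (2*K) T t - fsum K T t"
    using vallee_poussin_filter[OF T, of "\<lambda>_. 1" t] T[of t] by (simp add: fsum_def)
  then have "real K * cmod (T t) = cmod (fsum (2*K) T t - fsum K T t)"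
    by (metis norm_mult norm_of_nat)
  also have "\<dots> \<le> cmod (fsum (2*K) T t) + cmod (fsum K T t)"
    by (rule norm_triangle_ineq4)
  also have "\<dots> \<le> real (2*K) * Y (2*K) + real K * Y K"
    using norm_fsum_le[of T "2*K" t] norm_fsum_le[of T K t] continuous_on_trig[OF T] K
    by (simp add: Y_def)
  also have "\<dots> \<le> real K * (2 * (Y (2*K) + Y K))"
    using Y0[of K] by (simp add: algebra_simps)
  finally have "cmod (T t) \<le> 2 * (Y (2*K) + Y K)"
    using K by simp
  then have "cmod (T t) powr p \<le> 4 powr p * (Y (2*K) powr p + Y K powr p)"
    using Y0 p by (intro powr_le_twice_add) auto
  also have "\<dots> \<le> 4 powr p * (tmean (\<lambda>s. cmod (T s) powr p * dsq (2*K) (t - s)) / real (2*K)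
     + tmean (\<lambda>s. cmod (T s) powr p * dsq K (t - s)) / real K)"
    unfolding Y_def using K p
    by (intro mult_left_mono add_mono jensen_dsq continuous_intros) auto
  finally show ?thesis .
qed

lemma sum_tmean_dsq_grid:
  assumes [continuous_intros]: "continuous_on {0..2*pi} a" and M: "0 < M" "M \<le> N"
  shows "(\<Sum>s<N. tmean (\<lambda>x. a x * dsq M (2*pi*real s/real N - x)) / real M) = real N * tmean a"
proof -
  have "(\<Sum>s<N. tmean (\<lambda>x. a x * dsq M (2*pi*real s/real N - x)) / real M)
     = tmean (\<lambda>x. \<Sum>s<N. a x * dsq M (2*pi*real s/real N - x)) / real M"
    by (subst tmean_sum) (auto intro!: continuous_intros simp: sum_divide_distrib)
  also have "(\<lambda>x. \<Sum>s<N. a x * dsq M (2*pi*real s/real N - x)) = (\<lambda>x. (real N * real M) * a x)"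
  proof
    fix x
    show "(\<Sum>s<N. a x * dsq M (2*pi*real s/real N - x)) = (real N * real M) * a x"
      using sum_dsq_grid[of M N "-x"] M
      by (simp add: algebra_simps flip: sum_distrib_left)
  qed
  finally show ?thesis using M by (simp only: tmean_cmult) simp
qed

text \<open>The orders \<open>2*m\<close> and \<open>m\<close> of the two kernels in the pointwise
  bound do not exceed the number \<open>2*m\<close> of nodes. Summed over the nodes, each kernel
  thus becomes a constant and only the mean of \<open>cmod (T t) powr p\<close> remains.\<close>

lemma marcinkiewicz_zygmund:
  fixes c :: "int \<Rightarrow> complex"
  assumes T: "\<And>t. T t = (\<Sum>k\<in>{-int m..int m}. c k * cis (of_int k * t))"
    and m: "m > 0" and p: "1 \<le> p"
  shows "(\<Sum>i<2*m. cmod (T (pi * real i / real m)) powr p) \<le> 2 * 4 powr p * (real (2*m) * tmean (\<lambda>t. cmod (T t) powr p))"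
proof -
  note [continuous_intros] = continuous_on_trig[OF T]
  have c: "continuous_on {0..2*pi} (\<lambda>t. cmod (T t) powr p)"
    using p by (intro continuous_on_powr' continuous_intros) auto
  have eq: "pi * real i / real m = 2*pi*real i/real (2*m)" for i by simp
  let ?S = "\<lambda>M. \<Sum>i<2*m. tmean (\<lambda>s. cmod (T s) powr p * dsq M (pi * real i / real m - s)) / real M"
  have "(\<Sum>i<2*m. cmod (T (pi * real i / real m)) powr p) \<le>
     (\<Sum>i<2*m. 4 powr p * (tmean (\<lambda>s. cmod (T s) powr p * dsq (2*m) (pi * real i / real m - s)) / real (2*m)
     + tmean (\<lambda>s. cmod (T s) powr p * dsq m (pi * real i / real m - s)) / real m))"
    by (intro sum_mono norm_trig_powr_le[OF T m p])
  also have "\<dots> = 4 powr p * (?S (2*m) + ?S m)"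
    by (simp only: sum_distrib_left sum.distrib distrib_left)
  also have "?S (2*m) = real (2*m) * tmean (\<lambda>t. cmod (T t) powr p)"
    unfolding eq by (rule sum_tmean_dsq_grid[OF c]) (use m in auto)
  also have "?S m = real (2*m) * tmean (\<lambda>t. cmod (T t) powr p)"
    unfolding eq by (rule sum_tmean_dsq_grid[OF c]) (use m in auto)
  finally show ?thesis by simp
qed

text \<open>The dual inequality: a measure carried by the nodes, smoothed by \<open>vp m\<close>, is
  controlled by its discrete norm. The Fejer weights \<open>w M i t\<close> have sum 1 over the
  nodes \<open>i\<close>, which permits Jensen's inequality for each \<open>t\<close>, and mean
  \<open>1 / (2*m)\<close> in \<open>t\<close>, which then evaluates the mean.\<close>

lemma tmean_vp_sum_le:
  fixes a :: "nat \<Rightarrow> complex"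
  assumes m: "m > 0" and p: "1 \<le> p"
  shows "real (2*m) * tmean (\<lambda>t. cmod ((\<Sum>i<2*m. a i * of_real (vp m (t - pi * real i / real m))) / of_nat (2*m)) powr p)
    \<le> 2 * 4 powr p * (\<Sum>i<2*m. cmod (a i) powr p)"
proof -
  define w where "w = (\<lambda>M i t. dsq M (t - pi * real i / real m) / (real (2*m) * real M))"
  have w0: "w M i t \<ge> 0" for M i t by (simp add: w_def)
  have [continuous_intros]: "continuous_on A (w M i)" for A M i
    unfolding w_def using m by (cases "M = 0") (auto intro!: continuous_intros)
  have w1: "(\<Sum>i<2*m. w M i t) = 1" if "0 < M" "M \<le> 2*m" for M t
  proof -
    have "dsq M (t - pi * real i / real m) = dsq M (- t + 2 * pi * real i / real (2*m))" for i
      using dsq_minus[of M "t - pi * real i / real m"] by simp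
    then show ?thesis
      using sum_dsq_grid[of M "2*m" "-t"] that by (simp add: w_def flip: sum_divide_distrib)
  qed
  have wm: "tmean (w M i) = 1 / real (2*m)" if "M > 0" for M i
    using that tmean_cmult[of "1 / (real (2*m) * real M)" "\<lambda>t. dsq M (t - pi * real i / real m)"]
    by (simp add: w_def tmean_dsq')
  define Y where "Y = (\<lambda>M t. \<Sum>i<2*m. w M i t * cmod (a i))"
  have Y0: "Y M t \<ge> 0" for M t unfolding Y_def by (intro sum_nonneg mult_nonneg_nonneg w0) auto
  have b: "cmod ((\<Sum>i<2*m. a i * of_real (vp m (t - pi * real i / real m))) / of_nat (2*m)) powr p
     \<le> 4 powr p * ((\<Sum>i<2*m. w (2*m) i t * cmod (a i) powr p) + (\<Sum>i<2*m. w m i t * cmod (a i) powr p))" for t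
  proof -
    have "(\<Sum>i<2*m. a i * of_real (vp m (t - pi * real i / real m))) / of_nat (2*m)
      = (\<Sum>i<2*m. a i * of_real (2 * w (2*m) i t - w m i t))"
      unfolding sum_divide_distrib
      by (intro sum.cong refl) (use m in \<open>simp add: vp_def w_def field_simps\<close>)
    also have "cmod \<dots> \<le> (\<Sum>i<2*m. cmod (a i) * (2 * w (2*m) i t + w m i t))"
    proof (intro order_trans[OF norm_sum] sum_mono)
      fix i
      have "\<bar>2 * w (2*m) i t - w m i t\<bar> \<le> 2 * w (2*m) i t + w m i t"
        using w0[of "2*m" i t] w0[of m i t] by linarith
      then show "cmod (a i * of_real (2 * w (2*m) i t - w m i t)) \<le> cmod (a i) * (2 * w (2*m) i t + w m i t)"
        by (simp only: norm_mult norm_of_real mult_left_mono norm_ge_zero)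
    qed
    also have "\<dots> = 2 * Y (2*m) t + Y m t"
      by (simp add: Y_def sum.distrib sum_distrib_left algebra_simps)
    also have "\<dots> \<le> 2 * (Y (2*m) t + Y m t)" using Y0[of m t] by simp
    finally have "cmod ((\<Sum>i<2*m. a i * of_real (vp m (t - pi * real i / real m))) / of_nat (2*m)) powr p
      \<le> 4 powr p * (Y (2*m) t powr p + Y m t powr p)"
      using Y0 p by (intro powr_le_twice_add) auto
    also have "\<dots> \<le> 4 powr p * ((\<Sum>i<2*m. w (2*m) i t * cmod (a i) powr p) + (\<Sum>i<2*m. w m i t * cmod (a i) powr p))"
      unfolding Y_def using w0 w1 m p
      by (intro mult_left_mono add_mono jensen_sum_powr) auto
    finally show ?thesis .
  qed
  have "tmean (\<lambda>t. cmod ((\<Sum>i<2*m. a i * of_real (vp m (t - pi * real i / real m))) / of_nat (2*m)) powr p)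
    \<le> tmean (\<lambda>t. 4 powr p * ((\<Sum>i<2*m. w (2*m) i t * cmod (a i) powr p) + (\<Sum>i<2*m. w m i t * cmod (a i) powr p)))"
    using m p unfolding vp_def
    by (intro tmean_mono b[unfolded vp_def] continuous_on_powr' continuous_intros) auto
  also have "\<dots> = 4 powr p * ((\<Sum>i<2*m. tmean (\<lambda>t. cmod (a i) powr p * w (2*m) i t)) + (\<Sum>i<2*m. tmean (\<lambda>t. cmod (a i) powr p * w m i t)))"
    by (subst tmean_cmult, subst tmean_add, (intro continuous_intros)+)
       (simp add: tmean_sum continuous_intros mult.commute)
  also have "\<dots> = 4 powr p * (2 * ((\<Sum>i<2*m. cmod (a i) powr p) / real (2*m)))"
    using m by (simp only: tmean_cmult wm) (simp add: sum_divide_distrib)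
  finally show ?thesis using m by (simp add: field_simps)
qed

section \<open>M. Riesz's theorem\<close>

lemma continuous_on_cmod_powr:
  fixes f :: "'a::topological_space \<Rightarrow> complex"
  assumes "continuous_on A f" "0 < p"
  shows "continuous_on A (\<lambda>t. cmod (f t) powr p)"
  using assms by (intro continuous_on_powr' continuous_intros) auto

section \<open>Functions with nonnegative real part, for exponents up to 2\<close>

text \<open>After division by \<open>cmod z powr p\<close> only the argument \<theta> matters. Away
  from the imaginary axis \<open>cos \<theta>\<close> is bounded below and the \<open>A\<close> term
  suffices; near it \<open>cos (p * \<theta>)\<close> is negative, because \<open>p > 1\<close>
  carries the angle past \<open>pi/2\<close> and \<open>p \<le> 2\<close> keeps it at most
  \<open>pi\<close>, so the \<open>B\<close> term suffices.\<close>

lemma pichorides_pointwise: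
  fixes p :: real
  assumes "1 < p" "p \<le> 2"
  shows "\<exists>A B. 0 \<le> A \<and> 0 \<le> B \<and>
    (\<forall>z::complex. Re z > 0 \<longrightarrow> cmod z powr p \<le> A * Re z powr p - B * Re (z powr of_real p))"
proof -
  \<comment> \<open>The midpoint of \<open>pi/(2*p)\<close> and \<open>pi/2\<close>: strictly below
    \<open>pi/2\<close>, so that \<open>cos \<phi> > 0\<close>, and strictly above
    \<open>pi/(2*p)\<close>, so that \<open>cos (p * \<phi>) < 0\<close>.\<close>
  define \<phi> where "\<phi> = (pi / (2*p) + pi/2) / 2"
  have pp: "p * \<phi> = pi/4 + p * pi/4" using assms by (simp add: \<phi>_def field_simps)
  have \<phi>: "0 < \<phi>" "\<phi> < pi/2" "pi/2 < p * \<phi>" "p * \<phi> \<le> pi"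
  proof -
    have "pi / (2*p) < pi / 2" using assms by (simp add: field_simps)
    then show "\<phi> < pi/2" unfolding \<phi>_def by simp
    show "0 < \<phi>" unfolding \<phi>_def using assms by (intro divide_pos_pos add_pos_pos) auto
    have "1 * pi < p * pi" using assms by (intro mult_strict_right_mono) auto
    then show "pi/2 < p * \<phi>" unfolding pp by linarith
    have "p * pi \<le> 2 * pi" using assms by (intro mult_right_mono) auto
    then show "p * \<phi> \<le> pi" unfolding pp using pi_gt_zero by linarith
  qed
  define \<delta> where "\<delta> = - cos (p * \<phi>)"
  have \<delta>: "\<delta> > 0"
  proof -
    have "cos (p * \<phi>) < cos (pi/2)" by (rule cos_monotone_0_pi) (use \<phi> in auto)
    then show ?thesis by (simp add: \<delta>_def)
  qed
  have c\<phi>: "cos \<phi> > 0" using \<phi> by (intro cos_gt_zero_pi) auto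
  define B where "B = 1 / \<delta>"
  define A where "A = (1 + B) / cos \<phi> powr p"
  have B: "B \<ge> 0" using \<delta> by (simp add: B_def)
  have A: "A \<ge> 0" using B by (simp add: A_def)
  have angle: "1 \<le> A * cos \<theta> powr p - B * cos (p * \<theta>)" if "0 \<le> \<theta>" "\<theta> < pi/2" for \<theta>
  proof (cases "\<theta> < \<phi>")
    case True
    have "cos \<phi> \<le> cos \<theta>" using True \<phi> that by (intro cos_monotone_0_pi_le) auto
    then have "cos \<phi> powr p \<le> cos \<theta> powr p" using c\<phi> assms by (intro powr_mono2) auto
    then have "A * cos \<theta> powr p \<ge> A * cos \<phi> powr p" using A by (intro mult_left_mono)
    moreover have "A * cos \<phi> powr p = 1 + B" using c\<phi> by (simp add: A_def)
    moreover have "B * cos (p * \<theta>) \<le> B * 1" using B by (intro mult_left_mono) auto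
    ultimately show ?thesis by simp
  next
    case False
    have "p * \<theta> \<le> pi"
    proof -
      have "p * \<theta> \<le> 2 * (pi/2)" using assms that by (intro mult_mono) auto
      then show ?thesis by simp
    qed
    moreover have "p * \<phi> \<le> p * \<theta>" using False assms by simp
    ultimately have "cos (p * \<theta>) \<le> cos (p * \<phi>)" using \<phi> by (intro cos_monotone_0_pi_le) auto
    then have "B * cos (p * \<theta>) \<le> B * (- \<delta>)" using B by (intro mult_left_mono) (auto simp: \<delta>_def)
    also have "\<dots> = -1" using \<delta> by (simp add: B_def)
    finally have "1 \<le> - (B * cos (p * \<theta>))" by simp
    moreover have "0 \<le> A * cos \<theta> powr p" using A by simp
    ultimately show ?thesis by linarith
  qed
  have "cmod z powr p \<le> A * Re z powr p - B * Re (z powr of_real p)" if z: "Re z > 0" for z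
  proof -
    have "z \<noteq> 0" using z by auto
    define \<theta> where "\<theta> = Im (Ln z)"
    have \<theta>: "\<bar>\<theta>\<bar> < pi/2" unfolding \<theta>_def using Re_Ln_pos_lt[OF \<open>z \<noteq> 0\<close>] z by simp
    have lnz: "Ln z = Complex (ln (cmod z)) \<theta>"
      using \<open>z \<noteq> 0\<close> by (simp add: complex_eq_iff \<theta>_def)
    have "Re z = exp (Re (Ln z)) * cos (Im (Ln z))"
      using \<open>z \<noteq> 0\<close> by (metis Re_exp exp_Ln)
    then have rz: "Re z = cmod z * cos \<theta>" using \<open>z \<noteq> 0\<close> by (simp add: \<theta>_def)
    have "Re (z powr of_real p) = exp (p * ln (cmod z)) * cos (p * \<theta>)"
      using \<open>z \<noteq> 0\<close> by (simp add: powr_def Re_exp lnz)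
    then have rp: "Re (z powr of_real p) = cmod z powr p * cos (p * \<theta>)"
      using \<open>z \<noteq> 0\<close> by (simp add: powr_def)
    have c: "cos \<theta> > 0" using \<theta> by (intro cos_gt_zero_pi) auto
    have "1 \<le> A * cos \<theta> powr p - B * cos (p * \<theta>)"
      using angle[of "\<bar>\<theta>\<bar>"] \<theta> by (auto simp: abs_if split: if_splits)
    then have "cmod z powr p * 1 \<le> cmod z powr p * (A * cos \<theta> powr p - B * cos (p * \<theta>))"
      by (intro mult_left_mono) auto
    also have "\<dots> = A * Re z powr p - B * Re (z powr of_real p)"
      using c by (simp add: rz rp powr_mult algebra_simps)
    finally show ?thesis by simp
  qed
  then show ?thesis using A B by blast
qed

lemma tmean_holomorphic:
  assumes "continuous_on (cball 0 1) f" "f holomorphic_on ball 0 1"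
  shows "tmean (\<lambda>t. Re (f (cis t))) = Re (f 0)"
proof -
  have "((\<lambda>u. f u/(u-0)) has_contour_integral (2 * of_real pi * \<i> * f 0)) (circlepath 0 1)"
    using assms by (intro Cauchy_integral_circlepath) auto
  then have "((\<lambda>t. f (0 + 1 * cis t)/(0 + 1 * cis t - 0) * 1 * \<i> * cis t) has_integral (2 * of_real pi * \<i> * f 0)) {0..2*pi}"
    unfolding circlepath_def by (subst (asm) has_contour_integral_part_circlepath_iff) auto
  then have "((\<lambda>t. f (cis t) * \<i>) has_integral (2 * of_real pi * \<i> * f 0)) {0..2*pi}"
    by (simp add: field_simps cong: has_integral_cong)
  from has_integral_mult_right[OF this, of "- \<i>"]
  have "((\<lambda>t. f (cis t)) has_integral (2 * of_real pi * f 0)) {0..2*pi}"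
    by (simp add: algebra_simps)
  then have "((\<lambda>t. Re (f (cis t))) has_integral Re (2 * of_real pi * f 0)) {0..2*pi}"
    by (rule has_integral_Re)
  then show ?thesis by (simp add: tmean_def integral_unique)
qed

lemma continuous_on_entire_cis:
  assumes "G holomorphic_on UNIV"
  shows "continuous_on A (\<lambda>t. G (cis t))"
  by (rule continuous_on_compose2[of UNIV G])
     (use assms in \<open>auto intro!: holomorphic_on_imp_continuous_on continuous_intros\<close>)

text \<open>The mean of \<open>G powr p\<close> over the circle is \<open>G 0 powr p\<close>, which is positive, so after integration the
  second term of the pointwise inequality only helps.\<close>

lemma riesz_positive_real_part:
  fixes p :: real
  assumes "1 < p" "p \<le> 2"
  shows "\<exists>C\<ge>0. \<forall>G. G holomorphic_on UNIV \<longrightarrow> Im (G 0) = 0 \<longrightarrow> (\<forall>t. Re (G (cis t)) > 0) \<longrightarrow>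
    tmean (\<lambda>t. cmod (G (cis t)) powr p) \<le> C * tmean (\<lambda>t. Re (G (cis t)) powr p)"
proof -
  obtain A B where A: "A \<ge> 0" and B: "B \<ge> 0" and
    pw: "\<And>z::complex. Re z > 0 \<Longrightarrow> cmod z powr p \<le> A * Re z powr p - B * Re (z powr of_real p)"
    using pichorides_pointwise[OF assms] by blast
  have "tmean (\<lambda>t. cmod (G (cis t)) powr p) \<le> A * tmean (\<lambda>t. Re (G (cis t)) powr p)"
    if hol: "G holomorphic_on UNIV" and im: "Im (G 0) = 0" and pos: "\<And>t. Re (G (cis t)) > 0" for G
  proof -
    have contG: "continuous_on S G" for S
      using hol holomorphic_on_imp_continuous_on continuous_on_subset by blast
    note [continuous_intros] = continuous_on_entire_cis[OF hol]
    have posS: "Re (G z) > 0" if "z \<in> sphere 0 1" for z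
      using pos[of "Arg z"] that cis_Arg[of z] by (cases "z = 0") (auto simp: sgn_eq)
    obtain z0 where z0: "z0 \<in> sphere 0 1" "\<And>z. z \<in> sphere 0 1 \<Longrightarrow> Re (G z0) \<le> Re (G z)"
    proof -
      have "continuous_on (sphere 0 1) (\<lambda>z. Re (G z))" by (intro continuous_intros contG)
      from continuous_attains_inf[OF _ _ this]
      have "\<exists>x\<in>sphere 0 1. \<forall>y\<in>sphere 0 1. Re (G x) \<le> Re (G y)" by auto
      then show thesis using that by blast
    qed
    \<comment> \<open>The maximum principle for \<open>Re (- G)\<close> carries positivity of the
      real part from the circle into the disc. Hence \<open>G\<close> avoids the branch cut and its
      principal power is holomorphic inside.\<close>
    have posB: "Re (G z) > 0" if "z \<in> cball 0 1" for z
    proof -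
      have "Re (- G z) \<le> - Re (G z0)"
      proof (rule maximum_real_frontier[where f = "\<lambda>z. - G z" and S = "cball 0 1"])
        show "(\<lambda>z. - G z) holomorphic_on interior (cball 0 1)"
          using hol by (intro holomorphic_intros) (auto intro: holomorphic_on_subset)
      qed (use that z0 contG in \<open>auto intro!: continuous_intros\<close>)
      then show ?thesis using posS[OF z0(1)] by simp
    qed
    have nonneg: "G z \<notin> \<real>\<^sub>\<le>\<^sub>0" if "z \<in> cball 0 1" for z
      using posB[OF that] by (auto simp: complex_nonpos_Reals_iff)
    have "tmean (\<lambda>t. Re (G (cis t) powr of_real p)) = Re (G 0 powr of_real p)"
    proof (rule tmean_holomorphic[where f = "\<lambda>z. G z powr of_real p"])
      show "continuous_on (cball 0 1) (\<lambda>z. G z powr of_real p)"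
      proof (rule continuous_on_powr_complex)
        show "cball 0 1 \<subseteq> {z. 0 \<le> Re (G z) \<or> Im (G z) \<noteq> 0}"
          using posB by (auto intro: less_imp_le)
      qed (use assms contG in auto)
      show "(\<lambda>z. G z powr of_real p) holomorphic_on ball 0 1"
        using hol nonneg by (intro holomorphic_intros) (auto intro: holomorphic_on_subset)
    qed
    \<comment> \<open>Here the normalisation \<open>Im (G 0) = 0\<close> enters: \<open>G 0\<close>
      is a positive real number, and so is its power.\<close>
    moreover have "Re (G 0 powr of_real p) \<ge> 0"
    proof -
      have "G 0 = of_real (Re (G 0))" using im by (simp add: complex_eq_iff)
      then have "G 0 powr of_real p = of_real (Re (G 0) powr p)"
        using posB[of 0] powr_of_real[of "Re (G 0)" p] by (metis centre_in_cball less_imp_le zero_le_one)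
      then show ?thesis by simp
    qed
    ultimately have mv: "tmean (\<lambda>t. Re (G (cis t) powr of_real p)) \<ge> 0" by simp
    have cp: "continuous_on {0..2*pi} (\<lambda>t. G (cis t) powr of_real p)"
    proof (rule continuous_on_powr_complex)
      show "{0..2*pi} \<subseteq> {t. 0 \<le> Re (G (cis t)) \<or> Im (G (cis t)) \<noteq> 0}"
        using pos by (auto intro: less_imp_le)
    qed (use assms in \<open>auto intro!: continuous_intros\<close>)
    have cr: "continuous_on {0..2*pi} (\<lambda>t. Re (G (cis t)) powr p)"
      using assms pos by (intro continuous_on_powr' continuous_intros) (auto intro: less_imp_le)
    have "tmean (\<lambda>t. cmod (G (cis t)) powr p)
      \<le> tmean (\<lambda>t. A * Re (G (cis t)) powr p + (- B) * Re (G (cis t) powr of_real p))"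
      using pw[OF pos] assms
      by (intro tmean_mono continuous_on_cmod_powr continuous_on_add continuous_on_mult_left
          continuous_on_Re cp cr continuous_on_entire_cis[OF hol]) auto
    also have "\<dots> = A * tmean (\<lambda>t. Re (G (cis t)) powr p) + (- B) * tmean (\<lambda>t. Re (G (cis t) powr of_real p))"
      by (subst tmean_add, (intro continuous_on_mult_left continuous_on_Re cp cr)+)
         (simp only: tmean_cmult)
    also have "\<dots> \<le> A * tmean (\<lambda>t. Re (G (cis t)) powr p)"
      using B mv by simp
    finally show ?thesis .
  qed
  then show ?thesis using A by blast
qed

text \<open>Adding a constant \<open>d > 0\<close> to \<open>G\<close> makes the real part strictly
  positive; the constant in the bound does not depend on \<open>d\<close>, and the error is of order
  \<open>d powr p\<close>.\<close>

lemma riesz_nonneg_real_part: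
  fixes p :: real
  assumes "1 < p" "p \<le> 2"
  shows "\<exists>C\<ge>0. \<forall>G. G holomorphic_on UNIV \<longrightarrow> Im (G 0) = 0 \<longrightarrow> (\<forall>t. Re (G (cis t)) \<ge> 0) \<longrightarrow>
    tmean (\<lambda>t. cmod (G (cis t)) powr p) \<le> C * tmean (\<lambda>t. Re (G (cis t)) powr p)"
proof -
  obtain A where A: "A \<ge> 0" and
    pos: "\<And>G. G holomorphic_on UNIV \<Longrightarrow> Im (G 0) = 0 \<Longrightarrow> (\<And>t. Re (G (cis t)) > 0) \<Longrightarrow>
    tmean (\<lambda>t. cmod (G (cis t)) powr p) \<le> A * tmean (\<lambda>t. Re (G (cis t)) powr p)"
    using riesz_positive_real_part[OF assms] by blast
  have "tmean (\<lambda>t. cmod (G (cis t)) powr p) \<le> (2 powr p * A * 2 powr p) * tmean (\<lambda>t. Re (G (cis t)) powr p)"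
    if hol: "G holomorphic_on UNIV" and im: "Im (G 0) = 0" and nn: "\<And>t. Re (G (cis t)) \<ge> 0" for G
  proof (rule field_le_epsilon)
    fix e :: real assume e: "e > 0"
    define K where "K = 2 powr p * (A * 2 powr p + 1)"
    have K: "K > 0" unfolding K_def using A by (intro mult_pos_pos add_nonneg_pos) auto
    \<comment> \<open>Chosen so that the accumulated error \<open>K * d powr p\<close> is exactly
      \<open>e\<close>.\<close>
    define d where "d = (e / K) powr (1/p)"
    have d: "d > 0" "d powr p = e / K" using e K assms by (simp_all add: d_def powr_powr)
    note [continuous_intros] = continuous_on_entire_cis[OF hol]
    have [continuous_intros]: "continuous_on {0..2*pi} (\<lambda>t. Re (G (cis t)) powr p)"
      using assms nn by (intro continuous_on_powr' continuous_intros) auto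
    let ?H = "\<lambda>z. G z + of_real d"
    have rH: "Re (?H (cis t)) = Re (G (cis t)) + d" for t by simp
    have crH: "continuous_on {0..2*pi} (\<lambda>t. (Re (G (cis t)) + d) powr p)"
      using assms nn d by (intro continuous_on_powr' continuous_intros) (auto intro: add_nonneg_nonneg)
    have chH: "continuous_on {0..2*pi} (\<lambda>t. cmod (?H (cis t)) powr p)"
      using assms by (intro continuous_on_powr' continuous_intros) auto
    have "tmean (\<lambda>t. cmod (?H (cis t)) powr p) \<le> A * tmean (\<lambda>t. Re (?H (cis t)) powr p)"
      by (rule pos[of ?H]) (use hol im nn d in \<open>auto intro!: holomorphic_intros add_nonneg_pos\<close>)
    also have "tmean (\<lambda>t. Re (?H (cis t)) powr p) \<le> tmean (\<lambda>t. 2 powr p * (Re (G (cis t)) powr p + d powr p))"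
      unfolding rH using nn d assms by (intro tmean_mono crH continuous_intros powr_add_le) auto
    also have "\<dots> = 2 powr p * (tmean (\<lambda>t. Re (G (cis t)) powr p) + d powr p)"
      by (simp only: tmean_cmult) (subst tmean_add; auto intro!: continuous_intros)
    finally have 1: "tmean (\<lambda>t. cmod (?H (cis t)) powr p) \<le> A * (2 powr p * (tmean (\<lambda>t. Re (G (cis t)) powr p) + d powr p))"
      using A by (simp add: mult_left_mono)
    have "tmean (\<lambda>t. cmod (G (cis t)) powr p) \<le> tmean (\<lambda>t. 2 powr p * (cmod (?H (cis t)) powr p + d powr p))"
    proof (intro tmean_mono)
      fix t
      have "cmod (G (cis t)) = cmod (?H (cis t) + - of_real d)" by simp
      also have "\<dots> \<le> cmod (?H (cis t)) + cmod (- complex_of_real d)" by (rule norm_triangle_ineq)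
      finally have "cmod (G (cis t)) \<le> cmod (?H (cis t)) + d" using d by simp
      then show "cmod (G (cis t)) powr p \<le> 2 powr p * (cmod (?H (cis t)) powr p + d powr p)"
        using assms d by (intro powr_le_add) auto
    qed (use assms chH in \<open>auto intro!: continuous_on_cmod_powr continuous_intros\<close>)
    also have "\<dots> = 2 powr p * (tmean (\<lambda>t. cmod (?H (cis t)) powr p) + d powr p)"
      by (simp only: tmean_cmult) (subst tmean_add; use chH in auto)
    also have "\<dots> \<le> 2 powr p * (A * (2 powr p * (tmean (\<lambda>t. Re (G (cis t)) powr p) + d powr p)) + d powr p)"
      using 1 by simp
    also have "\<dots> = (2 powr p * A * 2 powr p) * tmean (\<lambda>t. Re (G (cis t)) powr p) + K * (d powr p)"
      by (simp add: K_def algebra_simps)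
    also have "K * (d powr p) = e" using K d by simp
    finally show "tmean (\<lambda>t. cmod (G (cis t)) powr p) \<le> (2 powr p * A * 2 powr p) * tmean (\<lambda>t. Re (G (cis t)) powr p) + e" .
  qed
  moreover have "2 powr p * A * 2 powr p \<ge> 0" using A by simp
  ultimately show ?thesis by blast
qed

section \<open>The analytic projection of trigonometric polynomials\<close>

text \<open>Every trigonometric polynomial is \<open>poly a (cis t) + poly b (cis (- t))\<close>,
  and \<open>poly b 0 = 0\<close> assigns the constant term to \<open>a\<close>. The statement is
  thus the boundedness in p-th mean of the projection onto nonnegative frequencies.\<close>

definition riesz_bound :: "real \<Rightarrow> bool" where
  "riesz_bound p \<longleftrightarrow> (\<exists>C\<ge>0. \<forall>a b :: complex poly. poly b 0 = 0 \<longrightarrow>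
     tmean (\<lambda>t. cmod (poly a (cis t)) powr p) \<le>
     C * tmean (\<lambda>t. cmod (poly a (cis t) + poly b (cis (- t))) powr p))"

text \<open>\<open>psum M a / M\<close> is the analytic part of the Fejer mean of \<open>a\<close>.
  It is a polynomial in \<open>cis t\<close> for every \<open>a\<close>, which matters because
  positive parts of trigonometric polynomials, themselves no longer trigonometric polynomials, will
  be inserted.\<close>

definition psum :: "nat \<Rightarrow> (real \<Rightarrow> complex) \<Rightarrow> real \<Rightarrow> complex" where
  "psum M a t = (\<Sum>i<M. \<Sum>j<M. (if int i - int j \<ge> 0 then 1 else 0) * fcoef a (int i - int j) * cis (of_int (int i - int j) * t))"

lemma continuous_on_psum [continuous_intros]: "continuous_on A (psum M a)"
  unfolding psum_def by (intro continuous_intros)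

lemma powr_sum_le:
  fixes a :: "'a \<Rightarrow> real"
  assumes "finite A" "\<And>i. i \<in> A \<Longrightarrow> 0 \<le> a i" "1 \<le> p"
  shows "(\<Sum>i\<in>A. a i) powr p \<le> real (card A) powr p * (\<Sum>i\<in>A. a i powr p)"
proof (cases "A = {}")
  case False
  define N where "N = real (card A)"
  have N: "N \<ge> 1" using False assms unfolding N_def by (simp add: Suc_le_eq card_gt_0_iff)
  have "(\<Sum>i\<in>A. a i) powr p = (N * (\<Sum>i\<in>A. (1/N) * a i)) powr p"
    using N by (simp flip: sum_divide_distrib)
  also have "\<dots> = N powr p * (\<Sum>i\<in>A. (1/N) * a i) powr p"
    by (rule powr_mult)
  also have "\<dots> \<le> N powr p * (\<Sum>i\<in>A. (1/N) * a i powr p)"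
    using N assms by (intro mult_left_mono jensen_sum_powr) (auto simp: N_def)
  also have "\<dots> \<le> N powr p * (\<Sum>i\<in>A. 1 * a i powr p)"
    using N by (intro mult_left_mono sum_mono mult_right_mono) (simp_all add: field_simps)
  finally show ?thesis by (simp add: N_def)
qed simp

lemma tmean_powr_le:
  assumes "continuous_on {0..2*pi} u" "\<And>s. 0 \<le> u s" "1 \<le> p"
  shows "tmean u powr p \<le> tmean (\<lambda>s. u s powr p)"
  using jensen_tmean_powr[of "\<lambda>_. 1" u p] assms by simp

text \<open>The Fejer mean \<open>F\<close> of \<open>u \<ge> 0\<close> is again nonnegative and is
  the real part of the polynomial \<open>G\<close> on the circle, whose value at 0 is the real
  number \<open>tmean u\<close>. The previous theorem bounds \<open>G\<close> by \<open>F\<close>,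
  Jensen's inequality bounds \<open>F\<close> by \<open>u\<close>, and \<open>psum / M\<close> is
  the average of \<open>G\<close> and the constant \<open>tmean u\<close>.\<close>

lemma psum_nonneg_bound:
  fixes p :: real
  assumes "1 < p" "p \<le> 2"
  shows "\<exists>C\<ge>0. \<forall>u M. continuous_on UNIV u \<longrightarrow> (\<forall>s. 0 \<le> u s) \<longrightarrow> 0 < M \<longrightarrow>
    tmean (\<lambda>t. cmod (psum M (\<lambda>s. of_real (u s)) t / of_nat M) powr p) \<le> C * tmean (\<lambda>s. u s powr p)"
proof -
  obtain A where A: "A \<ge> 0" and
    R: "\<And>G. G holomorphic_on UNIV \<Longrightarrow> Im (G 0) = 0 \<Longrightarrow> (\<And>t. Re (G (cis t)) \<ge> 0) \<Longrightarrow>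
    tmean (\<lambda>t. cmod (G (cis t)) powr p) \<le> A * tmean (\<lambda>t. Re (G (cis t)) powr p)"
    using riesz_nonneg_real_part[OF assms] by blast
  have "tmean (\<lambda>t. cmod (psum M (\<lambda>s. of_real (u s)) t / of_nat M) powr p) \<le> (2 powr p * (A + 1)) * tmean (\<lambda>s. u s powr p)"
    if cu: "continuous_on UNIV u" and u0: "\<And>s. 0 \<le> u s" and M: "0 < M" for u :: "real \<Rightarrow> real" and M :: nat
  proof -
    define U where "U = (\<lambda>s. complex_of_real (u s))"
    have cu': "continuous_on S u" for S using cu continuous_on_subset by blast
    note [continuous_intros] = cu'
    define H where "H = (\<lambda>z. \<Sum>i<M. \<Sum>j<M. if j < i then fcoef U (int i - int j) * z ^ (i - j) else 0)"
    define G where "G = (\<lambda>z. fcoef U 0 + 2 * H z / of_nat M)"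
    have f0: "fcoef U 0 = of_real (tmean u)"
      unfolding U_def by (rule fcoef_0_real) (rule cu')
    have tu: "tmean u \<ge> 0" by (rule tmean_nonneg) (use u0 cu' in auto)
    have holH: "H holomorphic_on UNIV"
    proof -
      have "(\<lambda>x. if j < i then fcoef U (int i - int j) * x ^ (i - j) else 0) holomorphic_on UNIV" for i j
        by (cases "j < i") (auto intro!: holomorphic_intros)
      then show ?thesis unfolding H_def by (intro holomorphic_on_sum)
    qed
    have holG: "G holomorphic_on UNIV"
      unfolding G_def using M by (intro holomorphic_intros holH) auto
    have "H 0 = 0" unfolding H_def by (intro sum.neutral ballI) auto
    then have imG: "Im (G 0) = 0" by (simp add: G_def f0)
    have diag: "(\<Sum>i<M. \<Sum>j<M. if i = j then fcoef U 0 else 0) = of_nat M * fcoef U 0"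
      by simp
    have ps: "psum M U t = of_nat M * fcoef U 0 + H (cis t)" for t
    proof -
      have "psum M U t = (\<Sum>i<M. \<Sum>j<M. (if i = j then fcoef U 0 else 0) + (if j < i then fcoef U (int i - int j) * cis t ^ (i - j) else 0))"
        unfolding psum_def by (intro sum.cong refl) (auto simp: Complex.DeMoivre of_nat_diff)
      then show ?thesis by (simp add: sum.distrib H_def)
    qed
    have fs: "fsum M U t = of_nat M * fcoef U 0 + H (cis t) + cnj (H (cis t))" for t
    proof -
      have "cnj (H (cis t)) = (\<Sum>i<M. \<Sum>j<M. if j < i then fcoef U (int j - int i) * cis (of_int (int j - int i) * t) else 0)"
        unfolding H_def cnj_sum
      proof (intro sum.cong refl)
        fix i j
        have "cnj (fcoef U (int i - int j)) = fcoef U (int j - int i)"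
          unfolding U_def using fcoef_cnj_real[of u "int i - int j"] by simp
        then show "cnj (if j < i then fcoef U (int i - int j) * cis t ^ (i - j) else 0) =
          (if j < i then fcoef U (int j - int i) * cis (of_int (int j - int i) * t) else 0)"
          by (auto simp: Complex.DeMoivre of_nat_diff cis_cnj algebra_simps)
      qed
      also have "\<dots> = (\<Sum>j<M. \<Sum>i<M. if j < i then fcoef U (int j - int i) * cis (of_int (int j - int i) * t) else 0)"
        by (rule sum.swap)
      finally have c: "cnj (H (cis t)) = (\<Sum>i<M. \<Sum>j<M. if i < j then fcoef U (int i - int j) * cis (of_int (int i - int j) * t) else 0)" .
      have "fsum M U t = (\<Sum>i<M. \<Sum>j<M. (if i = j then fcoef U 0 else 0) + (if j < i then fcoef U (int i - int j) * cis t ^ (i - j) else 0)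
         + (if i < j then fcoef U (int i - int j) * cis (of_int (int i - int j) * t) else 0))"
        unfolding fsum_def by (intro sum.cong refl) (auto simp: Complex.DeMoivre of_nat_diff)
      then show ?thesis by (simp only: c sum.distrib diag) (simp only: H_def)
    qed
    define F where "F = (\<lambda>t. tmean (\<lambda>s. u s * dsq M (t - s)) / real M)"
    have F0: "F t \<ge> 0" for t
      unfolding F_def using u0 by (intro divide_nonneg_nonneg tmean_nonneg continuous_intros) auto
    have reG: "Re (G (cis t)) = F t" for t
    proof -
      have "of_nat M * fcoef U 0 + H (cis t) + cnj (H (cis t)) = of_real (tmean (\<lambda>s. u s * dsq M (t - s)))"
        using fs[of t] fsum_real[of u M t] cu' by (simp add: U_def)
      then have "Re (of_nat M * fcoef U 0 + H (cis t) + cnj (H (cis t))) = tmean (\<lambda>s. u s * dsq M (t - s))"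
        by simp
      then show ?thesis using M by (simp add: G_def F_def f0 field_simps)
    qed
    have FG: "tmean (\<lambda>t. cmod (G (cis t)) powr p) \<le> A * tmean (\<lambda>t. F t powr p)"
      using R[OF holG imG] F0 by (simp add: reG)
    have cF: "continuous_on S F" for S
    proof -
      have "F = (\<lambda>t. Re (G (cis t)))" using reG by auto
      then show ?thesis using continuous_on_entire_cis[OF holG] by (auto intro!: continuous_intros)
    qed
    have cup: "continuous_on S (\<lambda>s. u s powr p)" for S
      using u0 assms by (intro continuous_on_powr' cu' continuous_intros) auto
    have cj: "continuous_on UNIV (\<lambda>(t, s). u s powr p * dsq M (t - s))"
      unfolding case_prod_unfold
      by (intro continuous_intros continuous_on_compose2[OF cup[of UNIV]]) auto
    have F1: "tmean (\<lambda>t. F t powr p) \<le> tmean (\<lambda>s. u s powr p)"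
    proof -
      have "tmean (\<lambda>t. F t powr p) \<le> tmean (\<lambda>t. (1 / real M) * tmean (\<lambda>s. u s powr p * dsq M (t - s)))"
      proof (intro tmean_mono)
        show "continuous_on {0..2*pi} (\<lambda>t. F t powr p)"
          using F0 assms by (intro continuous_on_powr' cF continuous_intros) auto
        show "continuous_on {0..2*pi} (\<lambda>t. (1 / real M) * tmean (\<lambda>s. u s powr p * dsq M (t - s)))"
          by (intro continuous_intros continuous_on_subset[OF continuous_on_tmean[OF cj]]) auto
        show "F t powr p \<le> (1 / real M) * tmean (\<lambda>s. u s powr p * dsq M (t - s))" for t
          using jensen_dsq[of u p M t] cu' u0 assms M by (simp add: F_def)
      qed
      also have "\<dots> = (1 / real M) * tmean (\<lambda>s. tmean (\<lambda>t. u s powr p * dsq M (t - s)))"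
        by (subst tmean_cmult, subst tmean_swap[OF cj]) (rule refl)
      also have "\<dots> = tmean (\<lambda>s. u s powr p)"
        unfolding tmean_cmult tmean_dsq' using M
        by (subst mult.commute[of _ "real M"]) (simp only: tmean_cmult, simp)
      finally show ?thesis .
    qed
    have G1: "tmean (\<lambda>t. cmod (G (cis t)) powr p) \<le> A * tmean (\<lambda>s. u s powr p)"
      using FG F1 A by (meson mult_left_mono order_trans)
    have U1: "tmean u powr p \<le> tmean (\<lambda>s. u s powr p)"
      by (rule tmean_powr_le) (use cu' u0 assms in auto)
    have "tmean (\<lambda>t. cmod (psum M U t / of_nat M) powr p) \<le> tmean (\<lambda>t. 2 powr p * (cmod (G (cis t)) powr p + tmean u powr p))"
    proof (intro tmean_mono)
      show "continuous_on {0..2*pi} (\<lambda>t. cmod (psum M U t / of_nat M) powr p)"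
        using assms M by (intro continuous_on_cmod_powr continuous_intros) auto
      show "continuous_on {0..2*pi} (\<lambda>t. 2 powr p * (cmod (G (cis t)) powr p + tmean u powr p))"
        using assms by (intro continuous_intros continuous_on_cmod_powr continuous_on_entire_cis[OF holG]) auto
      fix t
      have "psum M U t / of_nat M = (G (cis t) + of_real (tmean u)) / 2"
        using M by (simp add: ps G_def f0 field_simps)
      then have "cmod (psum M U t / of_nat M) = cmod (G (cis t) + of_real (tmean u)) / 2"
        by (simp only: norm_divide) simp
      then have "cmod (psum M U t / of_nat M) \<le> (cmod (G (cis t)) + tmean u) / 2"
        using norm_triangle_ineq[of "G (cis t)" "of_real (tmean u)"] tu by (simp add: norm_divide)
      also have "\<dots> \<le> cmod (G (cis t)) + tmean u" using tu by simp
      finally show "cmod (psum M U t / of_nat M) powr p \<le> 2 powr p * (cmod (G (cis t)) powr p + tmean u powr p)"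
        using assms tu by (intro powr_le_add) auto
    qed
    also have "\<dots> = 2 powr p * (tmean (\<lambda>t. cmod (G (cis t)) powr p) + tmean u powr p)"
      using assms
      by (simp only: tmean_cmult)
         (subst tmean_add; auto intro!: continuous_intros continuous_on_cmod_powr continuous_on_entire_cis[OF holG])
    also have "\<dots> \<le> 2 powr p * (A * tmean (\<lambda>s. u s powr p) + tmean (\<lambda>s. u s powr p))"
      using G1 U1 by (intro mult_left_mono add_mono) auto
    finally show ?thesis by (simp add: U_def algebra_simps)
  qed
  moreover have "2 powr p * (A + 1) \<ge> 0" using A by simp
  ultimately show ?thesis by blast
qed

lemma poly_cis_eq_sum:
  fixes a :: "complex poly"
  assumes "degree a \<le> K"
  shows "poly a (cis t) = (\<Sum>k\<in>{0..int K}. coeff a (nat k) * cis (of_int k * t))"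
proof -
  have "poly a (cis t) = (\<Sum>k\<le>K. coeff a k * cis t ^ k)"
    unfolding poly_altdef
    by (rule sum.mono_neutral_left) (use assms in \<open>auto simp: coeff_eq_0\<close>)
  also have "\<dots> = (\<Sum>k\<in>{0..int K}. coeff a (nat k) * cis (of_int k * t))"
    by (rule sum.reindex_bij_witness[where i = nat and j = int]) (auto simp: Complex.DeMoivre)
  finally show ?thesis .
qed

text \<open>To reduce to trigonometric polynomials with nonnegative real part, split \<open>T\<close> into the positive and
  negative parts \<open>u r\<close> of \<open>Re T\<close> and \<open>Im T\<close>, and restore polynomials by writing \<open>T\<close> as a combination of two
  Fejer means of itself.\<close>

lemma riesz_bound_le_2:
  assumes "1 < p" "p \<le> 2"
  shows "riesz_bound p"
proof -
  obtain A where A: "A \<ge> 0" and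
    R: "\<And>u M. continuous_on UNIV u \<Longrightarrow> (\<And>s. 0 \<le> u s) \<Longrightarrow> 0 < M \<Longrightarrow>
    tmean (\<lambda>t. cmod (psum M (\<lambda>s. of_real (u s)) t / of_nat M) powr p) \<le> A * tmean (\<lambda>s. u s powr p)"
    using psum_nonneg_bound[OF assms] by blast
  define B where "B = 4 powr p * (4 * A)"
  have B: "B \<ge> 0" using A by (simp add: B_def)
  have "tmean (\<lambda>t. cmod (poly a (cis t)) powr p) \<le>
     (4 powr p * (2 * B)) * tmean (\<lambda>t. cmod (poly a (cis t) + poly b (cis (- t))) powr p)"
    if b0: "poly b 0 = 0" for a b :: "complex poly"
  proof -
    define T where "T = (\<lambda>t. poly a (cis t) + poly b (cis (- t)))"
    define K where "K = Suc (max (degree a) (degree b))"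
    have K: "K > 0" "degree a \<le> K" "degree b \<le> K" by (auto simp: K_def)
    define c where "c = (\<lambda>k::int. if k \<ge> 0 then coeff a (nat k) else coeff b (nat (- k)))"
    have c0: "coeff b 0 = 0" using b0 by (simp add: poly_0_coeff_0)
    have pa: "poly a (cis t) = (\<Sum>k\<in>{-int K..int K}. (if k \<ge> 0 then 1 else 0) * c k * cis (of_int k * t))" for t
      unfolding poly_cis_eq_sum[OF K(2)]
      by (rule sum.mono_neutral_cong_left) (auto simp: c_def)
    have pb: "poly b (cis (- t)) = (\<Sum>k\<in>{-int K..int K}. (if k \<ge> 0 then 0 else 1) * c k * cis (of_int k * t))" for t
    proof -
      have "poly b (cis (- t)) = (\<Sum>k\<in>{-int K..0}. coeff b (nat (-k)) * cis (of_int k * t))"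
        unfolding poly_cis_eq_sum[OF K(3)]
        by (rule sum.reindex_bij_witness[where i = uminus and j = uminus]) auto
      also have "\<dots> = (\<Sum>k\<in>{-int K..int K}. (if k \<ge> 0 then 0 else 1) * c k * cis (of_int k * t))"
        by (rule sum.mono_neutral_cong_left) (auto simp: c_def c0)
      finally show ?thesis .
    qed
    have T: "T t = (\<Sum>k\<in>{-int K..int K}. c k * cis (of_int k * t))" for t
      unfolding T_def pa pb sum.distrib[symmetric] by (intro sum.cong refl) auto
    have cT: "continuous_on S T" for S by (rule continuous_on_trig[OF T])
    \<comment> \<open>For \<open>r = 0, 1, 2, 3\<close> these are the positive parts of
      \<open>Re T\<close>, \<open>Im T\<close>, \<open>- Re T\<close> and
      \<open>- Im T\<close>.\<close>
    define u where "u = (\<lambda>r s. max (Re (cnj (\<i> ^ r) * T s)) 0)"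
    have cu: "continuous_on S (u r)" for S r
      unfolding u_def by (intro continuous_intros cT)
    have u0: "u r s \<ge> 0" for r s by (simp add: u_def)
    have uT: "u r s \<le> cmod (T s)" for r s
      using complex_Re_le_cmod[of "cnj (\<i> ^ r) * T s"] by (auto simp: u_def norm_mult norm_power)
    have Tu: "T s = (\<Sum>r<4. \<i> ^ r * of_real (u r s))" for s
      by (simp add: u_def eval_nat_numeral complex_eq_iff max_def)
    have ps: "psum M T t = (\<Sum>r<4. \<i> ^ r * psum M (\<lambda>s. of_real (u r s)) t)" for M t
    proof -
      have "T = (\<lambda>s. \<Sum>r<4. \<i> ^ r * of_real (u r s))" using Tu by auto
      then have "fcoef T k = (\<Sum>r<4. fcoef (\<lambda>s. \<i> ^ r * of_real (u r s)) k)" for k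
        by (simp only:) (intro fcoef_sum continuous_intros cu finite_lessThan)
      then have *: "fcoef T k = (\<Sum>r<4. \<i> ^ r * fcoef (\<lambda>s. of_real (u r s)) k)" for k
        by (simp only: fcoef_cmult)
      have "psum M T t = (\<Sum>i<M. \<Sum>j<M. \<Sum>r<4. \<i> ^ r * ((if int i - int j \<ge> 0 then 1 else 0) * fcoef (\<lambda>s. of_real (u r s)) (int i - int j) * cis (of_int (int i - int j) * t)))"
        unfolding psum_def * sum_distrib_left sum_distrib_right
        by (intro sum.cong refl) (simp add: mult_ac)
      also have "\<dots> = (\<Sum>r<4. \<Sum>i<M. \<Sum>j<M. \<i> ^ r * ((if int i - int j \<ge> 0 then 1 else 0) * fcoef (\<lambda>s. of_real (u r s)) (int i - int j) * cis (of_int (int i - int j) * t)))"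
        by (rule sum_rotate)
      finally show ?thesis by (simp only: psum_def sum_distrib_left)
    qed
    define I where "I = tmean (\<lambda>t. cmod (T t) powr p)"
    have cpu: "continuous_on S (\<lambda>s. u r s powr p)" for S r
      using u0 assms by (intro continuous_on_powr' cu continuous_intros) auto
    have uI: "tmean (\<lambda>s. u r s powr p) \<le> I" for r
      unfolding I_def using assms u0 uT
      by (intro tmean_mono cpu continuous_on_cmod_powr cT powr_mono2) auto
    have psB: "tmean (\<lambda>t. cmod (psum M T t / of_nat M) powr p) \<le> B * I" if M: "M > 0" for M
    proof -
      have cps: "continuous_on S (\<lambda>t. cmod (psum M (\<lambda>s. of_real (u r s)) t / of_nat M) powr p)" for r S
        using assms M by (intro continuous_on_cmod_powr continuous_intros) auto
      have "tmean (\<lambda>t. cmod (psum M T t / of_nat M) powr p) \<le>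
        tmean (\<lambda>t. 4 powr p * (\<Sum>r<4. cmod (psum M (\<lambda>s. of_real (u r s)) t / of_nat M) powr p))"
      proof (intro tmean_mono)
        show "continuous_on {0..2*pi} (\<lambda>t. cmod (psum M T t / of_nat M) powr p)"
          using assms M by (intro continuous_on_cmod_powr continuous_intros) auto
        fix t
        have "cmod (psum M T t / of_nat M) \<le> (\<Sum>r<4. cmod (psum M (\<lambda>s. of_real (u r s)) t / of_nat M))"
          unfolding ps sum_divide_distrib by (intro sum_norm_le) (simp add: norm_mult norm_divide norm_power)
        then have "cmod (psum M T t / of_nat M) powr p \<le> (\<Sum>r<4. cmod (psum M (\<lambda>s. of_real (u r s)) t / of_nat M)) powr p"
          using assms by (intro powr_mono2) auto
        also have "\<dots> \<le> real (card {..<4::nat}) powr p * (\<Sum>r<4. cmod (psum M (\<lambda>s. of_real (u r s)) t / of_nat M) powr p)"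
          using assms by (intro powr_sum_le) auto
        finally show "cmod (psum M T t / of_nat M) powr p \<le> 4 powr p * (\<Sum>r<4. cmod (psum M (\<lambda>s. of_real (u r s)) t / of_nat M) powr p)"
          by simp
      qed (intro continuous_intros cps)
      also have "\<dots> = 4 powr p * (\<Sum>r<4. tmean (\<lambda>t. cmod (psum M (\<lambda>s. of_real (u r s)) t / of_nat M) powr p))"
        by (simp only: tmean_cmult) (subst tmean_sum, use cps in auto)
      also have "\<dots> \<le> 4 powr p * (\<Sum>r<4::nat. A * I)"
      proof (intro mult_left_mono sum_mono)
        fix r
        have "tmean (\<lambda>t. cmod (psum M (\<lambda>s. of_real (u r s)) t / of_nat M) powr p) \<le> A * tmean (\<lambda>s. u r s powr p)"
          by (rule R) (use cu u0 M in auto)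
        also have "\<dots> \<le> A * I" using uI A by (intro mult_left_mono)
        finally show "tmean (\<lambda>t. cmod (psum M (\<lambda>s. of_real (u r s)) t / of_nat M) powr p) \<le> A * I" .
      qed simp
      finally show ?thesis by (simp add: B_def)
    qed
    have c2: "continuous_on S (\<lambda>t. cmod (psum M T t / of_nat M) powr p)" if "M > 0" for M S
      using assms that by (intro continuous_on_cmod_powr continuous_intros) auto
    have "tmean (\<lambda>t. cmod (poly a (cis t)) powr p) \<le>
      tmean (\<lambda>t. 4 powr p * (cmod (psum (2*K) T t / of_nat (2*K)) powr p + cmod (psum K T t / of_nat K) powr p))"
    proof (intro tmean_mono)
      show "continuous_on {0..2*pi} (\<lambda>t. cmod (poly a (cis t)) powr p)"
        using assms by (intro continuous_on_cmod_powr continuous_on_poly continuous_intros) auto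
      show "continuous_on {0..2*pi} (\<lambda>t. 4 powr p * (cmod (psum (2*K) T t / of_nat (2*K)) powr p + cmod (psum K T t / of_nat K) powr p))"
        using K by (intro continuous_intros c2) auto
      fix t
      have "of_nat K * poly a (cis t) = psum (2*K) T t - psum K T t"
        using vallee_poussin_filter[OF T, of "\<lambda>k. if k \<ge> 0 then 1 else 0" t] unfolding pa psum_def by simp
      then have "poly a (cis t) = 2 * (psum (2*K) T t / of_nat (2*K)) - psum K T t / of_nat K"
        using K by (simp add: field_simps)
      then have "cmod (poly a (cis t)) \<le> cmod (2 * (psum (2*K) T t / of_nat (2*K))) + cmod (psum K T t / of_nat K)"
        by (metis norm_triangle_ineq4)
      also have "\<dots> \<le> 2 * (cmod (psum (2*K) T t / of_nat (2*K)) + cmod (psum K T t / of_nat K))"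
        using norm_ge_zero[of "psum K T t / of_nat K"]
        unfolding norm_mult norm_numeral distrib_left by linarith
      finally show "cmod (poly a (cis t)) powr p \<le> 4 powr p * (cmod (psum (2*K) T t / of_nat (2*K)) powr p + cmod (psum K T t / of_nat K) powr p)"
        using assms by (intro powr_le_twice_add) auto
    qed
    also have "\<dots> = 4 powr p * (tmean (\<lambda>t. cmod (psum (2*K) T t / of_nat (2*K)) powr p) + tmean (\<lambda>t. cmod (psum K T t / of_nat K) powr p))"
      by (simp only: tmean_cmult) (subst tmean_add, (rule c2, use K in simp)+, rule refl)
    also have "\<dots> \<le> 4 powr p * (B * I + B * I)"
      using K by (intro mult_left_mono add_mono psB) auto
    finally show ?thesis by (simp add: I_def T_def)
  qed
  moreover have "4 powr p * (2 * B) \<ge> 0" using B by simp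
  ultimately show ?thesis unfolding riesz_bound_def by blast
qed

text \<open>If \<open>T = f + g\<close> with \<open>f\<close> analytic and \<open>g\<close> strictly co-analytic, then \<open>f\<^sup>2\<close> is the analytic part
  of \<open>f\<^sup>2 - g\<^sup>2 = T (2 f - T)\<close>; this is Cotlar's identity, and it doubles the exponent.\<close>

lemma riesz_bound_double:
  assumes "riesz_bound p" "1 \<le> p"
  shows "riesz_bound (2 * p)"
proof -
  obtain C where C: "C \<ge> 0" and R: "\<And>a b :: complex poly. poly b 0 = 0 \<Longrightarrow>
     tmean (\<lambda>t. cmod (poly a (cis t)) powr p) \<le>
     C * tmean (\<lambda>t. cmod (poly a (cis t) + poly b (cis (- t))) powr p)"
    using assms unfolding riesz_bound_def by blast
  define c where "c = C * 4 powr p"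
  have "tmean (\<lambda>t. cmod (poly a (cis t)) powr (2*p)) \<le>
     (c\<^sup>2 + 2 * C * 2 powr p) * tmean (\<lambda>t. cmod (poly a (cis t) + poly b (cis (- t))) powr (2*p))"
    if b0: "poly b 0 = 0" for a b :: "complex poly"
  proof -
    define f where "f = (\<lambda>t. poly a (cis t))"
    define g where "g = (\<lambda>t. poly b (cis (- t)))"
    define T where "T = (\<lambda>t. f t + g t)"
    have cf: "continuous_on S f" for S unfolding f_def by (intro continuous_intros continuous_on_poly)
    have cg: "continuous_on S g" for S unfolding g_def by (intro continuous_intros continuous_on_poly)
    have cT: "continuous_on S T" for S unfolding T_def by (intro continuous_intros cf cg)
    have sq: "cmod z powr (2*p) = cmod (z\<^sup>2) powr p" "cmod z powr (2*p) = (cmod z powr p)\<^sup>2" for z :: complex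
    proof -
      have "cmod z powr (2*p) = (cmod z powr 2) powr p" by (simp only: powr_powr)
      then show "cmod z powr (2*p) = cmod (z\<^sup>2) powr p" by (simp add: norm_power)
      show "cmod z powr (2*p) = (cmod z powr p)\<^sup>2"
        by (simp only: power2_eq_square powr_add[symmetric] mult_2)
    qed
    let ?X = "tmean (\<lambda>t. cmod (f t) powr (2*p))"
    let ?Y = "tmean (\<lambda>t. cmod (T t) powr (2*p))"
    have cf2: "continuous_on S (\<lambda>t. cmod (f t) powr (2*p))" for S
      using assms by (intro continuous_on_cmod_powr cf) auto
    have cT2: "continuous_on S (\<lambda>t. cmod (T t) powr (2*p))" for S
      using assms by (intro continuous_on_cmod_powr cT) auto
    have cfg2: "continuous_on S (\<lambda>t. cmod ((f t)\<^sup>2 - (g t)\<^sup>2) powr p)" for S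
      using assms by (intro continuous_on_cmod_powr continuous_intros cf cg) auto
    \<comment> \<open>The bound for exponent \<open>p\<close> is applied to \<open>a\<^sup>2\<close>
      and \<open>- (b\<^sup>2)\<close>; the latter still vanishes at 0.\<close>
    have "?X \<le> C * tmean (\<lambda>t. cmod ((f t)\<^sup>2 - (g t)\<^sup>2) powr p)"
      using R[of "- (b\<^sup>2)" "a\<^sup>2"] b0 by (simp add: sq(1) f_def g_def)
    also have "\<dots> = tmean (\<lambda>t. C * cmod ((f t)\<^sup>2 - (g t)\<^sup>2) powr p)"
      by (simp only: tmean_cmult)
    also have "\<dots> \<le> tmean (\<lambda>t. (1/2) * cmod (f t) powr (2*p) + (c\<^sup>2/2 + C * 2 powr p) * cmod (T t) powr (2*p))"
    proof (intro tmean_mono)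
      fix t
      define x where "x = cmod (f t) powr p"
      define y where "y = cmod (T t) powr p"
      have eq: "(f t)\<^sup>2 - (g t)\<^sup>2 = T t * (2 * f t - T t)"
        by (simp add: T_def power2_eq_square algebra_simps)
      have "cmod (2 * f t - T t) \<le> 2 * cmod (f t) + cmod (T t)"
        using norm_triangle_ineq4[of "2 * f t" "T t"] by (simp add: norm_mult)
      then have "cmod (2 * f t - T t) powr p \<le> 2 powr p * ((2 * cmod (f t)) powr p + cmod (T t) powr p)"
        using assms by (intro powr_le_add) auto
      also have "\<dots> = 4 powr p * x + 2 powr p * y"
        by (simp only: x_def y_def powr_mult distrib_left mult.assoc[symmetric] two_powr_mult_self)
      finally have "C * cmod ((f t)\<^sup>2 - (g t)\<^sup>2) powr p \<le> C * (y * (4 powr p * x + 2 powr p * y))"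
        unfolding eq norm_mult powr_mult y_def using C by (intro mult_left_mono) auto
      also have "\<dots> = c * x * y + C * 2 powr p * y\<^sup>2"
        by (simp add: c_def power2_eq_square algebra_simps)
      \<comment> \<open>Splitting the mixed term with weight \<open>1/2\<close> on
        \<open>x\<^sup>2\<close> leaves half of \<open>?X\<close> on the right, to be absorbed into
        the left side.\<close>
      also have "c * x * y \<le> x\<^sup>2 / 2 + c\<^sup>2/2 * y\<^sup>2"
        using sum_squares_ge_zero[of "x - c * y" 0] by (simp add: power2_eq_square algebra_simps)
      finally have "C * cmod ((f t)\<^sup>2 - (g t)\<^sup>2) powr p \<le> (1/2) * x\<^sup>2 + (c\<^sup>2/2 + C * 2 powr p) * y\<^sup>2"
        by (simp add: algebra_simps)
      then show "C * cmod ((f t)\<^sup>2 - (g t)\<^sup>2) powr p \<le> (1/2) * cmod (f t) powr (2*p) + (c\<^sup>2/2 + C * 2 powr p) * cmod (T t) powr (2*p)"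
        unfolding sq(2) x_def y_def .
    qed (intro continuous_intros cf2 cT2 cfg2)+
    also have "\<dots> = (1/2) * ?X + (c\<^sup>2/2 + C * 2 powr p) * ?Y"
      by (subst tmean_add, (intro continuous_intros cf2 cT2)+) (simp only: tmean_cmult)
    finally have "?X \<le> (c\<^sup>2 + 2 * C * 2 powr p) * ?Y" by (simp add: algebra_simps)
    then show ?thesis by (simp add: f_def g_def T_def)
  qed
  moreover have "c\<^sup>2 + 2 * C * 2 powr p \<ge> 0" using C by simp
  ultimately show ?thesis unfolding riesz_bound_def by blast
qed

text \<open>An exponent above 2 is twice an exponent above 1, so repeated halving ends in the
  interval \<open>(1, 2]\<close>, where the direct argument applies.\<close>

theorem riesz_bound:
  assumes "1 < p"
  shows "riesz_bound p"
proof -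
  have *: "\<forall>p. 1 < p \<longrightarrow> p \<le> 2 ^ Suc n \<longrightarrow> riesz_bound p" for n
  proof (induction n)
    case (Suc n)
    show ?case
    proof (intro allI impI)
      fix p :: real assume p: "1 < p" "p \<le> 2 ^ Suc (Suc n)"
      show "riesz_bound p"
      proof (cases "p \<le> 2")
        case False
        then have "riesz_bound (p/2)" using Suc p by simp
        then show ?thesis using riesz_bound_double[of "p/2"] False by simp
      qed (use p riesz_bound_le_2 in simp)
    qed
  qed (simp add: riesz_bound_le_2)
  obtain n where "p < 2 ^ n" using real_arch_pow[of 2 p] by auto
  moreover have "(2::real) ^ n \<le> 2 ^ Suc n" by (rule power_increasing) auto
  ultimately have "p \<le> 2 ^ Suc n" by linarith
  with * assms show ?thesis by blast
qed

section \<open>Multipliers on the torus\<close>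

definition tmean2 :: "(real \<Rightarrow> real \<Rightarrow> real) \<Rightarrow> real" where
  "tmean2 f = tmean (\<lambda>x. tmean (f x))"

lemma continuous_on_slice:
  assumes "continuous_on UNIV (\<lambda>(x, y). f x y)"
  shows "continuous_on A (\<lambda>x. f x y)" "continuous_on A (f x)"
proof -
  have "continuous_on A (\<lambda>x. (\<lambda>(x, y). f x y) (x, y))"
    by (rule continuous_on_compose2[OF assms]) (auto intro!: continuous_intros)
  then show "continuous_on A (\<lambda>x. f x y)" by simp
  have "continuous_on A (\<lambda>y. (\<lambda>(x, y). f x y) (x, y))"
    by (rule continuous_on_compose2[OF assms]) (auto intro!: continuous_intros)
  then show "continuous_on A (f x)" by simp
qed

lemma continuous_on_tmean_slice:
  fixes f :: "real \<Rightarrow> real \<Rightarrow> real"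
  assumes "continuous_on UNIV (\<lambda>(x, y). f x y)"
  shows "continuous_on A (\<lambda>x. tmean (f x))"
  using continuous_on_tmean[OF assms] by (rule continuous_on_subset) simp

lemma tmean2_mono:
  assumes "continuous_on UNIV (\<lambda>(x, y). f x y)" "continuous_on UNIV (\<lambda>(x, y). g x y)"
    and "\<And>x y. f x y \<le> g x y"
  shows "tmean2 f \<le> tmean2 g"
  unfolding tmean2_def
  by (rule tmean_mono[OF continuous_on_tmean_slice[OF assms(1)] continuous_on_tmean_slice[OF assms(2)]
        tmean_mono[OF continuous_on_slice(2)[OF assms(1)] continuous_on_slice(2)[OF assms(2)] assms(3)]])

lemma tmean2_nonneg:
  assumes "continuous_on UNIV (\<lambda>(x, y). f x y)" "\<And>x y. 0 \<le> f x y"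
  shows "0 \<le> tmean2 f"
  unfolding tmean2_def
  by (rule tmean_nonneg[OF continuous_on_tmean_slice[OF assms(1)]
        tmean_nonneg[OF continuous_on_slice(2)[OF assms(1)] assms(2)]])

lemma tmean2_cmult: "tmean2 (\<lambda>x y. c * f x y) = c * tmean2 f"
  unfolding tmean2_def tmean_cmult ..

lemma tmean2_add:
  assumes "continuous_on UNIV (\<lambda>(x, y). f x y)" "continuous_on UNIV (\<lambda>(x, y). g x y)"
  shows "tmean2 (\<lambda>x y. f x y + g x y) = tmean2 f + tmean2 g"
proof -
  have "tmean (\<lambda>y. f x y + g x y) = tmean (f x) + tmean (g x)" for x
    by (rule tmean_add[OF continuous_on_slice(2)[OF assms(1)] continuous_on_slice(2)[OF assms(2)]])
  then show ?thesis
    unfolding tmean2_def by (simp only:)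
      (rule tmean_add[OF continuous_on_tmean_slice[OF assms(1)] continuous_on_tmean_slice[OF assms(2)]])
qed

lemma tmean2_const [simp]: "tmean2 (\<lambda>x y. c) = c"
  by (simp add: tmean2_def)

lemma tmean2_sum:
  assumes "finite A" "\<And>i. i \<in> A \<Longrightarrow> continuous_on UNIV (\<lambda>(x, y). f i x y)"
  shows "tmean2 (\<lambda>x y. \<Sum>i\<in>A. f i x y) = (\<Sum>i\<in>A. tmean2 (f i))"
proof -
  have "tmean (\<lambda>y. \<Sum>i\<in>A. f i x y) = (\<Sum>i\<in>A. tmean (f i x))" for x
    by (rule tmean_sum[OF assms(1) continuous_on_slice(2)[OF assms(2)]])
  then show ?thesis
    unfolding tmean2_def by (simp only:)
      (rule tmean_sum[OF assms(1) continuous_on_tmean_slice[OF assms(2)]])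
qed

lemma tmean2_swap:
  assumes "continuous_on UNIV (\<lambda>(x, y). f x y)"
  shows "tmean2 (\<lambda>x y. f y x) = tmean2 f"
  using tmean_swap[OF assms] by (simp add: tmean2_def)

lemma tmean2_shift:
  assumes f: "continuous_on UNIV (\<lambda>(x, y). f x y)"
    and per: "\<And>x y. f (x + 2*pi) y = f x y" "\<And>x y. f x (y + 2*pi) = f x y"
  shows "tmean2 (\<lambda>x y. f (x + a) (y + b)) = tmean2 f"
proof -
  have "tmean (\<lambda>y. f (x + a) (y + b)) = tmean (f (x + a))" for x
    by (rule tmean_shift[OF continuous_on_slice(2)[OF f] per(2)])
  then have "tmean2 (\<lambda>x y. f (x + a) (y + b)) = tmean (\<lambda>x. tmean (f (x + a)))"
    by (simp add: tmean2_def)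
  also have "\<dots> = tmean2 f" unfolding tmean2_def
    by (rule tmean_shift[OF continuous_on_tmean_slice[OF f]]) (simp add: per)
  finally show ?thesis .
qed

lemma tmean2_reflect:
  assumes f: "continuous_on UNIV (\<lambda>(x, y). f x y)"
    and per: "\<And>x y. f (x + 2*pi) y = f x y" "\<And>x y. f x (y + 2*pi) = f x y"
  shows "tmean2 (\<lambda>x y. f (- x) y) = tmean2 f" "tmean2 (\<lambda>x y. f x (- y)) = tmean2 f"
proof -
  show "tmean2 (\<lambda>x y. f (- x) y) = tmean2 f" unfolding tmean2_def
    by (rule tmean_minus[OF continuous_on_tmean_slice[OF f]]) (simp add: per)
  have "tmean (\<lambda>y. f x (- y)) = tmean (f x)" for x
    by (rule tmean_minus[OF continuous_on_slice(2)[OF f] per(2)])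
  then show "tmean2 (\<lambda>x y. f x (- y)) = tmean2 f" by (simp add: tmean2_def)
qed

text \<open>With the mean over \<open>t\<close> moved outermost, each fixed \<open>t\<close>
  contributes the mean of a translate of \<open>f\<close>, which is the mean of \<open>f\<close>
  itself.\<close>

lemma tmean2_along_line:
  assumes f: "continuous_on UNIV (\<lambda>(x, y). f x y)"
    and per: "\<And>x y. f (x + 2*pi) y = f x y" "\<And>x y. f x (y + 2*pi) = f x y"
  shows "tmean2 (\<lambda>x y. tmean (\<lambda>t. f (x + a * t) (y + b * t))) = tmean2 f"
proof -
  have cf: "continuous_on S (\<lambda>z. f (u z) (v z))"
    if "continuous_on S u" "continuous_on S v" for S :: "'c::topological_space set" and u v
    using continuous_on_compose2[OF f, of S "\<lambda>z. (u z, v z)"] that by (auto intro!: continuous_intros)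
  have c1: "continuous_on UNIV (\<lambda>(y, t). f (x + a * t) (y + b * t))" for x
    unfolding case_prod_unfold by (intro cf continuous_intros)
  have c2: "continuous_on UNIV (\<lambda>(x, t). tmean (\<lambda>y. f (x + a * t) (y + b * t)))"
    unfolding case_prod_unfold
    by (rule continuous_on_tmean[where f = "\<lambda>z y. f (fst z + a * snd z) (y + b * snd z)"])
       (unfold case_prod_unfold, intro cf continuous_intros)
  have "tmean2 (\<lambda>x y. tmean (\<lambda>t. f (x + a * t) (y + b * t)))
      = tmean (\<lambda>x. tmean (\<lambda>t. tmean (\<lambda>y. f (x + a * t) (y + b * t))))"
    unfolding tmean2_def by (subst tmean_swap[OF c1]) (rule refl)
  also have "\<dots> = tmean (\<lambda>t. tmean (\<lambda>x. tmean (\<lambda>y. f (x + a * t) (y + b * t))))"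
    by (rule tmean_swap[OF c2])
  also have "\<dots> = tmean (\<lambda>t. tmean2 f)"
    using tmean2_shift[OF f per] by (simp add: tmean2_def)
  finally show ?thesis by simp
qed

section \<open>Half planes and the rhombus as Fourier multipliers\<close>

text \<open>Conjugation followed by multiplication with \<open>cis ((d - 1) * t)\<close> preserves
  moduli and sends the frequency \<open>\<omega> x\<close> to \<open>d - 1 - \<omega> x\<close>,
  which is nonnegative exactly when \<open>\<omega> x < d\<close>. The remaining terms get strictly
  negative frequencies, hence \<open>poly b 0 = 0\<close>. The frequency is a function on an index
  set because many lattice points share one frequency along a line.\<close>

lemma riesz_filter:
  assumes "1 < p"
  shows "\<exists>C\<ge>0. \<forall>(A :: 'a set) (c :: 'a \<Rightarrow> complex) (\<omega> :: 'a \<Rightarrow> int) d. finite A \<longrightarrow>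
    tmean (\<lambda>t. cmod (\<Sum>x\<in>{x\<in>A. \<omega> x < d}. c x * cis (of_int (\<omega> x) * t)) powr p)
    \<le> C * tmean (\<lambda>t. cmod (\<Sum>x\<in>A. c x * cis (of_int (\<omega> x) * t)) powr p)"
proof -
  obtain C where C: "C \<ge> 0" and R: "\<And>a b :: complex poly. poly b 0 = 0 \<Longrightarrow>
     tmean (\<lambda>t. cmod (poly a (cis t)) powr p) \<le>
     C * tmean (\<lambda>t. cmod (poly a (cis t) + poly b (cis (- t))) powr p)"
    using riesz_bound[OF assms] unfolding riesz_bound_def by blast
  have "tmean (\<lambda>t. cmod (\<Sum>x\<in>{x\<in>A. \<omega> x < d}. c x * cis (of_int (\<omega> x) * t)) powr p)
    \<le> C * tmean (\<lambda>t. cmod (\<Sum>x\<in>A. c x * cis (of_int (\<omega> x) * t)) powr p)"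
    if A: "finite A" for A :: "'a set" and c :: "'a \<Rightarrow> complex" and \<omega> :: "'a \<Rightarrow> int" and d
  proof -
    define a where "a = (\<Sum>x\<in>{x\<in>A. \<omega> x < d}. monom (cnj (c x)) (nat (d - 1 - \<omega> x)))"
    define b where "b = (\<Sum>x\<in>{x\<in>A. \<not> \<omega> x < d}. monom (cnj (c x)) (nat (\<omega> x - (d - 1))))"
    have b0: "poly b 0 = 0"
      unfolding b_def poly_sum poly_monom by (intro sum.neutral) auto
    have e: "cnj (c x * cis (of_int (\<omega> x) * t)) * cis (of_int (d - 1) * t) = cnj (c x) * cis (of_int (d - 1 - \<omega> x) * t)" for x t
      by (simp add: cis_cnj cis_mult algebra_simps)
    have pa: "poly a (cis t) = cnj (\<Sum>x\<in>{x\<in>A. \<omega> x < d}. c x * cis (of_int (\<omega> x) * t)) * cis (of_int (d - 1) * t)" for t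
      unfolding a_def poly_sum poly_monom cnj_sum sum_distrib_right e
      by (intro sum.cong refl) (auto simp: Complex.DeMoivre of_nat_diff)
    have pb: "poly b (cis (- t)) = cnj (\<Sum>x\<in>{x\<in>A. \<not> \<omega> x < d}. c x * cis (of_int (\<omega> x) * t)) * cis (of_int (d - 1) * t)" for t
      unfolding b_def poly_sum poly_monom cnj_sum sum_distrib_right e
      by (intro sum.cong refl) (auto simp: Complex.DeMoivre of_nat_diff algebra_simps)
    have "A = {x\<in>A. \<omega> x < d} \<union> {x\<in>A. \<not> \<omega> x < d}" by auto
    then have "(\<Sum>x\<in>A. c x * cis (of_int (\<omega> x) * t)) =
       (\<Sum>x\<in>{x\<in>A. \<omega> x < d}. c x * cis (of_int (\<omega> x) * t)) + (\<Sum>x\<in>{x\<in>A. \<not> \<omega> x < d}. c x * cis (of_int (\<omega> x) * t))" for t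
      using A sum.union_disjoint[of "{x\<in>A. \<omega> x < d}" "{x\<in>A. \<not> \<omega> x < d}" "\<lambda>x. c x * cis (of_int (\<omega> x) * t)"] by auto
    then have pab: "poly a (cis t) + poly b (cis (- t)) = cnj (\<Sum>x\<in>A. c x * cis (of_int (\<omega> x) * t)) * cis (of_int (d - 1) * t)" for t
      unfolding pa pb by (simp add: algebra_simps)
    have "cmod (cnj z * cis s) = cmod z" for z s by (simp add: norm_mult)
    then show ?thesis using R[OF b0, of a] unfolding pab unfolding pa by (simp only:)
  qed
  then show ?thesis using C by blast
qed

definition trig2 :: "(int \<times> int) set \<Rightarrow> (int \<times> int \<Rightarrow> complex) \<Rightarrow> real \<Rightarrow> real \<Rightarrow> complex" where
  "trig2 A c x y = (\<Sum>k\<in>A. c k * cis (of_int (fst k) * x + of_int (snd k) * y))"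

lemma continuous_on_trig2 [continuous_intros]:
  "continuous_on S u \<Longrightarrow> continuous_on S v \<Longrightarrow> continuous_on S (\<lambda>z. trig2 A c (u z) (v z))"
  unfolding trig2_def by (intro continuous_intros)

lemma trig2_periodic: "trig2 A c (x + 2*pi) y = trig2 A c x y" "trig2 A c x (y + 2*pi) = trig2 A c x y"
proof -
  have "cis (of_int k * (x + 2*pi) + s) = cis (of_int k * x + s)" for k s x
    unfolding cis_mult[symmetric] cis_2pi_int ..
  moreover from this have "cis (s + of_int k * (x + 2*pi)) = cis (s + of_int k * x)" for k s x
    by (simp add: add.commute)
  ultimately show "trig2 A c (x + 2*pi) y = trig2 A c x y" "trig2 A c x (y + 2*pi) = trig2 A c x y"
    by (simp_all only: trig2_def)
qed

lemma continuous_on_trig2_powr: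
  assumes "0 < p"
  shows "continuous_on UNIV (\<lambda>(x, y). cmod (trig2 A c x y) powr p)"
  unfolding case_prod_unfold using assms by (intro continuous_on_cmod_powr continuous_intros)

text \<open>Restricted to a line in direction \<open>(a, b)\<close>, the half plane \<open>a k + b l < d\<close> cuts off the frequencies of a
  one-dimensional trigonometric polynomial; averaging over all such lines gives back the mean over the torus.\<close>

lemma half_plane_multiplier:
  assumes "1 < p"
  shows "\<exists>C\<ge>0. \<forall>A c a b d. finite A \<longrightarrow>
    tmean2 (\<lambda>x y. cmod (trig2 {k\<in>A. a * fst k + b * snd k < d} c x y) powr p)
    \<le> C * tmean2 (\<lambda>x y. cmod (trig2 A c x y) powr p)"
proof -
  obtain C where C: "C \<ge> 0" and R: "\<And>(A :: (int \<times> int) set) c \<omega> d. finite A \<Longrightarrow>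
    tmean (\<lambda>t. cmod (\<Sum>x\<in>{x\<in>A. \<omega> x < d}. c x * cis (of_int (\<omega> x) * t)) powr p)
    \<le> C * tmean (\<lambda>t. cmod (\<Sum>x\<in>A. c x * cis (of_int (\<omega> x) * t)) powr p)"
    using riesz_filter[OF assms, where 'a = "int \<times> int"] by blast
  have "tmean2 (\<lambda>x y. cmod (trig2 {k\<in>A. a * fst k + b * snd k < d} c x y) powr p)
    \<le> C * tmean2 (\<lambda>x y. cmod (trig2 A c x y) powr p)" if A: "finite A" for A c a b d
  proof -
    define f where "f = (\<lambda>A x y. cmod (trig2 A c x y) powr p)"
    have cf: "continuous_on UNIV (\<lambda>(x, y). f A x y)" for A
      unfolding f_def using assms by (intro continuous_on_trig2_powr) auto
    have per: "f A (x + 2*pi) y = f A x y" "f A x (y + 2*pi) = f A x y" for A x y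
      unfolding f_def trig2_periodic by simp_all
    have line: "tmean2 (\<lambda>x y. tmean (\<lambda>t. f A (x + of_int a * t) (y + of_int b * t))) = tmean2 (f A)" for A
      by (rule tmean2_along_line[OF cf per])
    have cl: "continuous_on UNIV (\<lambda>(x, y). tmean (\<lambda>t. f A (x + of_int a * t) (y + of_int b * t)))" for A
      unfolding case_prod_unfold
      by (rule continuous_on_tmean[where f = "\<lambda>z t. f A (fst z + of_int a * t) (snd z + of_int b * t)"])
         (unfold case_prod_unfold f_def, use assms in \<open>auto intro!: continuous_on_cmod_powr continuous_intros\<close>)
    have e: "trig2 B c (x + of_int a * t) (y + of_int b * t) =
       (\<Sum>k\<in>B. (c k * cis (of_int (fst k) * x + of_int (snd k) * y)) * cis (of_int (a * fst k + b * snd k) * t))" for B x y t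
      unfolding trig2_def mult.assoc cis_mult by (intro sum.cong refl) (simp add: algebra_simps)
    have "tmean (\<lambda>t. f {k\<in>A. a * fst k + b * snd k < d} (x + of_int a * t) (y + of_int b * t))
       \<le> C * tmean (\<lambda>t. f A (x + of_int a * t) (y + of_int b * t))" for x y
      unfolding f_def e by (rule R[OF A])
    then have "tmean2 (\<lambda>x y. tmean (\<lambda>t. f {k\<in>A. a * fst k + b * snd k < d} (x + of_int a * t) (y + of_int b * t)))
       \<le> tmean2 (\<lambda>x y. C * tmean (\<lambda>t. f A (x + of_int a * t) (y + of_int b * t)))"
      using cl[of A] by (intro tmean2_mono cl) (auto simp: case_prod_unfold intro!: continuous_intros)
    then show ?thesis unfolding tmean2_cmult line unfolding f_def .
  qed
  then show ?thesis using C by blast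
qed

definition rhombus :: "nat \<Rightarrow> nat \<Rightarrow> (int \<times> int) set" where
  "rhombus m n = {k. \<bar>fst k\<bar> * int n + \<bar>snd k\<bar> * int m < int m * int n}"

text \<open>Four successive half-plane cuts cost \<open>C ^ 4\<close>. The half-plane constant is
  uniform in \<open>a\<close>, \<open>b\<close> and \<open>d\<close>, so the result is uniform in
  \<open>m\<close> and \<open>n\<close> although the slopes vary.\<close>

lemma rhombus_multiplier:
  assumes "1 < p"
  shows "\<exists>C\<ge>0. \<forall>A c m n. finite A \<longrightarrow> rhombus m n \<subseteq> A \<longrightarrow>
    tmean2 (\<lambda>x y. cmod (trig2 (rhombus m n) c x y) powr p)
    \<le> C * tmean2 (\<lambda>x y. cmod (trig2 A c x y) powr p)"
proof -
  obtain C where C: "C \<ge> 0" and R: "\<And>A c a b d. finite A \<Longrightarrow>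
    tmean2 (\<lambda>x y. cmod (trig2 {k\<in>A. a * fst k + b * snd k < d} c x y) powr p)
    \<le> C * tmean2 (\<lambda>x y. cmod (trig2 A c x y) powr p)"
    using half_plane_multiplier[OF assms] by blast
  have "tmean2 (\<lambda>x y. cmod (trig2 (rhombus m n) c x y) powr p)
    \<le> C ^ 4 * tmean2 (\<lambda>x y. cmod (trig2 A c x y) powr p)"
    if A: "finite A" "rhombus m n \<subseteq> A" for A c m n
  proof -
    define N where "N = int m * int n"
    define f where "f = (\<lambda>(a, b) A. {k\<in>A. a * fst k + b * snd k < N})"
    define A1 where "A1 = f (int n, int m) A"
    define A2 where "A2 = f (int n, - int m) A1"
    define A3 where "A3 = f (- int n, int m) A2"
    define A4 where "A4 = f (- int n, - int m) A3"
    have fin: "finite A1" "finite A2" "finite A3"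
      unfolding A1_def A2_def A3_def f_def using A by auto
    have abs4: "\<bar>u\<bar> + \<bar>v\<bar> < N \<longleftrightarrow> u + v < N \<and> u - v < N \<and> - u + v < N \<and> - u - v < N" for u v :: int
      by arith
    have "rhombus m n = {k. \<bar>int n * fst k\<bar> + \<bar>int m * snd k\<bar> < N}"
      unfolding rhombus_def N_def by (simp add: abs_mult mult.commute)
    then have A4: "A4 = rhombus m n"
      using A(2) unfolding A1_def A2_def A3_def A4_def f_def abs4 by auto
    let ?I = "\<lambda>A. tmean2 (\<lambda>x y. cmod (trig2 A c x y) powr p)"
    have step: "?I (f ab B) \<le> C * ?I B" if "finite B" for ab B
      using R[OF that, of "fst ab" "snd ab" N c] by (simp add: f_def case_prod_unfold)
    have "?I A4 \<le> C * ?I A3" unfolding A4_def by (rule step) (rule fin)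
    also have "\<dots> \<le> C * (C * ?I A2)" unfolding A3_def using C by (intro mult_left_mono step fin)
    also have "\<dots> \<le> C * (C * (C * ?I A1))" unfolding A2_def using C by (intro mult_left_mono step fin)
    also have "\<dots> \<le> C * (C * (C * (C * ?I A)))" unfolding A1_def using C A by (intro mult_left_mono step)
    finally show ?thesis using A4 by (simp add: eval_nat_numeral mult.assoc)
  qed
  moreover have "C ^ 4 \<ge> 0" using C by simp
  ultimately show ?thesis by blast
qed

section \<open>Sampling and smoothing on product grids\<close>

lemma vp_expand:
  "\<exists>v. (\<forall>k. \<bar>k\<bar> \<le> int m \<longrightarrow> v k = 1) \<and>
     (\<forall>x. complex_of_real (vp m x) = (\<Sum>k\<in>{-int (2*m)..int (2*m)}. v k * cis (of_int k * x)))"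
  if "m > 0"
proof -
  \<comment> \<open>\<open>N M k\<close> counts the pairs \<open>i, j < M\<close> with
    \<open>i - j = k\<close>: the triangular Fejer weight.\<close>
  define N where "N = (\<lambda>M (k::int). \<Sum>i<M. \<Sum>j<M. if k = int i - int j then 1 else (0::complex))"
  define v where "v = (\<lambda>k. (N (2*m) k - N m k) / of_nat m)"
  have S: "of_real (dsq M x) = (\<Sum>k\<in>{-int (2*m)..int (2*m)}. N M k * cis (of_int k * x))" if "M \<le> 2*m" for M x
  proof -
    have "(\<Sum>k\<in>{-int (2*m)..int (2*m)}. N M k * cis (of_int k * x))
      = (\<Sum>k\<in>{-int (2*m)..int (2*m)}. \<Sum>i<M. \<Sum>j<M. if k = int i - int j then cis (of_int k * x) else 0)"
      unfolding N_def sum_distrib_right by (intro sum.cong refl) auto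
    also have "\<dots> = (\<Sum>i<M. \<Sum>j<M. \<Sum>k\<in>{-int (2*m)..int (2*m)}. if k = int i - int j then cis (of_int k * x) else 0)"
      by (rule sum_rotate[symmetric])
    also have "\<dots> = (\<Sum>i<M. \<Sum>j<M. cis (of_int (int i - int j) * x))"
      using that by (intro sum.cong refl) auto
    finally show ?thesis by (simp only: dsq_expand)
  qed
  have "v k = 1" if "\<bar>k\<bar> \<le> int m" for k
  proof -
    have "N (2*m) k - N m k = of_nat m * (\<Sum>l\<in>{-int m..int m}. if k = l then 1 else 0)"
      unfolding N_def by (rule vallee_poussin_sum) (use that in auto)
    also have "\<dots> = of_nat m" using that by auto
    finally show ?thesis using \<open>m > 0\<close> by (simp add: v_def)
  qed
  moreover have "complex_of_real (vp m x) = (\<Sum>k\<in>{-int (2*m)..int (2*m)}. v k * cis (of_int k * x))" for x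
  proof -
    have "complex_of_real (vp m x) = (of_real (dsq (2*m) x) - of_real (dsq m x)) / of_nat m"
      by (simp add: vp_def)
    also have "\<dots> = (\<Sum>k\<in>{-int (2*m)..int (2*m)}. v k * cis (of_int k * x))"
      by (subst S, simp, subst S, simp)
         (simp add: v_def sum_subtractf sum_divide_distrib left_diff_distrib diff_divide_distrib)
    finally show ?thesis .
  qed
  ultimately show ?thesis by blast
qed

text \<open>The inequality in one variable is used in \<open>y\<close> at each node of the first
  coordinate, and then in \<open>x\<close> for each \<open>y\<close> under the mean; this squares
  the constant.\<close>

lemma marcinkiewicz_zygmund_2d:
  fixes c :: "int \<times> int \<Rightarrow> complex"
  assumes m: "m > 0" and n: "n > 0" and p: "1 \<le> p"
  defines "H \<equiv> trig2 ({-int m..int m} \<times> {-int n..int n}) c"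
  shows "(\<Sum>i<2*m. \<Sum>j<2*n. cmod (H (pi * real i / real m) (pi * real j / real n)) powr p)
    \<le> (2 * 4 powr p)\<^sup>2 * (real (2*m) * real (2*n)) * tmean2 (\<lambda>x y. cmod (H x y) powr p)"
proof -
  define B :: real where "B = 2 * 4 powr p"
  have B: "B \<ge> 0" by (simp add: B_def)
  have H: "H x y = (\<Sum>k\<in>{-int m..int m}. \<Sum>l\<in>{-int n..int n}. c (k, l) * cis (of_int k * x) * cis (of_int l * y))" for x y
    unfolding H_def trig2_def by (simp add: cis_mult mult.assoc sum.cartesian_product case_prod_unfold)
  have cH: "continuous_on UNIV (\<lambda>(x, y). cmod (H x y) powr p)"
    unfolding H_def using p by (intro continuous_on_trig2_powr) auto
  have cH': "continuous_on S (\<lambda>x. cmod (H x y) powr p)" for S y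
    using continuous_on_slice(1)[OF cH] .
  have rowy: "(\<Sum>j<2*n. cmod (H x (pi * real j / real n)) powr p) \<le> B * (real (2*n) * tmean (\<lambda>y. cmod (H x y) powr p))" for x
    unfolding B_def
  proof (rule marcinkiewicz_zygmund[OF _ n p])
    show "H x y = (\<Sum>l\<in>{-int n..int n}. (\<Sum>k\<in>{-int m..int m}. c (k, l) * cis (of_int k * x)) * cis (of_int l * y))" for y
      unfolding H sum_distrib_right by (rule sum.swap)
  qed
  have rowx: "(\<Sum>i<2*m. cmod (H (pi * real i / real m) y) powr p) \<le> B * (real (2*m) * tmean (\<lambda>x. cmod (H x y) powr p))" for y
    unfolding B_def
  proof (rule marcinkiewicz_zygmund[OF _ m p])
    show "H x y = (\<Sum>k\<in>{-int m..int m}. (\<Sum>l\<in>{-int n..int n}. c (k, l) * cis (of_int l * y)) * cis (of_int k * x))" for x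
      unfolding H sum_distrib_right by (intro sum.cong refl) (simp add: mult_ac)
  qed
  have cH2: "continuous_on UNIV (\<lambda>(y, x). cmod (H x y) powr p)"
    unfolding H_def case_prod_unfold using p by (intro continuous_on_cmod_powr continuous_intros) auto
  have "(\<Sum>i<2*m. \<Sum>j<2*n. cmod (H (pi * real i / real m) (pi * real j / real n)) powr p)
     \<le> (\<Sum>i<2*m. B * (real (2*n) * tmean (\<lambda>y. cmod (H (pi * real i / real m) y) powr p)))"
    by (intro sum_mono rowy)
  also have "\<dots> = B * (real (2*n) * tmean (\<lambda>y. \<Sum>i<2*m. cmod (H (pi * real i / real m) y) powr p))"
    by (simp only: sum_distrib_left[symmetric])
       (subst tmean_sum, simp, rule continuous_on_slice(2)[OF cH], rule refl)
  also have "\<dots> \<le> B * (real (2*n) * tmean (\<lambda>y. B * (real (2*m) * tmean (\<lambda>x. cmod (H x y) powr p))))"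
    using B
    by (intro mult_left_mono tmean_mono rowx continuous_on_sum continuous_on_slice(2)[OF cH]
        continuous_on_mult_left continuous_on_tmean_slice[OF cH2]) auto
  also have "tmean (\<lambda>y. B * (real (2*m) * tmean (\<lambda>x. cmod (H x y) powr p))) = B * (real (2*m) * tmean2 (\<lambda>x y. cmod (H x y) powr p))"
    unfolding tmean_cmult tmean2_def by (subst tmean_swap[OF cH]) (rule refl)
  finally show ?thesis by (simp add: B_def power2_eq_square mult_ac)
qed

lemma tmean2_vp_sum_le:
  fixes F :: "nat \<Rightarrow> nat \<Rightarrow> complex"
  assumes m: "m > 0" and n: "n > 0" and p: "1 \<le> p"
  shows "real (2*m) * real (2*n) * tmean2 (\<lambda>x y. cmod ((\<Sum>i<2*m. \<Sum>j<2*n. F i j *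
      of_real (vp m (x - pi * real i / real m)) * of_real (vp n (y - pi * real j / real n))) / (of_nat (2*m) * of_nat (2*n))) powr p)
    \<le> (2 * 4 powr p)\<^sup>2 * (\<Sum>i<2*m. \<Sum>j<2*n. cmod (F i j) powr p)"
proof -
  define B :: real where "B = 2 * 4 powr p"
  have B: "B \<ge> 0" by (simp add: B_def)
  define g where "g = (\<lambda>j x. (\<Sum>i<2*m. F i j * of_real (vp m (x - pi * real i / real m))) / of_nat (2*m))"
  define h where "h = (\<lambda>x y. (\<Sum>j<2*n. g j x * of_real (vp n (y - pi * real j / real n))) / of_nat (2*n))"
  have vpc [continuous_intros]: "continuous_on S f \<Longrightarrow> k > 0 \<Longrightarrow> continuous_on S (\<lambda>z. vp k (f z))"
    for S :: "'c::topological_space set" and f k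
    unfolding vp_def by (intro continuous_intros) auto
  have gc: "continuous_on S f \<Longrightarrow> continuous_on S (\<lambda>z. g j (f z))" for S :: "'c::topological_space set" and f j
    unfolding g_def using m by (intro continuous_intros) auto
  have ch: "continuous_on UNIV (\<lambda>(x, y). cmod (h x y) powr p)"
    unfolding h_def case_prod_unfold using p n by (intro continuous_on_cmod_powr continuous_intros gc) auto
  have cg: "continuous_on S (\<lambda>x. cmod (g j x) powr p)" for S j
    using p by (intro continuous_on_cmod_powr gc continuous_intros) auto
  have eq: "(\<Sum>i<2*m. \<Sum>j<2*n. F i j * of_real (vp m (x - pi * real i / real m)) * of_real (vp n (y - pi * real j / real n))) / (of_nat (2*m) * of_nat (2*n)) = h x y" for x y
    unfolding h_def g_def sum_divide_distrib sum_distrib_right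
    by (subst sum.swap) (simp add: field_simps)
  have 1: "real (2*n) * tmean (\<lambda>y. cmod (h x y) powr p) \<le> B * (\<Sum>j<2*n. cmod (g j x) powr p)" for x
    unfolding h_def B_def by (rule tmean_vp_sum_le[OF n p])
  have 2: "real (2*m) * tmean (\<lambda>x. cmod (g j x) powr p) \<le> B * (\<Sum>i<2*m. cmod (F i j) powr p)" for j
    unfolding g_def B_def by (rule tmean_vp_sum_le[OF m p])
  have "real (2*m) * real (2*n) * tmean2 (\<lambda>x y. cmod (h x y) powr p)
      = real (2*m) * tmean (\<lambda>x. real (2*n) * tmean (\<lambda>y. cmod (h x y) powr p))"
    by (simp add: tmean2_def tmean_cmult)
  also have "\<dots> \<le> real (2*m) * tmean (\<lambda>x. B * (\<Sum>j<2*n. cmod (g j x) powr p))"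
    by (intro mult_left_mono tmean_mono 1 continuous_on_mult_left continuous_on_sum cg
        continuous_on_tmean_slice[OF ch]) auto
  also have "\<dots> = B * (\<Sum>j<2*n. real (2*m) * tmean (\<lambda>x. cmod (g j x) powr p))"
    unfolding tmean_cmult by (subst tmean_sum, simp, rule cg) (simp add: sum_distrib_left mult_ac)
  also have "\<dots> \<le> B * (\<Sum>j<2*n. B * (\<Sum>i<2*m. cmod (F i j) powr p))"
    using B by (intro mult_left_mono sum_mono 2) auto
  also have "\<dots> = B\<^sup>2 * (\<Sum>j<2*n. \<Sum>i<2*m. cmod (F i j) powr p)"
    by (simp add: sum_distrib_left power2_eq_square mult_ac)
  also have "(\<Sum>j<2*n. \<Sum>i<2*m. cmod (F i j) powr p) = (\<Sum>i<2*m. \<Sum>j<2*n. cmod (F i j) powr p)"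
    by (rule sum.swap)
  finally show ?thesis unfolding eq B_def .
qed

text \<open>The Dirichlet kernel of the open rhombus; the boundary frequency that the interpolation
  space also contains is added later, in \<open>ekr\<close>.\<close>

definition rker :: "nat \<Rightarrow> nat \<Rightarrow> real \<Rightarrow> real \<Rightarrow> complex" where
  "rker m n = trig2 (rhombus m n) (\<lambda>_. 1)"

lemma rhombus_subset: "rhombus m n \<subseteq> {-int m..int m} \<times> {-int n..int n}"
proof
  fix k assume "k \<in> rhombus m n"
  then have k: "\<bar>fst k\<bar> * int n + \<bar>snd k\<bar> * int m < int m * int n" by (simp add: rhombus_def)
  have "\<bar>fst k\<bar> * int n < int m * int n"
    using k mult_nonneg_nonneg[of "\<bar>snd k\<bar>" "int m"] by linarith
  then have "\<bar>fst k\<bar> < int m" using mult_right_less_imp_less[of "\<bar>fst k\<bar>" "int n" "int m"] by simp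
  moreover have "\<bar>snd k\<bar> * int m < int n * int m"
    using k mult_nonneg_nonneg[of "\<bar>fst k\<bar>" "int n"] mult.commute[of "int m" "int n"] by linarith
  then have "\<bar>snd k\<bar> < int n" using mult_right_less_imp_less[of "\<bar>snd k\<bar>" "int m" "int n"] by simp
  ultimately show "k \<in> {-int m..int m} \<times> {-int n..int n}"
    by (cases k) auto
qed

lemma finite_rhombus [simp]: "finite (rhombus m n)"
  by (rule finite_subset[OF rhombus_subset]) auto

text \<open>The product kernel \<open>vp m x * vp n y\<close> has coefficient 1 on a box that
  contains the rhombus. Restricting the frequencies of the smoothed measure to the rhombus therefore
  gives the same result as convolving the measure itself with \<open>rker\<close>, and only the
  multiplier bound and the dual sampling inequality are combined.\<close>

lemma rker_sum_bound:
  assumes "1 < p"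
  shows "\<exists>C\<ge>0. \<forall>m n (F :: nat \<Rightarrow> nat \<Rightarrow> complex). m > 0 \<longrightarrow> n > 0 \<longrightarrow>
    real (2*m) * real (2*n) * tmean2 (\<lambda>x y. cmod ((\<Sum>i<2*m. \<Sum>j<2*n. F i j * rker m n (x - pi * real i / real m) (y - pi * real j / real n)) / (of_nat (2*m) * of_nat (2*n))) powr p)
    \<le> C * (\<Sum>i<2*m. \<Sum>j<2*n. cmod (F i j) powr p)"
proof -
  obtain C where C: "C \<ge> 0" and R: "\<And>A c m n. finite A \<Longrightarrow> rhombus m n \<subseteq> A \<Longrightarrow>
    tmean2 (\<lambda>x y. cmod (trig2 (rhombus m n) c x y) powr p)
    \<le> C * tmean2 (\<lambda>x y. cmod (trig2 A c x y) powr p)"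
    using rhombus_multiplier[OF assms] by blast
  have "real (2*m) * real (2*n) * tmean2 (\<lambda>x y. cmod ((\<Sum>i<2*m. \<Sum>j<2*n. F i j * rker m n (x - pi * real i / real m) (y - pi * real j / real n)) / (of_nat (2*m) * of_nat (2*n))) powr p)
    \<le> (C * (2 * 4 powr p)\<^sup>2) * (\<Sum>i<2*m. \<Sum>j<2*n. cmod (F i j) powr p)"
    if m: "m > 0" and n: "n > 0" for m n and F :: "nat \<Rightarrow> nat \<Rightarrow> complex"
  proof -
    obtain v where v1: "\<And>k. \<bar>k\<bar> \<le> int m \<Longrightarrow> v k = 1" and
      v: "\<And>x. complex_of_real (vp m x) = (\<Sum>k\<in>{-int (2*m)..int (2*m)}. v k * cis (of_int k * x))"
      using vp_expand[OF m] by blast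
    obtain w where w1: "\<And>k. \<bar>k\<bar> \<le> int n \<Longrightarrow> w k = 1" and
      w: "\<And>x. complex_of_real (vp n x) = (\<Sum>k\<in>{-int (2*n)..int (2*n)}. w k * cis (of_int k * x))"
      using vp_expand[OF n] by blast
    define A where "A = {-int (2*m)..int (2*m)} \<times> {-int (2*n)..int (2*n)}"
    \<comment> \<open>The Fourier coefficients of the discrete measure with masses
      \<open>F i j\<close>, normalised by the number of grid points.\<close>
    define Fh where "Fh = (\<lambda>k::int \<times> int. (\<Sum>i<2*m. \<Sum>j<2*n. F i j * cis (- (of_int (fst k) * (pi * real i / real m) + of_int (snd k) * (pi * real j / real n)))) / (of_nat (2*m) * of_nat (2*n)))"
    define c where "c = (\<lambda>k. v (fst k) * w (snd k) * Fh k)"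
    have shift: "(\<Sum>i<2*m. \<Sum>j<2*n. F i j * (\<Sum>k\<in>D. d k * cis (of_int (fst k) * (x - pi * real i / real m) + of_int (snd k) * (y - pi * real j / real n)))) / (of_nat (2*m) * of_nat (2*n))
      = trig2 D (\<lambda>k. d k * Fh k) x y" for D :: "(int \<times> int) set" and d x y
    proof -
      have e: "cis (of_int (fst k) * (x - pi * real i / real m) + of_int (snd k) * (y - pi * real j / real n)) =
        cis (- (of_int (fst k) * (pi * real i / real m) + of_int (snd k) * (pi * real j / real n))) * cis (of_int (fst k) * x + of_int (snd k) * y)" for k :: "int \<times> int" and i j
        unfolding cis_mult by (simp add: algebra_simps)
      have "(\<Sum>i<2*m. \<Sum>j<2*n. F i j * (\<Sum>k\<in>D. d k * cis (of_int (fst k) * (x - pi * real i / real m) + of_int (snd k) * (y - pi * real j / real n))))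
        = (\<Sum>i<2*m. \<Sum>j<2*n. \<Sum>k\<in>D. F i j * cis (- (of_int (fst k) * (pi * real i / real m) + of_int (snd k) * (pi * real j / real n))) * (d k * cis (of_int (fst k) * x + of_int (snd k) * y)))"
        unfolding e sum_distrib_left by (intro sum.cong refl) (simp only: mult_ac)
      also have "\<dots> = (\<Sum>k\<in>D. \<Sum>i<2*m. \<Sum>j<2*n. F i j * cis (- (of_int (fst k) * (pi * real i / real m) + of_int (snd k) * (pi * real j / real n))) * (d k * cis (of_int (fst k) * x + of_int (snd k) * y)))"
        by (rule sum_rotate)
      also have "\<dots> = (\<Sum>k\<in>D. (of_nat (2*m) * of_nat (2*n)) * (d k * Fh k * cis (of_int (fst k) * x + of_int (snd k) * y)))"
        unfolding sum_distrib_right[symmetric] using m n by (intro sum.cong refl) (simp add: Fh_def)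
      finally show ?thesis using m n by (simp add: trig2_def sum_distrib_left[symmetric])
    qed
    have vw: "complex_of_real (vp m x) * of_real (vp n y) = (\<Sum>k\<in>A. (v (fst k) * w (snd k)) * cis (of_int (fst k) * x + of_int (snd k) * y))" for x y
      unfolding v w sum_product A_def cis_mult[symmetric] sum.cartesian_product
      by (intro sum.cong refl) (auto simp: mult_ac)
    have eqA: "(\<Sum>i<2*m. \<Sum>j<2*n. F i j * of_real (vp m (x - pi * real i / real m)) * of_real (vp n (y - pi * real j / real n))) / (of_nat (2*m) * of_nat (2*n)) = trig2 A c x y" for x y
      unfolding mult.assoc[of "F _ _"] vw c_def by (rule shift)
    have eqR: "(\<Sum>i<2*m. \<Sum>j<2*n. F i j * rker m n (x - pi * real i / real m) (y - pi * real j / real n)) / (of_nat (2*m) * of_nat (2*n)) = trig2 (rhombus m n) c x y" for x y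
    proof -
      have "trig2 (rhombus m n) c x y = trig2 (rhombus m n) (\<lambda>k. 1 * Fh k) x y"
        unfolding trig2_def
      proof (intro sum.cong refl)
        fix k assume "k \<in> rhombus m n"
        then have "k \<in> {-int m..int m} \<times> {-int n..int n}" using rhombus_subset by blast
        then have "v (fst k) = 1" "w (snd k) = 1" by (cases k; auto intro!: v1 w1)+
        then show "c k * cis (of_int (fst k) * x + of_int (snd k) * y) = 1 * Fh k * cis (of_int (fst k) * x + of_int (snd k) * y)"
          by (simp add: c_def)
      qed
      then show ?thesis
        unfolding rker_def trig2_def[of "rhombus m n" "\<lambda>_. 1"] shift by simp
    qed
    have sub: "rhombus m n \<subseteq> A" using rhombus_subset[of m n] unfolding A_def by force
    have "tmean2 (\<lambda>x y. cmod (trig2 (rhombus m n) c x y) powr p) \<le> C * tmean2 (\<lambda>x y. cmod (trig2 A c x y) powr p)"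
      by (rule R[OF _ sub]) (simp add: A_def)
    then have "real (2*m) * real (2*n) * tmean2 (\<lambda>x y. cmod (trig2 (rhombus m n) c x y) powr p)
       \<le> real (2*m) * real (2*n) * (C * tmean2 (\<lambda>x y. cmod (trig2 A c x y) powr p))"
      by (rule mult_left_mono) simp
    also have "\<dots> = C * (real (2*m) * real (2*n) * tmean2 (\<lambda>x y. cmod (trig2 A c x y) powr p))"
      by (simp only: mult_ac)
    also have "\<dots> \<le> C * ((2 * 4 powr p)\<^sup>2 * (\<Sum>i<2*m. \<Sum>j<2*n. cmod (F i j) powr p))"
      using C tmean2_vp_sum_le[OF m n, of p F] assms unfolding eqA by (intro mult_left_mono) auto
    finally show ?thesis unfolding eqR by (simp add: mult_ac)
  qed
  moreover have "C * (2 * 4 powr p)\<^sup>2 \<ge> 0" using C by simp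
  ultimately show ?thesis by blast
qed

section \<open>The \<open>L\<^sub>1\<close> norm of the rhombic Dirichlet kernel\<close>

text \<open>The integral of \<open>min M (1/t)\<close> over \<open>[0, pi]\<close>, for
  \<open>M \<ge> 1\<close>.\<close>

definition loglen :: "real \<Rightarrow> real" where
  "loglen M = 1 + ln (pi * M)"

lemma loglen_ge_1: "1 \<le> M \<Longrightarrow> 1 \<le> loglen M"
  unfolding loglen_def using pi_gt3 mult_mono[of 1 pi 1 M] by simp

lemma loglen_mono: "1 \<le> M \<Longrightarrow> M \<le> N \<Longrightarrow> loglen M \<le> loglen N"
  unfolding loglen_def using pi_gt_zero by simp

lemma loglen_le:
  "\<exists>\<kappa>>0. \<forall>M::nat. M \<ge> 1 \<longrightarrow> loglen (2 * real M) \<le> \<kappa> * ln (real M + 1)"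
proof -
  \<comment> \<open>The quotient absorbs the additive constant \<open>1 + ln (2*pi)\<close>, as
    \<open>ln (M + 1) \<ge> ln 2\<close>; the summand 1 accounts for \<open>ln M\<close>.\<close>
  define \<kappa> where "\<kappa> = (1 + ln (2*pi)) / ln 2 + 1"
  have l2p: "ln (2*pi) \<ge> 0" using pi_gt3 by simp
  have l2: "ln (2::real) > 0" by simp
  have "loglen (2 * real M) \<le> \<kappa> * ln (real M + 1)" if "M \<ge> 1" for M :: nat
  proof -
    have "ln (pi * (2 * real M)) = ln (2*pi) + ln (real M)"
      using that ln_mult[of "2*pi" "real M"] by (simp add: mult_ac)
    moreover have "ln (real M) \<le> ln (real M + 1)" using that by simp
    moreover have "1 + ln (2*pi) \<le> (1 + ln (2*pi)) / ln 2 * ln (real M + 1)"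
    proof -
      have "ln 2 \<le> ln (real M + 1)" using that by simp
      then have "(1 + ln (2*pi)) / ln 2 * ln 2 \<le> (1 + ln (2*pi)) / ln 2 * ln (real M + 1)"
        using l2p l2 by (intro mult_left_mono) auto
      then show ?thesis using l2 by simp
    qed
    ultimately show ?thesis by (simp add: loglen_def \<kappa>_def algebra_simps)
  qed
  moreover have "\<kappa> > 0" unfolding \<kappa>_def using l2p l2 by (intro add_nonneg_pos divide_nonneg_pos) auto
  ultimately show ?thesis by blast
qed

text \<open>On \<open>[-pi, pi]\<close> the function lies below
  \<open>B * min M (1 / \<bar>t\<bar>)\<close>, which is integrated with the change of regime at
  \<open>1/M\<close>. No sign of \<open>g\<close> is assumed, so a constant may be subtracted from a
  nonnegative function before the lemma is applied.\<close>

lemma tmean_log_bound: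
  fixes g :: "real \<Rightarrow> real"
  assumes g: "continuous_on UNIV g" "\<And>t. g (t + 2*pi) = g t" and B: "0 \<le> B" and M: "1 \<le> M"
    and g1: "\<And>t. \<bar>t\<bar> \<le> pi \<Longrightarrow> g t \<le> B * M" and g2: "\<And>t. \<bar>t\<bar> \<le> pi \<Longrightarrow> \<bar>t\<bar> * g t \<le> B"
  shows "tmean g \<le> B * loglen M"
proof -
  have cg: "continuous_on S g" for S using g(1) continuous_on_subset by blast
  have int: "g integrable_on {a..b}" for a b by (intro integrable_continuous_real cg)
  define u where "u = (\<lambda>t. g t + g (- t))"
  have cgm: "continuous_on S (\<lambda>t. g (- t))" for S
    by (rule continuous_on_compose2[OF g(1)]) (auto intro!: continuous_intros)
  have cu: "continuous_on S u" for S
    unfolding u_def by (intro continuous_intros cg cgm)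
  have iu: "u integrable_on {a..b}" for a b by (intro integrable_continuous_real cu)
  have "0 < 1 / M" "1 / M \<le> 1" using M by simp_all
  with pi_gt3 have M1: "0 < 1 / M" "1 / M \<le> pi" by linarith+
  have "integral {0..2*pi} g = integral {-pi..pi} g"
    using integral_periodic_shift[OF g, of "-pi"] by simp
  also have "\<dots> = integral {-pi..0} g + integral {0..pi} g"
    using Henstock_Kurzweil_Integration.integral_combine[of "-pi" 0 pi g] int by simp
  also have "integral {-pi..0} g = integral {0..pi} (\<lambda>t. g (- t))"
    using Henstock_Kurzweil_Integration.integral_reflect_real[of 0 "-pi" g] by simp
  also have "integral {0..pi} (\<lambda>t. g (- t)) + integral {0..pi} g = integral {0..pi} u"
    unfolding u_def by (subst Henstock_Kurzweil_Integration.integral_add)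
      (auto intro!: integrable_continuous_real cg cgm)
  also have "\<dots> = integral {0..1/M} u + integral {1/M..pi} u"
    using Henstock_Kurzweil_Integration.integral_combine[of 0 "1/M" pi u] iu M1 by simp
  also have "integral {0..1/M} u \<le> integral {0..1/M} (\<lambda>t. 2 * B * M)"
  proof (intro integral_le iu)
    fix t assume "t \<in> {0..1/M}"
    then have "\<bar>t\<bar> \<le> pi" "\<bar>- t\<bar> \<le> pi" using M1 by auto
    then show "u t \<le> 2 * B * M" using g1[of t] g1[of "- t"] by (simp add: u_def)
  qed auto
  also have "\<dots> = 2 * B" using M by simp
  also have "integral {1/M..pi} u \<le> integral {1/M..pi} (\<lambda>t. 2 * B * (1 / t))"
  proof (intro integral_le iu)
    show "(\<lambda>t. 2 * B * (1 / t)) integrable_on {1/M..pi}"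
      using M1 by (intro integrable_continuous_real continuous_intros) auto
    fix t assume t: "t \<in> {1/M..pi}"
    with M1(1) have t0: "t > 0" unfolding atLeastAtMost_iff by linarith
    have "t * g t \<le> B" "t * g (- t) \<le> B" using g2[of t] g2[of "-t"] t t0 by auto
    then have "t * u t \<le> 2 * B" by (simp add: u_def algebra_simps)
    then show "u t \<le> 2 * B * (1 / t)" using t0 by (simp add: field_simps)
  qed
  also have "\<dots> = 2 * B * ln (pi * M)"
  proof -
    have "((\<lambda>t. 1 / t) has_integral (ln pi - ln (1/M))) {1/M..pi}"
    proof (rule fundamental_theorem_of_calculus)
      fix t assume "t \<in> {1/M..pi}"
      with M1(1) have "t > 0" unfolding atLeastAtMost_iff by linarith
      then show "(ln has_vector_derivative 1 / t) (at t within {1/M..pi})"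
        by (auto intro!: derivative_eq_intros simp flip: has_real_derivative_iff_has_vector_derivative)
    qed (rule M1)
    moreover have "ln pi - ln (1/M) = ln (pi * M)"
      using M by (simp add: ln_div ln_mult)
    ultimately have "((\<lambda>t. 2 * B * (1 / t)) has_integral (2 * B * ln (pi * M))) {1/M..pi}"
      using has_integral_mult_right by metis
    then show ?thesis by (rule integral_unique)
  qed
  finally have "integral {0..2*pi} g \<le> 2 * B * loglen M" by (simp add: loglen_def algebra_simps)
  then have "tmean g \<le> 2 * B * loglen M / (2 * pi)"
    unfolding tmean_def by (intro divide_right_mono) auto
  also have "\<dots> = B * loglen M / pi" by simp
  also have "\<dots> \<le> B * loglen M / 1"
    using B loglen_ge_1[OF M] pi_gt3 by (intro divide_left_mono) auto
  finally show ?thesis by simp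
qed

text \<open>Jordan's inequality: by concavity the sine lies above its chord on
  \<open>[0, pi/2]\<close>.\<close>

lemma abs_sin_half_ge: "\<bar>t\<bar> / pi \<le> \<bar>sin (t/2)\<bar>" if "\<bar>t\<bar> \<le> pi"
proof -
  have "t / pi \<le> sin (t/2)" if "0 \<le> t" "t \<le> pi" for t
  proof -
    have "concave_on {0..pi/2} sin"
      by (rule f''_le0_imp_concave[where f' = cos and f'' = "\<lambda>x. - sin x"])
         (auto intro!: derivative_eq_intros sin_ge_zero)
    then have "sin ((1 - t/pi) *\<^sub>R 0 + (t/pi) *\<^sub>R (pi/2)) \<ge> (1 - t/pi) * sin 0 + (t/pi) * sin (pi/2)"
      using that by (intro concave_onD) auto
    then show ?thesis by simp
  qed
  from this[of "\<bar>t\<bar>"] that show ?thesis by (cases "t \<ge> 0") auto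
qed

lemma norm_cis_diff: "cmod (cis a - cis (- a)) = 2 * \<bar>sin a\<bar>"
proof -
  have "cis a - cis (- a) = 2 * \<i> * of_real (sin a)" by (simp add: complex_eq_iff)
  then show ?thesis by (simp only: norm_mult) simp
qed

text \<open>The factor \<open>2 i sin (t/2)\<close> makes the geometric sum telescope at
  half-integer frequencies, without a division that would exclude \<open>t = 0\<close>. The
  hypothesis \<open>a \<le> b + 1\<close> admits the empty sum.\<close>

lemma cis_sum_telescope:
  assumes "a \<le> b + 1"
  shows "(cis (t/2) - cis (- (t/2))) * (\<Sum>k\<in>{a..b}. cis (of_int k * t)) = cis ((of_int b + 1/2) * t) - cis ((of_int a - 1/2) * t)"
proof -
  have "(cis (t/2) - cis (- (t/2))) * (\<Sum>k\<in>{a..<a + int N}. cis (of_int k * t)) = cis ((of_int (a + int N) - 1/2) * t) - cis ((of_int a - 1/2) * t)" for N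
  proof (induction N)
    case (Suc N)
    have "{a..<a + int (Suc N)} = insert (a + int N) {a..<a + int N}" by auto
    then have "(cis (t/2) - cis (- (t/2))) * (\<Sum>k\<in>{a..<a + int (Suc N)}. cis (of_int k * t))
      = (cis (t/2) - cis (- (t/2))) * cis (of_int (a + int N) * t) + (cis ((of_int (a + int N) - 1/2) * t) - cis ((of_int a - 1/2) * t))"
      using Suc by (simp add: distrib_left)
    also have "(cis (t/2) - cis (- (t/2))) * cis (of_int (a + int N) * t) = cis ((of_int (a + int (Suc N)) - 1/2) * t) - cis ((of_int (a + int N) - 1/2) * t)"
      unfolding left_diff_distrib cis_mult by (simp add: algebra_simps)
    finally show ?case by simp
  qed simp
  from this[of "nat (b + 1 - a)"] assms have
    "(cis (t/2) - cis (- (t/2))) * (\<Sum>k\<in>{a..<b + 1}. cis (of_int k * t)) = cis ((of_int (b + 1) - 1/2) * t) - cis ((of_int a - 1/2) * t)"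
    by simp
  moreover have "{a..<b + 1} = {a..b}" by auto
  ultimately show ?thesis by (simp add: add.commute)
qed

text \<open>The number of terms bounds the sum near 0, and telescoping with Jordan's inequality
  bounds it by \<open>pi / \<bar>t\<bar>\<close>. The bound depends on the length of the frequency
  interval and not on its position.\<close>

lemma dirichlet_L1:
  fixes N :: real
  assumes "1 \<le> N" "of_int (b - a + 1) \<le> N"
  shows "tmean (\<lambda>t. cmod (\<Sum>k\<in>{a..b}. cis (of_int k * t))) \<le> pi * loglen N"
proof (cases "a \<le> b + 1")
  case True
  show ?thesis
  proof (rule tmean_log_bound)
    show "continuous_on UNIV (\<lambda>t. cmod (\<Sum>k\<in>{a..b}. cis (of_int k * t)))" by (intro continuous_intros)
    show "cmod (\<Sum>k\<in>{a..b}. cis (of_int k * (t + 2*pi))) = cmod (\<Sum>k\<in>{a..b}. cis (of_int k * t))" for t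
      by (simp only: cis_2pi_int)
    fix t :: real assume t: "\<bar>t\<bar> \<le> pi"
    have "cmod (\<Sum>k\<in>{a..b}. cis (of_int k * t)) \<le> (\<Sum>k\<in>{a..b}. 1)"
      by (intro sum_norm_le) simp
    also have "\<dots> = of_int (b - a + 1)" using True by simp
    also have "\<dots> \<le> 1 * N" using assms by simp
    also have "\<dots> \<le> pi * N" using assms pi_gt3 by (intro mult_right_mono) auto
    finally show "cmod (\<Sum>k\<in>{a..b}. cis (of_int k * t)) \<le> pi * N" .
    have "2 * \<bar>sin (t/2)\<bar> * cmod (\<Sum>k\<in>{a..b}. cis (of_int k * t)) = cmod (cis ((of_int b + 1/2) * t) - cis ((of_int a - 1/2) * t))"
      unfolding cis_sum_telescope[OF True, symmetric] norm_mult norm_cis_diff ..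
    also have "\<dots> \<le> 1 + 1" by (rule order_trans[OF norm_triangle_ineq4]) simp
    finally have "\<bar>sin (t/2)\<bar> * cmod (\<Sum>k\<in>{a..b}. cis (of_int k * t)) \<le> 1" by simp
    moreover have "(\<bar>t\<bar> / pi) * cmod (\<Sum>k\<in>{a..b}. cis (of_int k * t)) \<le> \<bar>sin (t/2)\<bar> * cmod (\<Sum>k\<in>{a..b}. cis (of_int k * t))"
      using abs_sin_half_ge[OF t] by (intro mult_right_mono) auto
    ultimately have "(\<bar>t\<bar> / pi) * cmod (\<Sum>k\<in>{a..b}. cis (of_int k * t)) \<le> 1" by linarith
    then show "\<bar>t\<bar> * cmod (\<Sum>k\<in>{a..b}. cis (of_int k * t)) \<le> pi" by (simp add: field_simps)
  qed (use assms in auto)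
next
  case False
  then have "{a..b} = {}" by auto
  then show ?thesis using loglen_ge_1[OF assms(1)] by simp
qed

lemma sum_inverse_le_loglen:
  assumes "1 \<le> m"
  shows "(\<Sum>k\<in>{1..<m}. 1 / real k) \<le> loglen (real m)"
proof -
  have "(\<Sum>k\<in>{1..<m}. 1 / real k) \<le> (\<Sum>k\<in>{1..m}. 1 / real k)"
    by (intro sum_mono2) auto
  also have "\<dots> \<le> 1 + ln (real m)"
    using assms
  proof (induction m rule: nat_induct_at_least)
    case (Suc m)
    have "ln (real m / real (Suc m)) \<le> real m / real (Suc m) - 1"
      using Suc by (intro ln_le_minus_one) auto
    also have "real m / real (Suc m) - 1 = - (1 / real (Suc m))"
      by (simp add: field_simps)
    finally have "1 / real (Suc m) \<le> ln (real (Suc m)) - ln (real m)"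
      using Suc by (simp add: ln_div)
    then show ?case using Suc by simp
  qed simp
  also have "\<dots> \<le> loglen (real m)"
    unfolding loglen_def using assms pi_gt3 by simp
  finally show ?thesis .
qed

section \<open>Exponential sums along the staircase edge of the rhombus\<close>

text \<open>In the row of the rhombus over \<open>k\<close>, the largest second coordinate is
  \<open>n - 1 - n * \<bar>k\<bar> div m\<close>. This sum runs along that edge and is what remains
  of the kernel after the rows have been summed.\<close>

definition fker :: "nat \<Rightarrow> nat \<Rightarrow> real \<Rightarrow> real \<Rightarrow> complex" where
  "fker m n x y = (\<Sum>k<m. cis (real k * x + real (n * k div m) * y))"

lemma continuous_on_fker [continuous_intros]:
  "continuous_on S u \<Longrightarrow> continuous_on S v \<Longrightarrow> continuous_on S (\<lambda>z. fker m n (u z) (v z))"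
  unfolding fker_def by (intro continuous_intros)

lemma cis_add_2pi_nat: "cis (x + 2 * pi * real k) = cis x"
  using cis_multiple_2pi[of "real k"] by (simp flip: cis_mult)

text \<open>The integer parts are removed by \<open>\<lfloor>n k / m\<rfloor> = n k / m - (n k mod m) / m\<close> and expanding
  \<open>r \<mapsto> exp (- i r y / m)\<close> in the characters of \<open>\<int> / m\<close>: the coefficient \<open>b \<nu>\<close> has size about
  \<open>\<bar>y\<bar> / \<nu>\<close>.\<close>

lemma fker_coeff_bound:
  assumes m: "1 \<le> m" and y: "0 \<le> y" "y \<le> pi"
  defines "b \<equiv> \<lambda>\<nu>. (\<Sum>r<m. cis (- (real r * ((y + 2 * pi * real \<nu>) / real m)))) / of_nat m"
  shows "(\<Sum>\<nu><m. cmod (b \<nu>)) \<le> 1 + y * loglen (real m)"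
proof -
  have b0: "cmod (b 0) \<le> 1"
  proof -
    have "cmod (\<Sum>r<m. cis (- (real r * ((y + 2 * pi * real 0) / real m)))) \<le> (\<Sum>r<m. 1)"
      by (intro sum_norm_le) simp
    then show ?thesis using m unfolding b_def by (simp add: norm_divide)
  qed
  have b: "cmod (b \<nu>) \<le> y / 2 * (1 / real \<nu> + 1 / real (m - \<nu>))" if \<nu>: "\<nu> \<in> {1..<m}" for \<nu>
  proof -
    \<comment> \<open>Half the angle between consecutive terms of the geometric sum.\<close>
    define x where "x = (y + 2 * pi * real \<nu>) / (2 * real m)"
    define S where "S = (\<Sum>k\<in>{1 - int m..0}. cis (of_int k * (2 * x)))"
    have mpos: "real m > 0" "real \<nu> > 0" "real m - real \<nu> > 0" using \<nu> by auto
    have x0: "2 * x = (y + 2 * pi * real \<nu>) / real m" using mpos by (simp add: x_def field_simps)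
    have bS: "b \<nu> = S / of_nat m"
      unfolding b_def S_def x0
      by (intro arg_cong2[where f = "(/)"] refl
          sum.reindex_bij_witness[where i = "\<lambda>k. nat (- k)" and j = "\<lambda>r. - int r"])
         auto
    have tel: "(cis (2 * x / 2) - cis (- (2 * x / 2))) * S = cis ((of_int 0 + 1/2) * (2 * x)) - cis ((of_int (1 - int m) - 1/2) * (2 * x))"
      unfolding S_def by (rule cis_sum_telescope) (use m in auto)
    \<comment> \<open>The upper and lower ends of the telescoped sum differ, up to full turns, only
      by the phase \<open>y\<close>. This makes \<open>S\<close> of size
      \<open>sin (y/2) / sin x\<close> and produces the factor \<open>y\<close> in the
      bound.\<close>
    have "cis ((of_int (1 - int m) - 1/2) * (2 * x)) = cis (x - y)"
    proof -
      have "(of_int (1 - int m) - 1/2) * (2 * x) + 2 * pi * real \<nu> = x - y"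
        using mpos by (simp add: x_def field_simps)
      then show ?thesis using cis_add_2pi_nat by metis
    qed
    then have "(cis x - cis (- x)) * S = cis x - cis (x - y)" using tel by simp
    also have "\<dots> = cis (x - y/2) * (cis (y/2) - cis (- (y/2)))"
      unfolding right_diff_distrib cis_mult by simp
    finally have "2 * \<bar>sin x\<bar> * cmod S = 2 * \<bar>sin (y/2)\<bar>"
      unfolding norm_cis_diff[symmetric] norm_mult[symmetric] by (simp add: norm_mult)
    moreover have "2 * \<bar>sin (y/2)\<bar> \<le> y" using abs_sin_x_le_abs_x[of "y/2"] y by simp
    ultimately have sS: "2 * \<bar>sin x\<bar> * cmod S \<le> y" by simp
    have x1: "pi * real \<nu> / real m \<le> x" using mpos y by (simp add: x_def field_simps)
    have x2: "x \<le> pi * real \<nu> / real m + pi / (2 * real m)"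
      using mpos y by (simp add: x_def field_simps)
    \<comment> \<open>Because \<open>m - \<nu> \<ge> 1\<close>, the loss \<open>1\<close> in
      \<open>2 * (m - \<nu>) - 1\<close> is at most \<open>m - \<nu>\<close>.\<close>
    have x3: "pi - x \<ge> pi * (real m - real \<nu>) / (2 * real m)"
    proof -
      have "pi - x \<ge> pi - (pi * real \<nu> / real m + pi / (2 * real m))" using x2 by simp
      also have "pi - (pi * real \<nu> / real m + pi / (2 * real m)) = pi * (2 * (real m - real \<nu>) - 1) / (2 * real m)"
        using mpos by (simp add: field_simps)
      also have "\<dots> \<ge> pi * (real m - real \<nu>) / (2 * real m)"
        using \<nu> by (intro divide_right_mono mult_left_mono) auto
      finally show ?thesis .
    qed
    \<comment> \<open>Jordan's inequality is applied at \<open>x\<close> or, beyond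
      \<open>pi/2\<close>, at \<open>pi - x\<close>.\<close>
    have sin0: "sin x \<ge> min (real \<nu> / real m) ((real m - real \<nu>) / real m)" and sinpos: "sin x > 0"
    proof -
      have xr: "0 < x" "x < pi"
      proof -
        have "0 < pi * real \<nu> / real m" using mpos by simp
        then show "0 < x" using x1 by linarith
        have "0 < pi * (real m - real \<nu>) / (2 * real m)" using mpos by simp
        then show "x < pi" using x3 by linarith
      qed
      then show "sin x > 0" by (rule sin_gt_zero)
      show "sin x \<ge> min (real \<nu> / real m) ((real m - real \<nu>) / real m)"
      proof (cases "x \<le> pi / 2")
        case True
        have "\<bar>2 * x\<bar> / pi \<le> \<bar>sin (2 * x / 2)\<bar>" by (rule abs_sin_half_ge) (use True xr in auto)
        then have "2 * x / pi \<le> sin x" using xr \<open>sin x > 0\<close> by simp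
        moreover have "2 * (pi * real \<nu> / real m) / pi \<le> 2 * x / pi"
          using x1 by (intro divide_right_mono mult_left_mono) auto
        moreover have "2 * (pi * real \<nu> / real m) / pi = 2 * (real \<nu> / real m)" by simp
        moreover have "0 \<le> real \<nu> / real m" by simp
        ultimately show ?thesis by linarith
      next
        case False
        have "\<bar>2 * (pi - x)\<bar> / pi \<le> \<bar>sin (2 * (pi - x) / 2)\<bar>"
          by (rule abs_sin_half_ge) (use False xr in auto)
        moreover have "2 * (pi - x) / 2 = pi - x" by simp
        ultimately have "\<bar>2 * (pi - x)\<bar> / pi \<le> \<bar>sin x\<bar>" by (simp only: sin_pi_minus)
        then have "2 * (pi - x) / pi \<le> sin x" using xr \<open>sin x > 0\<close> by simp
        moreover have "2 * (pi * (real m - real \<nu>) / (2 * real m)) / pi \<le> 2 * (pi - x) / pi"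
          using x3 by (intro divide_right_mono mult_left_mono) auto
        moreover have "2 * (pi * (real m - real \<nu>) / (2 * real m)) / pi = (real m - real \<nu>) / real m"
          by simp
        ultimately show ?thesis by linarith
      qed
    qed
    have "1 / sin x \<le> real m / real \<nu> + real m / (real m - real \<nu>)"
    proof -
      have mp: "min (real \<nu> / real m) ((real m - real \<nu>) / real m) > 0" using mpos by simp
      have "1 / sin x \<le> 1 / min (real \<nu> / real m) ((real m - real \<nu>) / real m)"
        using sin0 mp by (intro divide_left_mono mult_pos_pos) (auto simp: sinpos)
      also have "\<dots> \<le> real m / real \<nu> + real m / (real m - real \<nu>)"
        using mpos by (auto simp: min_def)
      finally show ?thesis .
    qed
    then have inv: "y / (2 * real m) * (1 / sin x) \<le> y / (2 * real m) * (real m / real \<nu> + real m / (real m - real \<nu>))"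
      using y by (intro mult_left_mono) auto
    have "cmod S \<le> y / 2 * (1 / sin x)" using sS sinpos by (simp add: field_simps)
    then have "cmod (b \<nu>) \<le> y / (2 * real m) * (1 / sin x)"
      using mpos by (simp add: bS norm_divide field_simps)
    also note inv
    also have "y / (2 * real m) * (real m / real \<nu> + real m / (real m - real \<nu>)) = y / 2 * (1 / real \<nu> + 1 / (real m - real \<nu>))"
      using mpos by (simp add: field_simps)
    also have "real m - real \<nu> = real (m - \<nu>)" using \<nu> by (simp add: of_nat_diff)
    finally show ?thesis .
  qed
  have "{..<m} = insert 0 {1..<m}" using m by auto
  then have "(\<Sum>\<nu><m. cmod (b \<nu>)) = cmod (b 0) + (\<Sum>\<nu>\<in>{1..<m}. cmod (b \<nu>))" by simp
  also have "\<dots> \<le> 1 + (\<Sum>\<nu>\<in>{1..<m}. y / 2 * (1 / real \<nu> + 1 / real (m - \<nu>)))"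
    using b0 b by (intro add_mono sum_mono)
  also have "(\<Sum>\<nu>\<in>{1..<m}. y / 2 * (1 / real \<nu> + 1 / real (m - \<nu>))) = y / 2 * ((\<Sum>\<nu>\<in>{1..<m}. 1 / real \<nu>) + (\<Sum>\<nu>\<in>{1..<m}. 1 / real (m - \<nu>)))"
    by (simp only: sum_distrib_left sum.distrib distrib_left)
  also have "(\<Sum>\<nu>\<in>{1..<m}. 1 / real (m - \<nu>)) = (\<Sum>\<nu>\<in>{1..<m}. 1 / real \<nu>)"
    by (rule sum.reindex_bij_witness[where i = "\<lambda>k. m - k" and j = "\<lambda>k. m - k"]) auto
  also have "y / 2 * ((\<Sum>\<nu>\<in>{1..<m}. 1 / real \<nu>) + (\<Sum>\<nu>\<in>{1..<m}. 1 / real \<nu>)) = y * (\<Sum>\<nu>\<in>{1..<m}. 1 / real \<nu>)"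
    by simp
  also have "\<dots> \<le> y * loglen (real m)"
    using y m by (intro mult_left_mono sum_inverse_le_loglen)
  finally show ?thesis by simp
qed

text \<open>Once the integer part is expanded, \<open>fker\<close> at fixed \<open>y\<close> is a
  combination, with coefficients \<open>b \<nu>\<close>, of translates in \<open>x\<close> of a
  Dirichlet kernel of length \<open>m\<close>. Translation does not change the mean modulus, so the
  bound is the product of \<open>\<Sum>\<nu><m. cmod (b \<nu>)\<close> and a Dirichlet mean.\<close>

lemma tmean_fker_le:
  assumes m: "1 \<le> m" and y: "0 \<le> y" "y \<le> pi"
  shows "tmean (\<lambda>x. cmod (fker m n x y)) \<le> (1 + y * loglen (real m)) * (pi * loglen (real m))"
proof -
  define b where "b = (\<lambda>\<nu>. (\<Sum>r<m. cis (- (real r * ((y + 2 * pi * real \<nu>) / real m)))) / of_nat m)"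
  \<comment> \<open>Fourier inversion on the residues modulo \<open>m\<close>: \<open>b\<close>
    holds the coefficients of \<open>r \<mapsto> cis (- (r * y / m))\<close>.\<close>
  have inv: "cis (- (real r * (y / real m))) = (\<Sum>\<nu><m. b \<nu> * cis (real \<nu> * (2 * pi * real r / real m)))"
    if r: "r < m" for r
  proof -
    have e: "cis (- (real s * ((y + 2 * pi * real \<nu>) / real m))) * cis (real \<nu> * (2 * pi * real r / real m))
       = cis (- (real s * (y / real m))) * cis (of_int (int r - int s) * (0 + 2 * pi * real \<nu> / real m))" for s \<nu>
      unfolding cis_mult using m by (intro arg_cong[where f = cis]) (simp add: field_simps)
    have "(\<Sum>\<nu><m. b \<nu> * cis (real \<nu> * (2 * pi * real r / real m)))
       = (\<Sum>\<nu><m. \<Sum>s<m. cis (- (real s * (y / real m))) * cis (of_int (int r - int s) * (0 + 2 * pi * real \<nu> / real m)) / of_nat m)"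
      unfolding b_def sum_divide_distrib sum_distrib_right times_divide_eq_left e ..
    also have "\<dots> = (\<Sum>s<m. \<Sum>\<nu><m. cis (- (real s * (y / real m))) * cis (of_int (int r - int s) * (0 + 2 * pi * real \<nu> / real m)) / of_nat m)"
      by (rule sum.swap)
    also have "\<dots> = (\<Sum>s<m. cis (- (real s * (y / real m))) * (\<Sum>\<nu><m. cis (of_int (int r - int s) * (0 + 2 * pi * real \<nu> / real m))) / of_nat m)"
      by (simp only: sum_divide_distrib sum_distrib_left)
    also have "\<dots> = (\<Sum>s<m. if r = s then cis (- (real s * (y / real m))) else 0)"
    proof (intro sum.cong refl)
      fix s assume "s \<in> {..<m}"
      then have "\<not> int m dvd (int r - int s)" if "r \<noteq> s"
        using that r dvd_imp_le_int[of "int r - int s" "int m"] by auto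
      then show "cis (- (real s * (y / real m))) * (\<Sum>\<nu><m. cis (of_int (int r - int s) * (0 + 2 * pi * real \<nu> / real m))) / of_nat m
         = (if r = s then cis (- (real s * (y / real m))) else 0)"
        using sum_cis_grid[of m "int r - int s" 0] m by (cases "r = s") auto
    qed
    also have "\<dots> = cis (- (real r * (y / real m)))" using r by simp
    finally show ?thesis ..
  qed
  define D where "D = (\<lambda>x. \<Sum>k\<in>{0..int m - 1}. cis (of_int k * x))"
  have Dsum: "D x = (\<Sum>k<m. cis (real k * x))" for x
    unfolding D_def
    by (rule sum.reindex_bij_witness[where i = int and j = nat]) auto
  have fD: "fker m n x y = (\<Sum>\<nu><m. b \<nu> * D (x + (real n * y + 2 * pi * real \<nu> * real n) / real m))" for x
  proof -
    have "cis (real k * x + real (n * k div m) * y) = (\<Sum>\<nu><m. b \<nu> * cis (real k * (x + (real n * y + 2 * pi * real \<nu> * real n) / real m)))"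
      if "k < m" for k
    proof -
      define q where "q = n * k div m"
      define r where "r = n * k mod m"
      have r: "r < m" using m by (simp add: r_def)
      have "n * k = m * q + r" by (simp add: q_def r_def)
      then have nk: "real n * real k = real m * real q + real r" by (metis of_nat_add of_nat_mult)
      have e1: "real k * x + real q * y = (real k * (x + real n * y / real m)) + - (real r * (y / real m))"
        using m nk by (simp add: field_simps)
      \<comment> \<open>As \<open>n * k = m * q + r\<close>, replacing \<open>r\<close> by
        \<open>n * k\<close> changes the angle by the integer number \<open>\<nu> * q\<close> of
        full turns. The character of the remainder becomes a character of \<open>k\<close>, that is,
        a translation in \<open>x\<close>.\<close>
      have e2: "cis (real \<nu> * (2 * pi * real r / real m)) = cis (2 * pi * real \<nu> * real n * real k / real m)" for \<nu>
      proof -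
        have "2 * pi * real \<nu> * real n * real k / real m = 2 * pi * real \<nu> * (real n * real k) / real m" by simp
        also have "\<dots> = real \<nu> * (2 * pi * real r / real m) + 2 * pi * real (\<nu> * q)"
          unfolding nk using m by (simp add: field_simps)
        finally show ?thesis by (simp only: cis_add_2pi_nat)
      qed
      have "cis (real k * x + real q * y) = cis (real k * (x + real n * y / real m)) * cis (- (real r * (y / real m)))"
        unfolding e1 cis_mult ..
      also have "\<dots> = (\<Sum>\<nu><m. cis (real k * (x + real n * y / real m)) * (b \<nu> * cis (2 * pi * real \<nu> * real n * real k / real m)))"
        unfolding inv[OF r] e2 sum_distrib_left ..
      also have "\<dots> = (\<Sum>\<nu><m. b \<nu> * cis (real k * (x + (real n * y + 2 * pi * real \<nu> * real n) / real m)))"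
      proof (intro sum.cong refl)
        fix \<nu>
        have "cis (real k * (x + real n * y / real m)) * cis (2 * pi * real \<nu> * real n * real k / real m) = cis (real k * (x + (real n * y + 2 * pi * real \<nu> * real n) / real m))"
          unfolding cis_mult using m by (intro arg_cong[where f = cis]) (simp add: field_simps)
        then show "cis (real k * (x + real n * y / real m)) * (b \<nu> * cis (2 * pi * real \<nu> * real n * real k / real m)) = b \<nu> * cis (real k * (x + (real n * y + 2 * pi * real \<nu> * real n) / real m))"
          by (metis mult.left_commute)
      qed
      finally show ?thesis by (simp only: q_def)
    qed
    then have "fker m n x y = (\<Sum>k<m. \<Sum>\<nu><m. b \<nu> * cis (real k * (x + (real n * y + 2 * pi * real \<nu> * real n) / real m)))"
      unfolding fker_def by (intro sum.cong refl) auto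
    also have "\<dots> = (\<Sum>\<nu><m. \<Sum>k<m. b \<nu> * cis (real k * (x + (real n * y + 2 * pi * real \<nu> * real n) / real m)))"
      by (rule sum.swap)
    finally show ?thesis by (simp only: Dsum sum_distrib_left)
  qed
  have cD: "continuous_on S f \<Longrightarrow> continuous_on S (\<lambda>x. D (f x))" for S :: "real set" and f
    unfolding D_def by (intro continuous_intros)
  have Dm: "tmean (\<lambda>x. cmod (D (x + c))) \<le> pi * loglen (real m)" for c
  proof -
    have "tmean (\<lambda>x. cmod (D (x + c))) = tmean (\<lambda>x. cmod (D x))"
    proof (rule tmean_shift[where g = "\<lambda>x. cmod (D x)"])
      show "continuous_on UNIV (\<lambda>x. cmod (D x))" by (intro continuous_intros cD)
      show "cmod (D (x + 2*pi)) = cmod (D x)" for x unfolding D_def cis_2pi_int ..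
    qed
    also have "\<dots> \<le> pi * loglen (real m)" unfolding D_def
      by (rule dirichlet_L1) (use m in auto)
    finally show ?thesis .
  qed
  have "tmean (\<lambda>x. cmod (fker m n x y)) \<le> tmean (\<lambda>x. \<Sum>\<nu><m. cmod (b \<nu>) * cmod (D (x + (real n * y + 2 * pi * real \<nu> * real n) / real m)))"
  proof (intro tmean_mono)
    show "cmod (fker m n x y) \<le> (\<Sum>\<nu><m. cmod (b \<nu>) * cmod (D (x + (real n * y + 2 * pi * real \<nu> * real n) / real m)))" for x
      unfolding fD by (rule order_trans[OF norm_sum]) (simp add: norm_mult)
  qed (intro continuous_intros cD)+
  also have "\<dots> = (\<Sum>\<nu><m. cmod (b \<nu>) * tmean (\<lambda>x. cmod (D (x + (real n * y + 2 * pi * real \<nu> * real n) / real m))))"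
    by (subst tmean_sum, simp, intro continuous_intros cD) (simp only: tmean_cmult)
  also have "\<dots> \<le> (\<Sum>\<nu><m. cmod (b \<nu>) * (pi * loglen (real m)))"
    by (intro sum_mono mult_left_mono Dm) auto
  also have "\<dots> = (\<Sum>\<nu><m. cmod (b \<nu>)) * (pi * loglen (real m))" by (simp only: sum_distrib_right)
  also have "\<dots> \<le> (1 + y * loglen (real m)) * (pi * loglen (real m))"
  proof (rule mult_right_mono)
    show "(\<Sum>\<nu><m. cmod (b \<nu>)) \<le> 1 + y * loglen (real m)"
      unfolding b_def by (rule fker_coeff_bound[OF m y])
    show "0 \<le> pi * loglen (real m)" using loglen_ge_1[of "real m"] m by simp
  qed
  finally show ?thesis .
qed

section \<open>From the rhombic kernel to staircase sums\<close>

lemma sum_symmetric_int: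
  fixes f :: "int \<Rightarrow> complex"
  assumes "1 \<le> m"
  shows "(\<Sum>k\<in>{1 - int m..int m - 1}. f k) = (\<Sum>k<m. f (int k)) + (\<Sum>k<m. f (- int k)) - f 0"
proof -
  have 1: "(\<Sum>k<m. f (int k)) = (\<Sum>k\<in>{0..int m - 1}. f k)"
    by (rule sum.reindex_bij_witness[where i = nat and j = int]) auto
  have 2: "(\<Sum>k<m. f (- int k)) = (\<Sum>k\<in>{1 - int m..0}. f k)"
    by (rule sum.reindex_bij_witness[where i = "\<lambda>k. nat (- k)" and j = "\<lambda>k. - int k"]) auto
  have "{1 - int m..0} = insert 0 {1 - int m..-1}" using assms by auto
  then have 3: "(\<Sum>k\<in>{1 - int m..0}. f k) = f 0 + (\<Sum>k\<in>{1 - int m..-1}. f k)" by simp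
  have "{1 - int m..int m - 1} = {1 - int m..-1} \<union> {0..int m - 1}" using assms by auto
  then have "(\<Sum>k\<in>{1 - int m..int m - 1}. f k) = (\<Sum>k\<in>{1 - int m..-1}. f k) + (\<Sum>k\<in>{0..int m - 1}. f k)"
    by (simp only:) (rule sum.union_disjoint; auto)
  then show ?thesis by (simp add: 1 2 3)
qed

lemma int_div_less_iff:
  fixes a b c :: int
  assumes "0 < b"
  shows "a div b < c \<longleftrightarrow> a < c * b"
proof
  assume "a div b < c"
  then have "(a div b + 1) * b \<le> c * b" using assms by (intro mult_right_mono) auto
  moreover have "a < (a div b + 1) * b"
    using pos_mod_bound[OF assms, of a] div_mult_mod_eq[of a b] unfolding distrib_right by linarith
  ultimately show "a < c * b" by linarith
next
  assume "a < c * b"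
  moreover have "a div b * b \<le> a"
    using pos_mod_sign[OF assms, of a] div_mult_mod_eq[of a b] by linarith
  ultimately have "a div b * b < c * b" by linarith
  then show "a div b < c" using assms by simp
qed

lemma mem_rhombus_iff:
  assumes "1 \<le> m"
  shows "(k, l) \<in> rhombus m n \<longleftrightarrow> \<bar>k\<bar> < int m \<and> \<bar>l\<bar> \<le> int n - 1 - (int n * \<bar>k\<bar>) div int m"
    (is "?L \<longleftrightarrow> ?R")
proof -
  have "(k, l) \<in> rhombus m n \<longleftrightarrow> int n * \<bar>k\<bar> < (int n - \<bar>l\<bar>) * int m"
    by (auto simp: rhombus_def algebra_simps)
  also have "\<dots> \<longleftrightarrow> (int n * \<bar>k\<bar>) div int m < int n - \<bar>l\<bar>"
    using assms by (subst int_div_less_iff) (auto simp: mult.commute)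
  finally have 1: "?L \<longleftrightarrow> (int n * \<bar>k\<bar>) div int m < int n - \<bar>l\<bar>" .
  have "\<bar>k\<bar> < int m" if "?L"
  proof -
    have "\<bar>k\<bar> * int n + \<bar>l\<bar> * int m < int m * int n" using that by (simp add: rhombus_def)
    then have "\<bar>k\<bar> * int n < int m * int n" using mult_nonneg_nonneg[of "\<bar>l\<bar>" "int m"] by linarith
    then show ?thesis using mult_right_less_imp_less[of "\<bar>k\<bar>" "int n" "int m"] by simp
  qed
  then show ?thesis using 1 by auto
qed

lemma rker_commute: "rker m n x y = rker n m y x"
  unfolding rker_def trig2_def
  by (rule sum.reindex_bij_witness[where i = prod.swap and j = prod.swap])
     (auto simp: rhombus_def add.commute mult.commute)

lemma rker_rows:
  assumes "1 \<le> m"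
  shows "rker m n x y = (\<Sum>k\<in>{1 - int m..int m - 1}. cis (of_int k * x) *
    (\<Sum>l\<in>{- (int n - 1 - (int n * \<bar>k\<bar>) div int m)..int n - 1 - (int n * \<bar>k\<bar>) div int m}. cis (of_int l * y)))"
proof -
  have "rhombus m n = (SIGMA k:{1 - int m..int m - 1}. {- (int n - 1 - (int n * \<bar>k\<bar>) div int m)..int n - 1 - (int n * \<bar>k\<bar>) div int m})"
    using mem_rhombus_iff[OF assms] by (auto simp: abs_le_iff)
  then show ?thesis
    unfolding rker_def trig2_def
    by (simp add: sum.Sigma sum_distrib_left cis_mult case_prod_unfold)
qed

lemma continuous_on_rker [continuous_intros]:
  "continuous_on S u \<Longrightarrow> continuous_on S v \<Longrightarrow> continuous_on S (\<lambda>z. rker m n (u z) (v z))"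
  unfolding rker_def by (intro continuous_intros)

text \<open>The factor \<open>2 i sin (y/2)\<close> telescopes every row, leaving its two ends, at
  frequencies \<open>\<plusminus> (n - 1/2 - n * \<bar>k\<bar> div m)\<close>. Each end contributes
  a sum over \<open>-m < k < m\<close>, split into two staircase sums; the term
  \<open>k = 0\<close>, counted twice in each, accounts for the \<open>+ 2\<close>.\<close>

lemma norm_rker_le_fker:
  assumes m: "1 \<le> m" and n: "1 \<le> n"
  shows "2 * \<bar>sin (y/2)\<bar> * cmod (rker m n x y) \<le>
    cmod (fker m n x y) + cmod (fker m n (- x) y) + cmod (fker m n x (- y)) + cmod (fker m n (- x) (- y)) + 2"
proof -
  define q where "q = (\<lambda>k::int. (int n * \<bar>k\<bar>) div int m)"
  define G where "G = (\<lambda>s. \<Sum>k\<in>{1 - int m..int m - 1}. cis (of_int k * x) * cis (of_int (q k) * s))"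
  have G: "G s = fker m n x s + fker m n (- x) s - 1" for s
  proof -
    have "q (int k) = int (n * k div m)" "q (- int k) = int (n * k div m)" for k
      by (simp_all add: q_def zdiv_int)
    then show ?thesis
      unfolding G_def sum_symmetric_int[OF m] fker_def by (simp add: cis_mult q_def)
  qed
  have row: "(cis (y/2) - cis (- (y/2))) * (\<Sum>l\<in>{- (int n - 1 - q k)..int n - 1 - q k}. cis (of_int l * y))
     = cis ((real n - 1/2) * y) * cis (of_int (q k) * (- y)) - cis (- ((real n - 1/2) * y)) * cis (of_int (q k) * y)"
    if "k \<in> {1 - int m..int m - 1}" for k
  proof -
    have "int n * \<bar>k\<bar> < int n * int m" using that n by (intro mult_strict_left_mono) auto
    then have "q k < int n" unfolding q_def using m by (subst int_div_less_iff) (auto simp: mult.commute)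
    then have "(cis (y/2) - cis (- (y/2))) * (\<Sum>l\<in>{- (int n - 1 - q k)..int n - 1 - q k}. cis (of_int l * y))
      = cis ((of_int (int n - 1 - q k) + 1/2) * y) - cis ((of_int (- (int n - 1 - q k)) - 1/2) * y)"
      by (intro cis_sum_telescope) auto
    then show ?thesis unfolding cis_mult by (simp add: algebra_simps)
  qed
  have "(cis (y/2) - cis (- (y/2))) * rker m n x y =
    (\<Sum>k\<in>{1 - int m..int m - 1}. cis (of_int k * x) * ((cis (y/2) - cis (- (y/2))) *
    (\<Sum>l\<in>{- (int n - 1 - q k)..int n - 1 - q k}. cis (of_int l * y))))"
    unfolding rker_rows[OF m] q_def sum_distrib_left[of "cis (y/2) - cis (- (y/2))" _ "{1 - int m..int m - 1}"]
    by (intro sum.cong refl) (rule mult.left_commute)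
  also have "\<dots> = (\<Sum>k\<in>{1 - int m..int m - 1}. cis (of_int k * x) * (cis ((real n - 1/2) * y) * cis (of_int (q k) * (- y)) - cis (- ((real n - 1/2) * y)) * cis (of_int (q k) * y)))"
    by (intro sum.cong refl) (simp only: row)
  also have "\<dots> = cis ((real n - 1/2) * y) * G (- y) - cis (- ((real n - 1/2) * y)) * G y"
    unfolding G_def sum_distrib_left sum_subtractf[symmetric]
    by (intro sum.cong refl) (simp only: right_diff_distrib mult.left_commute)
  finally have eq: "(cis (y/2) - cis (- (y/2))) * rker m n x y = cis ((real n - 1/2) * y) * G (- y) - cis (- ((real n - 1/2) * y)) * G y" .
  have "2 * \<bar>sin (y/2)\<bar> * cmod (rker m n x y) = cmod ((cis (y/2) - cis (- (y/2))) * rker m n x y)"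
    by (simp only: norm_mult norm_cis_diff)
  also have "\<dots> \<le> cmod (G (- y)) + cmod (G y)"
    unfolding eq by (rule order_trans[OF norm_triangle_ineq4]) (simp add: norm_mult)
  also have "cmod (G s) \<le> cmod (fker m n x s) + cmod (fker m n (- x) s) + 1" for s
    unfolding G
    using norm_triangle_ineq4[of "fker m n x s + fker m n (- x) s" 1] norm_triangle_ineq[of "fker m n x s" "fker m n (- x) s"]
    by simp
  from this[of "- y"] this[of y] have "cmod (G (- y)) + cmod (G y) \<le>
     cmod (fker m n x y) + cmod (fker m n (- x) y) + cmod (fker m n x (- y)) + cmod (fker m n (- x) (- y)) + 2"
    by linarith
  finally show ?thesis .
qed

lemma fker_periodic: "fker m n (x + 2*pi) y = fker m n x y"
proof -
  have "cis (real k * (x + 2*pi) + s) = cis (real k * x + s)" for k s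
    using cis_2pi_int[of "int k" x] by (simp flip: cis_mult)
  then show ?thesis by (simp only: fker_def)
qed

lemma norm_fker_minus: "cmod (fker m n (- x) (- y)) = cmod (fker m n x y)"
proof -
  have "fker m n (- x) (- y) = cnj (fker m n x y)"
    unfolding fker_def cnj_sum by (intro sum.cong refl) (simp add: cis_cnj)
  then show ?thesis by simp
qed

lemma tmean_fker_le':
  assumes "1 \<le> m" "\<bar>y\<bar> \<le> pi"
  shows "tmean (\<lambda>x. cmod (fker m n x y)) \<le> (1 + \<bar>y\<bar> * loglen (real m)) * (pi * loglen (real m))"
    and "tmean (\<lambda>x. cmod (fker m n (- x) y)) \<le> (1 + \<bar>y\<bar> * loglen (real m)) * (pi * loglen (real m))"
proof -
  have refl: "tmean (\<lambda>x. cmod (fker m n (- x) y)) = tmean (\<lambda>x. cmod (fker m n x y))" for y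
    by (rule tmean_minus[where g = "\<lambda>x. cmod (fker m n x y)"])
       (auto intro!: continuous_intros simp: fker_periodic)
  show *: "tmean (\<lambda>x. cmod (fker m n x y)) \<le> (1 + \<bar>y\<bar> * loglen (real m)) * (pi * loglen (real m))"
  proof (cases "0 \<le> y")
    case True
    then show ?thesis using tmean_fker_le[of m y n] assms by simp
  next
    case False
    have "tmean (\<lambda>x. cmod (fker m n x y)) = tmean (\<lambda>x. cmod (fker m n (- x) y))" using refl by simp
    also have "\<dots> = tmean (\<lambda>x. cmod (fker m n x (- y)))"
      using norm_fker_minus[of m n _ "- y"] by simp
    finally show ?thesis using tmean_fker_le[of m "- y" n] assms False by simp
  qed
  then show "tmean (\<lambda>x. cmod (fker m n (- x) y)) \<le> (1 + \<bar>y\<bar> * loglen (real m)) * (pi * loglen (real m))"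
    unfolding refl .
qed

text \<open>This serves near \<open>y = 0\<close>, where division by \<open>sin (y/2)\<close> is too
  costly: the kernel has fewer than \<open>2*n\<close> rows in the other direction, each a Dirichlet
  kernel in \<open>x\<close> of length at most \<open>2*m\<close>.\<close>

lemma tmean_rker_le:
  assumes m: "1 \<le> m" and n: "1 \<le> n"
  shows "tmean (\<lambda>x. cmod (rker m n x y)) \<le> 2 * real n * (pi * loglen (2 * real m))"
proof -
  define K where "K = (\<lambda>l::int. int m - 1 - (int m * \<bar>l\<bar>) div int n)"
  define D where "D = (\<lambda>l x. \<Sum>k\<in>{- K l..K l}. cis (of_int k * x))"
  have eq: "rker m n x y = (\<Sum>l\<in>{1 - int n..int n - 1}. cis (of_int l * y) * D l x)" for x
    unfolding rker_commute[of m n] rker_rows[OF n] D_def K_def ..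
  have D: "tmean (\<lambda>x. cmod (D l x)) \<le> pi * loglen (2 * real m)" for l
    unfolding D_def
  proof (rule dirichlet_L1)
    have "0 \<le> (int m * \<bar>l\<bar>) div int n" using n by (simp add: pos_imp_zdiv_nonneg_iff)
    then have "K l - - K l + 1 \<le> 2 * int m" by (simp add: K_def)
    then have "real_of_int (K l - - K l + 1) \<le> real_of_int (2 * int m)" by (simp only: of_int_le_iff)
    then show "real_of_int (K l - - K l + 1) \<le> 2 * real m" by simp
  qed (use m in simp)
  have cD: "continuous_on S (D l)" for S l unfolding D_def by (intro continuous_intros)
  have "tmean (\<lambda>x. cmod (rker m n x y)) \<le> tmean (\<lambda>x. \<Sum>l\<in>{1 - int n..int n - 1}. cmod (D l x))"
  proof (intro tmean_mono)
    show "cmod (rker m n x y) \<le> (\<Sum>l\<in>{1 - int n..int n - 1}. cmod (D l x))" for x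
      unfolding eq by (rule order_trans[OF norm_sum]) (simp add: norm_mult)
  qed (intro continuous_intros cD)+
  also have "\<dots> = (\<Sum>l\<in>{1 - int n..int n - 1}. tmean (\<lambda>x. cmod (D l x)))"
    by (intro tmean_sum continuous_intros cD) simp
  also have "\<dots> \<le> (\<Sum>l\<in>{1 - int n..int n - 1}. pi * loglen (2 * real m))"
    by (intro sum_mono D)
  also have "\<dots> = real (nat (2 * int n - 1)) * (pi * loglen (2 * real m))" by simp
  also have "\<dots> \<le> 2 * real n * (pi * loglen (2 * real m))"
    using loglen_ge_1[of "2 * real m"] m n by (intro mult_right_mono) auto
  finally show ?thesis .
qed

text \<open>Let \<open>I y\<close> be the mean in \<open>x\<close>. The staircase bound gives
  \<open>I y\<close> at most a multiple of \<open>a / \<bar>y\<bar> + a\<^sup>2\<close>, and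
  counting rows gives a multiple of \<open>n * A\<close>. The non-decaying part
  \<open>a\<^sup>2\<close> is subtracted first; what is left decays like
  \<open>1 / \<bar>y\<bar>\<close> and costs only one further factor
  \<open>loglen n\<close>.\<close>

lemma rker_L1_loglen:
  assumes m: "1 \<le> m" and n: "1 \<le> n"
  shows "tmean2 (\<lambda>x y. cmod (rker m n x y)) \<le> 3 * pi\<^sup>2 * (loglen (2 * real m) * loglen (real n) + (loglen (real m))\<^sup>2)"
proof -
  define a where "a = loglen (real m)"
  define A where "A = loglen (2 * real m)"
  have a: "1 \<le> a" "a \<le> A" "1 \<le> A"
    unfolding a_def A_def using m by (auto intro!: loglen_ge_1 loglen_mono)
  define I where "I = (\<lambda>y. tmean (\<lambda>x. cmod (rker m n x y)))"
  have cr: "continuous_on UNIV (\<lambda>(x, y). cmod (rker m n x y))"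
    unfolding case_prod_unfold by (intro continuous_intros)
  have cr': "continuous_on UNIV (\<lambda>(y, x). cmod (rker m n x y))"
    unfolding case_prod_unfold by (intro continuous_intros)
  have cI: "continuous_on S I" for S unfolding I_def by (rule continuous_on_tmean_slice[OF cr'])
  have perI: "I (y + 2*pi) = I y" for y unfolding I_def rker_def trig2_periodic ..
  have b1: "\<bar>y\<bar> * I y \<le> 3 * pi\<^sup>2 * a * (1 + \<bar>y\<bar> * a)" if y: "\<bar>y\<bar> \<le> pi" for y
  proof -
    define X where "X = (1 + \<bar>y\<bar> * a) * (pi * a)"
    have X1: "1 \<le> X"
    proof -
      have "1 * (1 * 1) \<le> (1 + \<bar>y\<bar> * a) * (pi * a)"
        using a pi_gt3 by (intro mult_mono) auto
      then show ?thesis by (simp add: X_def)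
    qed
    have f: "tmean (\<lambda>x. cmod (fker m n x s)) \<le> X" "tmean (\<lambda>x. cmod (fker m n (- x) s)) \<le> X" if "\<bar>s\<bar> = \<bar>y\<bar>" for s
      using tmean_fker_le'[OF m, of s n] that y by (simp_all add: X_def a_def)
    have "2 * \<bar>sin (y/2)\<bar> * I y = tmean (\<lambda>x. 2 * \<bar>sin (y/2)\<bar> * cmod (rker m n x y))"
      by (simp only: I_def tmean_cmult)
    also have "\<dots> \<le> tmean (\<lambda>x. cmod (fker m n x y) + cmod (fker m n (- x) y) + cmod (fker m n x (- y)) + cmod (fker m n (- x) (- y)) + 2)"
      by (intro tmean_mono norm_rker_le_fker m n continuous_intros)
    also have "\<dots> = tmean (\<lambda>x. cmod (fker m n x y)) + tmean (\<lambda>x. cmod (fker m n (- x) y)) + tmean (\<lambda>x. cmod (fker m n x (- y))) + tmean (\<lambda>x. cmod (fker m n (- x) (- y))) + 2"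
      by (subst tmean_add, (intro continuous_intros)+)+ simp
    also have "\<dots> \<le> X + X + X + X + 2 * X"
      using f[of y] f[of "- y"] X1 by simp
    finally have "\<bar>sin (y/2)\<bar> * I y \<le> 3 * X" by linarith
    moreover have "I y \<ge> 0" unfolding I_def by (intro tmean_nonneg continuous_intros) auto
    then have "\<bar>y\<bar> / pi * I y \<le> \<bar>sin (y/2)\<bar> * I y"
      using abs_sin_half_ge[OF y] by (intro mult_right_mono)
    ultimately have "\<bar>y\<bar> / pi * I y \<le> 3 * X" by linarith
    then have "\<bar>y\<bar> * I y \<le> 3 * X * pi" by (simp add: field_simps)
    then show ?thesis by (simp add: X_def power2_eq_square mult_ac)
  qed
  \<comment> \<open>The subtracted constant is precisely the part of the bound \<open>b1\<close>
    that does not decay in \<open>y\<close>; \<open>g\<close> may be negative.\<close>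
  define g where "g = (\<lambda>y. I y - 3 * pi\<^sup>2 * a\<^sup>2)"
  have "tmean g \<le> 3 * pi\<^sup>2 * A * loglen (real n)"
  proof (rule tmean_log_bound)
    show "continuous_on UNIV g" unfolding g_def by (intro continuous_intros cI)
    show "g (y + 2*pi) = g y" for y by (simp add: g_def perI)
    show "0 \<le> 3 * pi\<^sup>2 * A" using a by simp
    show "1 \<le> real n" using n by simp
    fix y assume y: "\<bar>y\<bar> \<le> pi"
    have "g y \<le> I y" by (simp add: g_def)
    also have "\<dots> \<le> 2 * real n * (pi * A)" unfolding I_def A_def by (rule tmean_rker_le[OF m n])
    also have "\<dots> = (2 * pi) * (A * real n)" by simp
    also have "\<dots> \<le> (3 * pi\<^sup>2) * (A * real n)"
      using a pi_gt3 by (intro mult_right_mono) (auto simp: power2_eq_square intro!: mult_mono)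
    finally show "g y \<le> 3 * pi\<^sup>2 * A * real n" by simp
    have "\<bar>y\<bar> * g y = \<bar>y\<bar> * I y - \<bar>y\<bar> * (3 * pi\<^sup>2 * a\<^sup>2)" by (simp add: g_def right_diff_distrib)
    also have "\<dots> \<le> 3 * pi\<^sup>2 * a * (1 + \<bar>y\<bar> * a) - \<bar>y\<bar> * (3 * pi\<^sup>2 * a\<^sup>2)"
      using b1[OF y] by simp
    also have "\<dots> = 3 * pi\<^sup>2 * a" by (simp add: power2_eq_square algebra_simps)
    also have "\<dots> \<le> 3 * pi\<^sup>2 * A" using a by simp
    finally show "\<bar>y\<bar> * g y \<le> 3 * pi\<^sup>2 * A" .
  qed
  moreover have "tmean g = tmean I - 3 * pi\<^sup>2 * a\<^sup>2"
    using tmean_add[of I "\<lambda>_. - (3 * pi\<^sup>2 * a\<^sup>2)"] cI by (simp add: g_def)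
  moreover have "tmean2 (\<lambda>x y. cmod (rker m n x y)) = tmean I"
    unfolding tmean2_def I_def by (rule tmean_swap[OF cr])
  ultimately show ?thesis by (simp add: a_def A_def algebra_simps)
qed

text \<open>The square \<open>(loglen m)\<^sup>2\<close> is admissible when
  \<open>m \<le> n\<close>; otherwise the roles of the coordinates are exchanged by
  \<open>rker_commute\<close>.\<close>

theorem rker_L1:
  "\<exists>C>0. \<forall>m n. 1 \<le> m \<longrightarrow> 1 \<le> n \<longrightarrow>
     tmean2 (\<lambda>x y. cmod (rker m n x y)) \<le> C * (ln (real m + 1) * ln (real n + 1))"
proof -
  obtain \<kappa> where \<kappa>: "\<kappa> > 0" "\<And>M::nat. M \<ge> 1 \<Longrightarrow> loglen (2 * real M) \<le> \<kappa> * ln (real M + 1)"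
    using loglen_le by blast
  have le: "tmean2 (\<lambda>x y. cmod (rker m n x y)) \<le> 6 * pi\<^sup>2 * \<kappa>\<^sup>2 * (ln (real m + 1) * ln (real n + 1))"
    if m: "1 \<le> m" and n: "1 \<le> n" and mn: "m \<le> n" for m n
  proof -
    have l: "1 \<le> loglen (real m)" "1 \<le> loglen (real n)" "loglen (real m) \<le> loglen (2 * real m)"
      "loglen (real n) \<le> loglen (2 * real n)" "loglen (real m) \<le> loglen (2 * real n)"
      using m n mn by (auto intro!: loglen_ge_1 loglen_mono)
    have "loglen (2 * real m) * loglen (real n) + (loglen (real m))\<^sup>2 \<le> loglen (2 * real m) * loglen (2 * real n) + loglen (2 * real m) * loglen (2 * real n)"
      unfolding power2_eq_square using l by (intro add_mono mult_mono) auto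
    also have "\<dots> = 2 * (loglen (2 * real m) * loglen (2 * real n))" by simp
    also have "\<dots> \<le> 2 * ((\<kappa> * ln (real m + 1)) * (\<kappa> * ln (real n + 1)))"
      using l \<kappa> m n by (intro mult_left_mono mult_mono) auto
    finally have "3 * pi\<^sup>2 * (loglen (2 * real m) * loglen (real n) + (loglen (real m))\<^sup>2) \<le> 3 * pi\<^sup>2 * (2 * ((\<kappa> * ln (real m + 1)) * (\<kappa> * ln (real n + 1))))"
      by (rule mult_left_mono) simp
    also have "\<dots> = 6 * pi\<^sup>2 * \<kappa>\<^sup>2 * (ln (real m + 1) * ln (real n + 1))"
      by (simp add: power2_eq_square)
    finally show ?thesis using rker_L1_loglen[OF m n] by linarith
  qed
  have "tmean2 (\<lambda>x y. cmod (rker m n x y)) \<le> 6 * pi\<^sup>2 * \<kappa>\<^sup>2 * (ln (real m + 1) * ln (real n + 1))"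
    if m: "1 \<le> m" and n: "1 \<le> n" for m n
  proof (cases "m \<le> n")
    case False
    have "continuous_on UNIV (\<lambda>(x, y). cmod (rker m n x y))"
      unfolding case_prod_unfold by (intro continuous_intros)
    then have "tmean2 (\<lambda>x y. cmod (rker m n x y)) = tmean2 (\<lambda>x y. cmod (rker m n y x))"
      by (rule tmean2_swap[symmetric])
    also have "\<dots> = tmean2 (\<lambda>x y. cmod (rker n m x y))" by (simp only: rker_commute[of m n])
    finally show ?thesis using le[OF n m] False by (simp add: mult_ac)
  qed (use le m n in auto)
  moreover have "6 * pi\<^sup>2 * \<kappa>\<^sup>2 > 0" using \<kappa> by simp
  ultimately show ?thesis by blast
qed

section \<open>Interpolation at the Lissajous--Chebyshev nodes\<close>

text \<open>The number of distinct frequencies \<open>(\<plusminus> k, \<plusminus> l)\<close>,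
  except that \<open>(0, n)\<close> has weight 1: the frequencies \<open>(0, n)\<close> and
  \<open>(0, -n)\<close> give the same character on the lattice and must be counted once.\<close>

definition ewt :: "nat \<Rightarrow> nat \<times> nat \<Rightarrow> real" where
  "ewt n k = (if k = (0, n) then 1 else (if fst k = 0 then 1 else 2) * (if snd k = 0 then 1 else 2))"

definition ekr :: "nat \<Rightarrow> nat \<Rightarrow> real \<Rightarrow> real \<Rightarrow> real" where
  "ekr m n x y = (\<Sum>k\<in>idxL m n. ewt n k * (cos (real (fst k) * x) * cos (real (snd k) * y)))"

lemma idxL_eq:
  assumes "1 \<le> m" "1 \<le> n"
  shows "idxL m n = insert (0, n) {k. fst k * n + snd k * m < m * n}"
proof -
  have "real k / real m + real l / real n < 1 \<longleftrightarrow> k * n + l * m < m * n" for k l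
  proof -
    have "real k / real m + real l / real n < 1 \<longleftrightarrow> real k * real n + real l * real m < real m * real n"
      using assms by (simp add: field_simps)
    also have "\<dots> \<longleftrightarrow> real (k * n + l * m) < real (m * n)" by simp
    finally show ?thesis by (simp only: of_nat_less_iff)
  qed
  then show ?thesis by (auto simp: idxL_def)
qed

lemma idxL_subset:
  assumes "1 \<le> m" "1 \<le> n"
  shows "idxL m n \<subseteq> {..<m} \<times> {..n}"
proof
  fix k assume "k \<in> idxL m n"
  then consider "k = (0, n)" | "fst k * n + snd k * m < m * n" unfolding idxL_eq[OF assms] by auto
  then show "k \<in> {..<m} \<times> {..n}"
  proof cases
    case 2
    then have "fst k * n < m * n" "snd k * m < n * m"
      unfolding mult.commute[of n m] by linarith+
    then show ?thesis by (cases k) auto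
  qed (use assms in auto)
qed

lemma finite_idxL: "1 \<le> m \<Longrightarrow> 1 \<le> n \<Longrightarrow> finite (idxL m n)"
  by (rule finite_subset[OF idxL_subset]) auto

lemma rker_eq_cos_sum:
  "rker m n x y = of_real (\<Sum>k\<in>{k. fst k * n + snd k * m < m * n}.
     ((if fst k = 0 then 1 else 2) * (if snd k = 0 then 1 else 2)) * (cos (real (fst k) * x) * cos (real (snd k) * y)))"
  if m: "1 \<le> m" and n: "1 \<le> n"
proof -
  define Q where "Q = {k :: nat \<times> nat. fst k * n + snd k * m < m * n}"
  have fin: "finite Q" using finite_idxL[OF m n] unfolding idxL_eq[OF m n] Q_def by simp
  \<comment> \<open>The set \<open>{int k, - int k}\<close> collapses to a point when
    \<open>k = 0\<close>, which is where the weights 1 and 2 come from.\<close>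
  have two: "(\<Sum>a\<in>{int k, - int k}. cis (of_int a * t)) = of_real ((if k = 0 then 1 else 2) * cos (real k * t))" for k t
    by (cases "k = 0") (auto simp: complex_eq_iff)
  have mem: "k \<in> rhombus m n \<longleftrightarrow> (nat \<bar>fst k\<bar>, nat \<bar>snd k\<bar>) \<in> Q" for k
  proof -
    have "nat \<bar>fst k\<bar> * n + nat \<bar>snd k\<bar> * m < m * n \<longleftrightarrow> int (nat \<bar>fst k\<bar> * n + nat \<bar>snd k\<bar> * m) < int (m * n)"
      by (rule of_nat_less_iff[symmetric])
    also have "\<dots> \<longleftrightarrow> \<bar>fst k\<bar> * int n + \<bar>snd k\<bar> * int m < int m * int n" by simp
    finally show ?thesis by (simp add: rhombus_def Q_def)
  qed
  have "rker m n x y = (\<Sum>z\<in>(SIGMA k:Q. {int (fst k), - int (fst k)} \<times> {int (snd k), - int (snd k)}). cis (of_int (fst (snd z)) * x + of_int (snd (snd z)) * y))"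
    unfolding rker_def trig2_def
    by (rule sum.reindex_bij_witness[where i = snd and j = "\<lambda>k. ((nat \<bar>fst k\<bar>, nat \<bar>snd k\<bar>), k)"])
       (auto simp: mem abs_if nat_int split: if_splits)
  also have "\<dots> = (\<Sum>k\<in>Q. \<Sum>z\<in>{int (fst k), - int (fst k)} \<times> {int (snd k), - int (snd k)}. cis (of_int (fst z) * x + of_int (snd z) * y))"
    by (subst sum.Sigma) (use fin in \<open>auto simp: case_prod_unfold\<close>)
  also have "\<dots> = (\<Sum>k\<in>Q. (\<Sum>a\<in>{int (fst k), - int (fst k)}. cis (of_int a * x)) * (\<Sum>b\<in>{int (snd k), - int (snd k)}. cis (of_int b * y)))"
    by (simp only: sum_product sum.cartesian_product cis_mult case_prod_unfold)
  finally show ?thesis unfolding two Q_def by (simp only: of_real_sum of_real_mult[symmetric]) (simp add: mult_ac)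
qed

lemma ekr_eq:
  assumes m: "1 \<le> m" and n: "1 \<le> n"
  shows "of_real (ekr m n x y) = rker m n x y + of_real (cos (real n * y))"
proof -
  let ?Q = "{k. fst k * n + snd k * m < m * n}"
  have "(0, n) \<notin> ?Q" "finite ?Q" using finite_idxL[OF m n] unfolding idxL_eq[OF m n] by auto
  then have "ekr m n x y = cos (real n * y) + (\<Sum>k\<in>?Q. ewt n k * (cos (real (fst k) * x) * cos (real (snd k) * y)))"
    unfolding ekr_def idxL_eq[OF m n] by (simp add: ewt_def)
  also have "(\<Sum>k\<in>?Q. ewt n k * (cos (real (fst k) * x) * cos (real (snd k) * y))) =
    (\<Sum>k\<in>?Q. ((if fst k = 0 then 1 else 2) * (if snd k = 0 then 1 else 2)) * (cos (real (fst k) * x) * cos (real (snd k) * y)))"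
    using \<open>(0, n) \<notin> ?Q\<close> by (intro sum.cong refl) (auto simp: ewt_def)
  finally show ?thesis unfolding rker_eq_cos_sum[OF m n] by simp
qed

lemma cis_pi_int_even: "even a \<Longrightarrow> cis (x + pi * of_int a) = cis x"
proof -
  assume "even a"
  then obtain b where "a = 2 * b" by blast
  then have "cis (x + pi * of_int a) = cis x * cis (2 * pi * of_int b)" by (simp add: cis_mult mult_ac)
  also have "cis (2 * pi * of_int b) = 1" by (rule cis_multiple_2pi) simp
  finally show ?thesis by simp
qed

lemma sum_cis_full_period:
  assumes "1 \<le> m"
  shows "(\<Sum>k\<in>{- int m..<int m}. cis (of_int k * (pi * of_int a / real m))) = (if 2 * int m dvd a then of_nat (2 * m) else 0)"
proof -
  have "(\<Sum>k\<in>{- int m..<int m}. cis (of_int k * (pi * of_int a / real m))) = (\<Sum>s<2*m. cis (of_int a * (- pi + 2 * pi * real s / real (2*m))))"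
    by (rule sum.reindex_bij_witness[where i = "\<lambda>s. int s - int m" and j = "\<lambda>k. nat (k + int m)"])
       (use assms in \<open>auto simp: field_simps intro!: arg_cong[where f = cis]\<close>)
  also have "\<dots> = (if 2 * int m dvd a then of_nat (2 * m) else 0)"
  proof (cases "2 * int m dvd a")
    case True
    then obtain b where b: "a = 2 * int m * b" by blast
    have "cis (of_int a * (- pi + 2 * pi * real s / real (2*m))) = 1" for s
    proof -
      have "of_int a * (- pi + 2 * pi * real s / real (2*m)) = 0 + pi * of_int (2 * (b * (int s - int m)))"
        using assms b by (simp add: field_simps)
      then show ?thesis using cis_pi_int_even[of "2 * (b * (int s - int m))" 0] by simp
    qed
    then show ?thesis using True by simp
  next
    case False
    then show ?thesis using sum_cis_grid[of "2*m" a "-pi"] assms by simp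
  qed
  finally show ?thesis .
qed

text \<open>The half-turn \<open>k \<mapsto> k \<plusminus> m\<close>, \<open>l \<mapsto> l \<plusminus> n\<close> of the box \<open>[-m, m) \<times> [-n, n)\<close> replaces
  \<open>\<bar>k\<bar> / m + \<bar>l\<bar> / n\<close> by \<open>2 - \<bar>k\<bar> / m - \<bar>l\<bar> / n\<close> and fixes the characters restricted to the lattice.
  As \<open>m\<close> and \<open>n\<close> are coprime, only \<open>(-m, 0)\<close> and \<open>(0, -n)\<close> lie on the boundary of the rhombus.\<close>

lemma ekr_lattice:
  assumes m: "1 \<le> m" and n: "1 \<le> n" and cop: "coprime m n" and ab: "even (a + b)"
  shows "ekr m n (pi * of_int a / real m) (pi * of_int b / real n) =
    (if 2 * int m dvd a \<and> 2 * int n dvd b then 2 * real m * real n else 0)"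
proof -
  define f where "f = (\<lambda>k :: int \<times> int. cis (of_int (fst k) * (pi * of_int a / real m) + of_int (snd k) * (pi * of_int b / real n)))"
  define B where "B = {- int m..<int m} \<times> {- int n..<int n}"
  define R where "R = rhombus m n"
  define E where "E = {(- int m, 0), (0, - int n)}"
  define h where "h = (\<lambda>m k::int. if 0 \<le> k then k - m else k + m)"
  define \<tau> where "\<tau> = (\<lambda>k :: int \<times> int. (h (int m) (fst k), h (int n) (snd k)))"
  have hh: "h M (h M k) = k" "\<bar>h M k\<bar> = M - \<bar>k\<bar>" "h M k \<in> {-M..<M}" if "k \<in> {-M..<M}" for M k
    using that by (auto simp: h_def)
  have \<tau>B: "\<tau> k \<in> B" "\<tau> (\<tau> k) = k" if "k \<in> B" for k
    using that hh by (auto simp: B_def \<tau>_def)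
  define w where "w = (\<lambda>k :: int \<times> int. \<bar>fst k\<bar> * int n + \<bar>snd k\<bar> * int m)"
  have w\<tau>: "w (\<tau> k) = 2 * (int m * int n) - w k" if "k \<in> B" for k
  proof -
    have "w (\<tau> k) = (int m - \<bar>fst k\<bar>) * int n + (int n - \<bar>snd k\<bar>) * int m"
      using that hh(2)[of "fst k" "int m"] hh(2)[of "snd k" "int n"]
      by (simp only: B_def w_def \<tau>_def mem_Times_iff fst_conv snd_conv)
    then show ?thesis by (simp add: w_def algebra_simps)
  qed
  have Rw: "k \<in> R \<longleftrightarrow> w k < int m * int n" for k by (simp add: R_def rhombus_def w_def)
  have RB: "R \<subseteq> B"
  proof
    fix k assume k: "k \<in> R"
    then have "\<bar>fst k\<bar> * int n < int m * int n" "\<bar>snd k\<bar> * int m < int n * int m"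
      unfolding Rw w_def
      using mult_nonneg_nonneg[of "\<bar>fst k\<bar>" "int n"] mult_nonneg_nonneg[of "\<bar>snd k\<bar>" "int m"] mult.commute[of "int n" "int m"]
      by linarith+
    then have "\<bar>fst k\<bar> < int m" "\<bar>snd k\<bar> < int n" using m n by simp_all
    then show "k \<in> B" by (cases k) (auto simp: B_def)
  qed
  \<comment> \<open>Equality \<open>\<bar>k\<bar> * n + \<bar>l\<bar> * m = m * n\<close> gives
    \<open>m dvd \<bar>k\<bar> * n\<close>, and coprimality reduces this to
    \<open>m dvd \<bar>k\<bar>\<close>, so only corners remain. The half-open box contains two of
    them.\<close>
  have bd: "k \<in> E" if k: "k \<in> B" "w k = int m * int n" for k
  proof -
    have "int m dvd \<bar>fst k\<bar> * int n" using k(2) unfolding w_def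
      by (metis dvd_add_left_iff dvd_triv_left dvd_triv_right)
    then have "int m dvd \<bar>fst k\<bar>" using cop by (simp add: coprime_dvd_mult_left_iff)
    moreover have "\<bar>fst k\<bar> \<le> int m" using k(1) by (auto simp: B_def)
    ultimately have "\<bar>fst k\<bar> = 0 \<or> \<bar>fst k\<bar> = int m"
      using zdvd_imp_le[of "int m" "\<bar>fst k\<bar>"] by force
    then show ?thesis
    proof
      assume 0: "\<bar>fst k\<bar> = 0"
      then have "\<bar>snd k\<bar> * int m = int n * int m" using k(2) by (simp add: w_def mult.commute)
      then have "\<bar>snd k\<bar> = int n" using m by simp
      then show ?thesis using 0 k(1) by (cases k) (auto simp: B_def E_def)
    next
      assume 1: "\<bar>fst k\<bar> = int m"
      then have "\<bar>snd k\<bar> * int m = 0" using k(2) by (simp add: w_def)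
      then have "snd k = 0" using m by simp
      then show ?thesis using 1 k(1) by (cases k) (auto simp: B_def E_def)
    qed
  qed
  have EB: "E \<subseteq> B" "w k = int m * int n" if "k \<in> E" for k
    using that m n by (auto simp: E_def B_def w_def)
  have EB': "E \<subseteq> B" using m n by (auto simp: E_def B_def)
  have finB: "finite B" by (simp add: B_def)
  have f\<tau>: "f (\<tau> k) = f k" for k
  proof -
    define s where "s = (if 0 \<le> fst k then -1 else 1 :: int)"
    define t where "t = (if 0 \<le> snd k then -1 else 1 :: int)"
    have "\<tau> k = (fst k + s * int m, snd k + t * int n)" by (simp add: \<tau>_def h_def s_def t_def)
    then have "f (\<tau> k) = cis ((of_int (fst k) * (pi * of_int a / real m) + of_int (snd k) * (pi * of_int b / real n)) + pi * of_int (s * a + t * b))"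
      unfolding f_def using m n by (intro arg_cong[where f = cis]) (simp add: field_simps)
    also have "\<dots> = f k" unfolding f_def
      by (rule cis_pi_int_even) (use ab in \<open>auto simp: s_def t_def\<close>)
    finally show ?thesis .
  qed
  have "(\<Sum>k\<in>B - R - E. f k) = (\<Sum>k\<in>R. f k)"
  proof (rule sum.reindex_bij_witness[where i = \<tau> and j = \<tau>])
    fix k assume k: "k \<in> B - R - E"
    then show "\<tau> (\<tau> k) = k" "f (\<tau> k) = f k" using \<tau>B f\<tau> by auto
    have "w k > int m * int n" using k bd[of k] Rw[of k] by force
    then show "\<tau> k \<in> R" using k w\<tau>[of k] by (simp add: Rw)
  next
    fix k assume k: "k \<in> R"
    then have kB: "k \<in> B" using RB by auto
    then show "\<tau> (\<tau> k) = k" using \<tau>B by auto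
    have "w (\<tau> k) > int m * int n" using k w\<tau>[OF kB] by (simp add: Rw)
    then show "\<tau> k \<in> B - R - E" using \<tau>B(1)[OF kB] EB(2)[of "\<tau> k"] Rw[of "\<tau> k"] by auto
  qed
  moreover have "(\<Sum>k\<in>B. f k) = (\<Sum>k\<in>B - R - E. f k) + (\<Sum>k\<in>E. f k) + (\<Sum>k\<in>R. f k)"
  proof -
    have "R \<inter> E = {}" using EB(2) Rw by auto
    then have "E \<subseteq> B - R" using EB' by auto
    then show ?thesis
      using sum.subset_diff[OF RB finB, of f] sum.subset_diff[of E "B - R" f] finB by simp
  qed
  \<comment> \<open>On the lattice both corner characters equal \<open>(-1) ^ b\<close>, since
    \<open>a + b\<close> is even. Their sum is twice the term that \<open>ekr\<close> adds to
    \<open>rker\<close>, so the sum over the whole box is exactly twice \<open>ekr\<close>.\<close>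
  moreover have "(\<Sum>k\<in>E. f k) = 2 * of_real (cos (pi * of_int b))"
  proof -
    have "f (- int m, 0) = cis (pi * of_int b)"
    proof -
      have "f (- int m, 0) = cis (- (pi * of_int a))" using m by (simp add: f_def)
      also have "- (pi * of_int a) = pi * of_int b + pi * of_int (- (a + b))" by (simp add: algebra_simps)
      also have "cis \<dots> = cis (pi * of_int b)" by (rule cis_pi_int_even) (use ab in simp)
      finally show ?thesis .
    qed
    moreover have "f (0, - int n) = cis (pi * of_int b)"
    proof -
      have "f (0, - int n) = cis (- (pi * of_int b))" using n by (simp add: f_def)
      also have "- (pi * of_int b) = pi * of_int b + pi * of_int (- (2 * b))" by (simp add: algebra_simps)
      also have "cis \<dots> = cis (pi * of_int b)" by (rule cis_pi_int_even) simp
      finally show ?thesis .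
    qed
    moreover have "cis (pi * of_int b) = of_real (cos (pi * of_int b))"
      by (simp add: complex_eq_iff sin_zero_iff_int2 mult.commute)
    moreover have "(- int m, 0) \<noteq> (0, - int n)" using m by auto
    ultimately show ?thesis by (simp add: E_def)
  qed
  moreover have "(\<Sum>k\<in>R. f k) = rker m n (pi * of_int a / real m) (pi * of_int b / real n)"
    by (simp add: rker_def trig2_def f_def R_def)
  ultimately have "(\<Sum>k\<in>B. f k) = 2 * (rker m n (pi * of_int a / real m) (pi * of_int b / real n) + of_real (cos (real n * (pi * of_int b / real n))))"
    using n by simp
  then have 1: "(\<Sum>k\<in>B. f k) = 2 * of_real (ekr m n (pi * of_int a / real m) (pi * of_int b / real n))"
    unfolding ekr_eq[OF m n] .
  have "(\<Sum>k\<in>B. f k) = (\<Sum>k\<in>{- int m..<int m}. cis (of_int k * (pi * of_int a / real m))) * (\<Sum>l\<in>{- int n..<int n}. cis (of_int l * (pi * of_int b / real n)))"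
    unfolding B_def f_def cis_mult[symmetric] sum_product sum.cartesian_product by (simp add: case_prod_unfold)
  also have "\<dots> = of_real (if 2 * int m dvd a \<and> 2 * int n dvd b then 4 * real m * real n else 0)"
    unfolding sum_cis_full_period[OF m] sum_cis_full_period[OF n] by simp
  finally have "of_real (2 * ekr m n (pi * of_int a / real m) (pi * of_int b / real n)) =
     complex_of_real (if 2 * int m dvd a \<and> 2 * int n dvd b then 4 * real m * real n else 0)"
    unfolding 1 by simp
  then have "2 * ekr m n (pi * of_int a / real m) (pi * of_int b / real n) =
     (if 2 * int m dvd a \<and> 2 * int n dvd b then 4 * real m * real n else 0)"
    by (simp only: of_real_eq_iff)
  then show ?thesis by (auto split: if_splits)
qed

text \<open>\<open>lam m n F\<close> interpolates data \<open>F\<close> on the lattice; \<open>F\<close> is meant to vanish at the points with \<open>i + j\<close> odd,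
  which allows sums over the full grid.\<close>

definition lam :: "nat \<Rightarrow> nat \<Rightarrow> (nat \<Rightarrow> nat \<Rightarrow> real) \<Rightarrow> real \<Rightarrow> real \<Rightarrow> real" where
  "lam m n F x y = (\<Sum>i<2*m. \<Sum>j<2*n. F i j * ekr m n (x - pi * real i / real m) (y - pi * real j / real n)) / (2 * real m * real n)"

definition icoef :: "nat \<Rightarrow> nat \<Rightarrow> (nat \<Rightarrow> nat \<Rightarrow> real) \<Rightarrow> nat \<times> nat \<Rightarrow> real" where
  "icoef m n F k = ewt n k * (\<Sum>i<2*m. \<Sum>j<2*n. F i j * (cos (real (fst k) * (pi * real i / real m)) * cos (real (snd k) * (pi * real j / real n)))) / (2 * real m * real n)"

definition interp :: "nat \<Rightarrow> nat \<Rightarrow> (nat \<Rightarrow> nat \<Rightarrow> real) \<Rightarrow> real \<times> real \<Rightarrow> real" where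
  "interp m n F z = (\<Sum>(k, l)\<in>idxL m n. icoef m n F (k, l) * cheb k (fst z) * cheb l (snd z))"

text \<open>The indices run over full periods, \<open>i < 2*m\<close> and \<open>j < 2*n\<close>, so
  the values of \<open>g\<close> are extended evenly in both angles and interior nodes are
  repeated.\<close>

definition dat :: "nat \<Rightarrow> nat \<Rightarrow> (real \<times> real \<Rightarrow> real) \<Rightarrow> nat \<Rightarrow> nat \<Rightarrow> real" where
  "dat m n g i j = (if even (i + j) then g (node m i, node n j) else 0)"

section \<open>Existence of the interpolant\<close>

text \<open>By the three-term recurrence \<open>cos (k * t)\<close> is a polynomial in
  \<open>cos t\<close>. Thus \<open>cheb k (cos t) = cos (k * t)\<close> holds for every
  \<open>t\<close>, also where \<open>arccos (cos t)\<close> differs from \<open>t\<close>.\<close>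

lemma cos_mult_cong:
  assumes "cos a = cos b"
  shows "cos (real k * a) = cos (real k * b)"
proof (induction k rule: less_induct)
  case (less k)
  show ?case
  proof (cases "k \<le> 1")
    case True
    then have "k = 0 \<or> k = 1" by linarith
    then show ?thesis using assms by auto
  next
    case False
    define j where "j = k - 1"
    have j: "k = Suc j" "j \<ge> 1" using False by (auto simp: j_def)
    have rec: "cos (real k * t) = 2 * cos t * cos (real j * t) - cos (real (j - 1) * t)" for t
    proof -
      have "cos (real k * t) + cos (real (j - 1) * t) = 2 * cos t * cos (real j * t)"
        using cos_add[of "real j * t" t] cos_diff[of "real j * t" t] j
        by (simp add: algebra_simps of_nat_diff)
      then show ?thesis by simp
    qed
    show ?thesis unfolding rec using less[of j] less[of "j - 1"] j assms by simp
  qed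
qed

lemma cheb_cos: "cheb k (cos t) = cos (real k * t)"
  unfolding cheb_def by (rule cos_mult_cong) simp

lemma node_eq: "node m i = cos (pi * real i / real m)"
  by (simp add: node_def mult.commute)

lemma interp_in_PiL: "interp m n F \<in> PiL m n"
  unfolding PiL_def mem_Collect_eq by (rule exI[of _ "icoef m n F"]) (simp add: interp_def)

text \<open>Averaging \<open>ekr (x - a, y - b)\<close> over the signs of \<open>x\<close> and
  \<open>y\<close> removes the sine terms of the addition formula, so that the dependence on
  \<open>(x, y)\<close> and on \<open>(a, b)\<close> separates into products of cosines.\<close>

lemma interp_cos:
  "interp m n F (cos x, cos y) = (lam m n F x y + lam m n F (- x) y + lam m n F x (- y) + lam m n F (- x) (- y)) / 4"
proof -
  have c: "(cos (k * (x - a)) * cos (l * (y - b)) + cos (k * (- x - a)) * cos (l * (y - b)) + cos (k * (x - a)) * cos (l * (- y - b)) + cos (k * (- x - a)) * cos (l * (- y - b)))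
     = 4 * ((cos (k * a) * cos (l * b)) * (cos (k * x) * cos (l * y)))" for k l a b :: real
  proof -
    have "cos (k * (x - a)) + cos (k * (- x - a)) = 2 * (cos (k * x) * cos (k * a))"
      "cos (l * (y - b)) + cos (l * (- y - b)) = 2 * (cos (l * y) * cos (l * b))"
      by (simp_all add: right_diff_distrib cos_diff)
    then have "(cos (k * (x - a)) + cos (k * (- x - a))) * (cos (l * (y - b)) + cos (l * (- y - b))) = (2 * (cos (k * x) * cos (k * a))) * (2 * (cos (l * y) * cos (l * b)))"
      by simp
    then show ?thesis by (simp add: algebra_simps)
  qed
  have e: "ekr m n (x - a) (y - b) + ekr m n (- x - a) (y - b) + ekr m n (x - a) (- y - b) + ekr m n (- x - a) (- y - b)
     = 4 * (\<Sum>k\<in>idxL m n. ewt n k * ((cos (real (fst k) * a) * cos (real (snd k) * b)) * (cos (real (fst k) * x) * cos (real (snd k) * y))))" for a b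
    unfolding ekr_def sum.distrib[symmetric] distrib_left[symmetric] c by (simp add: sum_distrib_left mult_ac)
  let ?a = "\<lambda>i. pi * real i / real m" and ?b = "\<lambda>j. pi * real j / real n"
  have "lam m n F x y + lam m n F (- x) y + lam m n F x (- y) + lam m n F (- x) (- y)
     = (\<Sum>i<2*m. \<Sum>j<2*n. F i j * (ekr m n (x - ?a i) (y - ?b j) + ekr m n (- x - ?a i) (y - ?b j) + ekr m n (x - ?a i) (- y - ?b j) + ekr m n (- x - ?a i) (- y - ?b j))) / (2 * real m * real n)"
    unfolding lam_def add_divide_distrib[symmetric] sum.distrib[symmetric] distrib_left[symmetric] ..
  also have "\<dots> = 4 * ((\<Sum>i<2*m. \<Sum>j<2*n. \<Sum>k\<in>idxL m n. F i j * (ewt n k * ((cos (real (fst k) * ?a i) * cos (real (snd k) * ?b j)) * (cos (real (fst k) * x) * cos (real (snd k) * y))))) / (2 * real m * real n))"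
    unfolding e by (simp add: sum_distrib_left sum_divide_distrib mult_ac)
  also have "(\<Sum>i<2*m. \<Sum>j<2*n. \<Sum>k\<in>idxL m n. F i j * (ewt n k * ((cos (real (fst k) * ?a i) * cos (real (snd k) * ?b j)) * (cos (real (fst k) * x) * cos (real (snd k) * y)))))
     = (\<Sum>k\<in>idxL m n. \<Sum>i<2*m. \<Sum>j<2*n. F i j * (ewt n k * ((cos (real (fst k) * ?a i) * cos (real (snd k) * ?b j)) * (cos (real (fst k) * x) * cos (real (snd k) * y)))))"
    by (rule sum_rotate)
  also have "\<dots> / (2 * real m * real n) = interp m n F (cos x, cos y)"
    unfolding interp_def icoef_def cheb_cos fst_conv snd_conv
    by (simp add: sum_divide_distrib sum_distrib_left sum_distrib_right case_prod_unfold mult_ac)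
  finally show ?thesis by simp
qed

text \<open>By \<open>ekr_lattice\<close> only the grid point congruent to \<open>(a, b)\<close>
  modulo the periods contributes. The hypothesis on \<open>F\<close> removes the grid points off the
  lattice, about which \<open>ekr_lattice\<close> says nothing.\<close>

lemma lam_lattice:
  assumes m: "1 \<le> m" and n: "1 \<le> n" and cop: "coprime m n" and ab: "even (a + b)"
    and F: "\<And>i j. odd (i + j) \<Longrightarrow> F i j = 0"
  shows "lam m n F (pi * of_int a / real m) (pi * of_int b / real n) = F (nat (a mod (2 * int m))) (nat (b mod (2 * int n)))"
proof -
  define i0 where "i0 = nat (a mod (2 * int m))"
  define j0 where "j0 = nat (b mod (2 * int n))"
  have i0: "i0 < 2 * m" and j0: "j0 < 2 * n"
    unfolding i0_def j0_def using m n by (auto simp: nat_less_iff)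
  have dv: "2 * int M dvd c - int i \<longleftrightarrow> i = nat (c mod (2 * int M))" if "i < 2 * M" for i c M
  proof -
    have "2 * int M dvd c - int i \<longleftrightarrow> c mod (2 * int M) = int i mod (2 * int M)"
      by (simp add: mod_eq_dvd_iff)
    also have "int i mod (2 * int M) = int i" using that by simp
    finally show ?thesis using that by (auto simp: )
  qed
  have t: "F i j * ekr m n (pi * of_int a / real m - pi * real i / real m) (pi * of_int b / real n - pi * real j / real n)
     = (if i = i0 then (if j = j0 then F i0 j0 * (2 * real m * real n) else 0) else 0)" if ij: "i < 2*m" "j < 2*n" for i j
  proof (cases "even (i + j)")
    case True
    have e: "pi * of_int a / real m - pi * real i / real m = pi * of_int (a - int i) / real m"
       "pi * of_int b / real n - pi * real j / real n = pi * of_int (b - int j) / real n"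
      by (simp_all add: diff_divide_distrib right_diff_distrib)
    have "even ((a - int i) + (b - int j))" using True ab by auto
    from ekr_lattice[OF m n cop this] show ?thesis
      unfolding e dv[OF ij(1)] dv[OF ij(2)] i0_def[symmetric] j0_def[symmetric] by simp
  next
    case False
    then show ?thesis using F[of i j] by auto
  qed
  have "(\<Sum>i<2*m. \<Sum>j<2*n. F i j * ekr m n (pi * of_int a / real m - pi * real i / real m) (pi * of_int b / real n - pi * real j / real n))
    = (\<Sum>i<2*m. if i = i0 then (\<Sum>j<2*n. if j = j0 then F i0 j0 * (2 * real m * real n) else 0) else 0)"
    using t by (intro sum.cong refl) (auto intro!: sum.cong)
  also have "\<dots> = F i0 j0 * (2 * real m * real n)" using i0 j0 by simp
  finally show ?thesis unfolding lam_def i0_def j0_def using m n by simp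
qed

lemma node_mod: "1 \<le> m \<Longrightarrow> node m (nat (a mod (2 * int m))) = cos (pi * of_int a / real m)"
proof -
  assume m: "1 \<le> m"
  define r where "r = a mod (2 * int m)"
  define q where "q = a div (2 * int m)"
  have "a = r + 2 * int m * q" by (simp add: r_def q_def)
  then have "pi * of_int a / real m = pi * of_int r / real m + 2 * pi * of_int q"
    using m by (simp add: field_simps)
  then have "cos (pi * of_int a / real m) = cos (pi * of_int r / real m)"
    by (simp add: cos_add)
  moreover have "r \<ge> 0" unfolding r_def using m by simp
  ultimately show ?thesis by (simp add: node_eq r_def)
qed

text \<open>The four reflections of a node are lattice points at which \<open>dat\<close> has one
  and the same value, as it depends only on the cosines and on a parity that reflections preserve.
  Their average is therefore that value.\<close>

lemma interp_LC:
  assumes m: "1 \<le> m" and n: "1 \<le> n" and cop: "coprime m n" and z: "z \<in> LC m n"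
  shows "interp m n (dat m n g) z = g z"
proof -
  obtain i j where ij: "z = (node m i, node n j)" "even (i + j)"
    using z by (auto simp: LC_def)
  have "lam m n (dat m n g) (pi * of_int a / real m) (pi * of_int b / real n) = g z"
    if "\<bar>a\<bar> = int i" "\<bar>b\<bar> = int j" for a b
  proof -
    have ab: "even (a + b)" using ij(2) that by (cases "a \<ge> 0"; cases "b \<ge> 0"; presburger)
    have "even (a mod (2 * int m)) = even a" "even (b mod (2 * int n)) = even b"
      by (simp_all add: dvd_mod_iff)
    then have "even (nat (a mod (2 * int m)) + nat (b mod (2 * int n)))"
      using ab m n by (simp add: even_nat_iff)
    moreover have "cos (pi * of_int a / real m) = node m i" "cos (pi * of_int b / real n) = node n j"
      using that by (auto simp: node_eq abs_if split: if_splits)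
         (metis cos_minus minus_divide_left mult_minus_right of_int_minus of_int_of_nat_eq minus_minus)+
    then have "node m (nat (a mod (2 * int m))) = node m i" "node n (nat (b mod (2 * int n))) = node n j"
      by (simp_all only: node_mod[OF m] node_mod[OF n])
    ultimately show ?thesis
      using lam_lattice[OF m n cop ab, of "dat m n g"] by (simp add: dat_def ij(1))
  qed
  from this[of "int i" "int j"] this[of "- int i" "int j"] this[of "int i" "- int j"] this[of "- int i" "- int j"]
  show ?thesis unfolding ij(1) node_eq interp_cos by simp
qed

section \<open>Uniqueness by discrete orthogonality\<close>

lemma sum_cos_full_period:
  assumes "1 \<le> m"
  shows "(\<Sum>i<2*m. cos (of_int a * (pi * real i / real m))) = (if 2 * int m dvd a then 2 * real m else 0)"
proof -
  have e: "cos (of_int a * (pi * real i / real m)) = Re (cis (of_int a * (0 + 2 * pi * real i / real (2*m))))" for i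
    by simp
  show ?thesis
  proof (cases "2 * int m dvd a")
    case True
    then obtain b where b: "a = 2 * int m * b" by blast
    have "cos (of_int a * (pi * real i / real m)) = 1" for i
    proof -
      have "of_int a * (pi * real i / real m) = of_int (b * int i) * 2 * pi" using b assms by simp
      then show ?thesis using cos_one_2pi_int by blast
    qed
    then show ?thesis using True by simp
  next
    case False
    then show ?thesis unfolding e Re_sum[symmetric]
      using sum_cis_grid[of "2*m" a 0] assms by simp
  qed
qed

definition Esum :: "nat \<Rightarrow> nat \<Rightarrow> int \<Rightarrow> int \<Rightarrow> real" where
  "Esum m n a b = (\<Sum>i<2*m. \<Sum>j<2*n. if even (i + j) then cos (of_int a * (pi * real i / real m)) * cos (of_int b * (pi * real j / real n)) else 0)"

text \<open>The indicator of \<open>i + j\<close> even is \<open>(1 + (-1) ^ (i + j)) / 2\<close>,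
  and the factor \<open>(-1) ^ i\<close> shifts a frequency by \<open>m\<close>,
  \<open>(-1) ^ j\<close> one by \<open>n\<close>. The two terms are the two ways in which a
  frequency can be invisible on the lattice.\<close>

lemma Esum_eq:
  assumes m: "1 \<le> m" and n: "1 \<le> n"
  shows "Esum m n a b = (if 2 * int m dvd a \<and> 2 * int n dvd b then 2 * real m * real n else 0)
     + (if 2 * int m dvd a + int m \<and> 2 * int n dvd b + int n then 2 * real m * real n else 0)"
proof -
  have s: "cos (of_int (c + int M) * (pi * real i / real M)) = (-1) ^ i * cos (of_int c * (pi * real i / real M))" if "1 \<le> M" for c M i
  proof -
    have "of_int (c + int M) * (pi * real i / real M) = of_int c * (pi * real i / real M) + real i * pi"
      using that by (simp add: field_simps)
    then show ?thesis by (simp only: cos_add cos_npi sin_npi) simp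
  qed
  let ?c = "\<lambda>a i. cos (of_int a * (pi * real i / real m))" and ?d = "\<lambda>b j. cos (of_int b * (pi * real j / real n))"
  have "(if even (i + j) then ?c a i * ?d b j else 0) = (?c a i * ?d b j + ?c (a + int m) i * ?d (b + int n) j) / 2" for i j
    unfolding s[OF m] s[OF n] by (cases "even i"; cases "even j") simp_all
  then have "Esum m n a b = ((\<Sum>i<2*m. ?c a i) * (\<Sum>j<2*n. ?d b j) + (\<Sum>i<2*m. ?c (a + int m) i) * (\<Sum>j<2*n. ?d (b + int n) j)) / 2"
    unfolding Esum_def by (simp only: sum_product sum.distrib sum_divide_distrib add_divide_distrib)
  then show ?thesis unfolding sum_cos_full_period[OF m] sum_cos_full_period[OF n] by auto
qed

text \<open>Coincidence modulo \<open>(2*m, 2*n)\<close> forces \<open>k = k'\<close>, as the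
  indices stay below \<open>m\<close> and at most \<open>n\<close>. Coincidence after the shift by
  \<open>(m, n)\<close> needs \<open>m \<le> fst k + fst k'\<close> and
  \<open>n \<le> snd k + snd k'\<close>; this puts both indices on the boundary of the rhombus,
  where \<open>idxL\<close> has only \<open>(0, n)\<close>.\<close>

lemma Esum_idxL:
  assumes m: "1 \<le> m" and n: "1 \<le> n" and k: "k \<in> idxL m n" "k' \<in> idxL m n" "k \<noteq> k'"
    and st: "\<bar>s\<bar> = 1" "\<bar>t\<bar> = 1"
  shows "Esum m n (int (fst k) + s * int (fst k')) (int (snd k) + t * int (snd k')) = 0"
proof -
  define a where "a = int (fst k) + s * int (fst k')"
  define b where "b = int (snd k) + t * int (snd k')"
  have r: "fst k < m" "fst k' < m" "snd k \<le> n" "snd k' \<le> n"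
    using k idxL_subset[OF m n] by auto
  have s: "s = 1 \<or> s = -1" and t: "t = 1 \<or> t = -1" using st by linarith+
  have ab: "\<bar>a\<bar> \<le> int (fst k) + int (fst k')" "\<bar>b\<bar> \<le> int (snd k) + int (snd k')"
    unfolding a_def b_def using s t by auto
  have 1: "\<not> (2 * int m dvd a \<and> 2 * int n dvd b)"
  proof
    assume d: "2 * int m dvd a \<and> 2 * int n dvd b"
    have "a = 0"
    proof (rule ccontr)
      assume "a \<noteq> 0"
      then have "2 * int m \<le> \<bar>a\<bar>" using d dvd_imp_le_int[of a "2 * int m"] by simp
      then show False using ab r by linarith
    qed
    then have "fst k = fst k'" unfolding a_def using s by auto
    moreover have "snd k = snd k'"
    proof (cases "b = 0")
      case True
      then show ?thesis unfolding b_def using t by auto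
    next
      case False
      then have "2 * int n \<le> \<bar>b\<bar>" using d dvd_imp_le_int[of b "2 * int n"] by simp
      then show ?thesis using ab r by linarith
    qed
    ultimately show False using k(3) by (simp add: prod_eq_iff)
  qed
  have 2: "\<not> (2 * int m dvd a + int m \<and> 2 * int n dvd b + int n)"
  proof
    assume d: "2 * int m dvd a + int m \<and> 2 * int n dvd b + int n"
    \<comment> \<open>The hypothesis says that \<open>c\<close> is an odd multiple of
      \<open>M\<close>, hence nonzero.\<close>
    have big: "M \<le> \<bar>c\<bar>" if dv: "2 * M dvd c + M" and M: "0 < M" for c M :: int
    proof -
      obtain q where q: "c + M = 2 * M * q" using dv by (rule dvdE)
      have "c = M * (2 * q - 1)" using q by (simp add: algebra_simps)
      moreover have "1 \<le> \<bar>2 * q - 1\<bar>" by presburger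
      ultimately show ?thesis using M mult_left_mono[of 1 "\<bar>2 * q - 1\<bar>" M] by (simp add: abs_mult)
    qed
    have "int m \<le> \<bar>a\<bar>" "int n \<le> \<bar>b\<bar>" using big[of "int m" a] big[of "int n" b] d m n by auto
    then have ge: "m \<le> fst k + fst k'" "n \<le> snd k + snd k'" using ab by linarith+
    have "m * n + n * m \<le> (fst k + fst k') * n + (snd k + snd k') * m"
      using ge by (intro add_mono mult_right_mono) auto
    then have tot: "2 * (m * n) \<le> (fst k * n + snd k * m) + (fst k' * n + snd k' * m)"
      by (simp add: algebra_simps)
    have le: "fst x * n + snd x * m \<le> m * n" "fst x * n + snd x * m = m * n \<Longrightarrow> x = (0, n)" if "x \<in> idxL m n" for x
      using that unfolding idxL_eq[OF m n] by (auto simp: mult.commute)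
    have "fst k * n + snd k * m = m * n" "fst k' * n + snd k' * m = m * n"
      using tot le(1)[OF k(1)] le(1)[OF k(2)] by linarith+
    then have "k = (0, n)" "k' = (0, n)" using le(2) k by blast+
    then show False using k(3) by simp
  qed
  show ?thesis unfolding Esum_eq[OF m n] a_def[symmetric] b_def[symmetric] using 1 2 by auto
qed

text \<open>The reflection \<open>i \<mapsto> 2*m - i\<close> preserves the cosine, and also the
  parity because \<open>2*m\<close> is even.\<close>

lemma node_reduce:
  assumes m: "1 \<le> m" and i: "i < 2 * m"
  shows "\<exists>i'\<le>m. node m i' = node m i \<and> even i' = even i"
proof (cases "i \<le> m")
  case False
  have "node m (2 * m - i) = cos (2 * pi - pi * real i / real m)"
    unfolding node_eq using m i by (intro arg_cong[where f = cos]) (simp add: of_nat_diff field_simps)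
  also have "\<dots> = node m i" unfolding node_eq by (simp add: cos_diff)
  finally show ?thesis using i False by (intro exI[of _ "2 * m - i"]) auto
qed auto

lemma node_in_LC:
  assumes "1 \<le> m" "1 \<le> n" "i < 2 * m" "j < 2 * n" "even (i + j)"
  shows "(node m i, node n j) \<in> LC m n"
proof -
  obtain i' where i': "i' \<le> m" "node m i' = node m i" "even i' = even i"
    using node_reduce[OF assms(1,3)] by blast
  obtain j' where j': "j' \<le> n" "node n j' = node n j" "even j' = even j"
    using node_reduce[OF assms(2,4)] by blast
  have "even (i' + j')" using i'(3) j'(3) assms(5) by simp
  then have "(node m i', node n j') \<in> LC m n" using i'(1) j'(1) unfolding LC_def by blast
  then show ?thesis by (simp only: i'(2) j'(2))
qed

text \<open>The products of cosines indexed by \<open>idxL\<close> are orthogonal for the sum over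
  the lattice, so the discrete inner product of \<open>q\<close> with each of them isolates one
  coefficient. All sample points are nodes in \<open>LC\<close>, where \<open>q\<close>
  vanishes.\<close>

lemma PiL_zero:
  assumes m: "1 \<le> m" and n: "1 \<le> n"
    and q: "q \<in> PiL m n" and q0: "\<And>z. z \<in> LC m n \<Longrightarrow> q z = 0"
  shows "q = (\<lambda>z. 0)"
proof -
  obtain c where c: "\<And>x y. q (x, y) = (\<Sum>(k, l)\<in>idxL m n. c (k, l) * cheb k x * cheb l y)"
    using q unfolding PiL_def by blast
  let ?a = "\<lambda>i. pi * real i / real m" and ?b = "\<lambda>j. pi * real j / real n"
  have prod: "(cos (k * x) * cos (l * y)) * (cos (k' * x) * cos (l' * y)) =
     (cos ((k + k') * x) * cos ((l + l') * y) + cos ((k - k') * x) * cos ((l + l') * y)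
      + cos ((k + k') * x) * cos ((l - l') * y) + cos ((k - k') * x) * cos ((l - l') * y)) / 4" for k l k' l' x y :: real
  proof -
    have "cos (k * x) * cos (k' * x) = (cos ((k + k') * x) + cos ((k - k') * x)) / 2"
      "cos (l * y) * cos (l' * y) = (cos ((l + l') * y) + cos ((l - l') * y)) / 2"
      by (simp_all add: cos_add cos_diff distrib_right left_diff_distrib)
    note c2 = this
    have "(cos (k * x) * cos (l * y)) * (cos (k' * x) * cos (l' * y)) = (cos (k * x) * cos (k' * x)) * (cos (l * y) * cos (l' * y))"
      by (simp only: mult_ac)
    also have "\<dots> = ((cos ((k + k') * x) + cos ((k - k') * x)) / 2) * ((cos ((l + l') * y) + cos ((l - l') * y)) / 2)"
      by (simp only: c2)
    finally show ?thesis by (simp add: algebra_simps)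
  qed
  \<comment> \<open>The Gram matrix of these products. Product-to-sum formulas write an entry as
    four values of \<open>Esum\<close>; on the diagonal, the one at frequency \<open>(0, 0)\<close>
    is positive and the others are nonnegative.\<close>
  define O1 where "O1 = (\<lambda>k k'. \<Sum>i<2*m. \<Sum>j<2*n. if even (i + j) then
      (cos (real (fst k) * ?a i) * cos (real (snd k) * ?b j)) * (cos (real (fst k') * ?a i) * cos (real (snd k') * ?b j)) else 0)"
  have O1: "O1 k k' = (Esum m n (int (fst k) + 1 * int (fst k')) (int (snd k) + 1 * int (snd k'))
      + Esum m n (int (fst k) + (-1) * int (fst k')) (int (snd k) + 1 * int (snd k'))
      + Esum m n (int (fst k) + 1 * int (fst k')) (int (snd k) + (-1) * int (snd k'))
      + Esum m n (int (fst k) + (-1) * int (fst k')) (int (snd k) + (-1) * int (snd k'))) / 4" for k k'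
    unfolding O1_def Esum_def prod sum.distrib[symmetric] sum_divide_distrib
    by (intro sum.cong refl) simp
  have off: "O1 k k' = 0" if "k \<in> idxL m n" "k' \<in> idxL m n" "k \<noteq> k'" for k k'
    unfolding O1 by (simp only: Esum_idxL[OF m n that] abs_one abs_minus_cancel) simp
  have diag: "O1 k k > 0" for k
  proof -
    have nn: "Esum m n a b \<ge> 0" for a b unfolding Esum_eq[OF m n] by simp
    have "Esum m n (int (fst k) + (-1) * int (fst k)) (int (snd k) + (-1) * int (snd k)) > 0"
      unfolding Esum_eq[OF m n] using m n by (simp add: add_pos_nonneg)
    then show ?thesis unfolding O1 using nn
      by (intro divide_pos_pos add_nonneg_pos add_nonneg_nonneg) auto
  qed
  have c0: "c k' = 0" if k': "k' \<in> idxL m n" for k'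
  proof -
    have "0 = (\<Sum>i<2*m. \<Sum>j<2*n. if even (i + j) then q (node m i, node n j) * (cos (real (fst k') * ?a i) * cos (real (snd k') * ?b j)) else 0)"
    proof (rule sum.neutral[symmetric], intro ballI sum.neutral)
      fix i j assume "i \<in> {..<2*m}" "j \<in> {..<2*n}"
      then have "q (node m i, node n j) = 0" if "even (i + j)"
        using that by (intro q0 node_in_LC[OF m n]) auto
      then show "(if even (i + j) then q (node m i, node n j) * (cos (real (fst k') * ?a i) * cos (real (snd k') * ?b j)) else 0) = 0"
        by simp
    qed
    also have "\<dots> = (\<Sum>i<2*m. \<Sum>j<2*n. \<Sum>k\<in>idxL m n. c k * (if even (i + j) then
      (cos (real (fst k) * ?a i) * cos (real (snd k) * ?b j)) * (cos (real (fst k') * ?a i) * cos (real (snd k') * ?b j)) else 0))"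
      unfolding c node_eq cheb_cos by (intro sum.cong refl) (auto simp: sum_distrib_left case_prod_unfold mult_ac)
    also have "\<dots> = (\<Sum>k\<in>idxL m n. c k * O1 k k')"
      unfolding O1_def sum_distrib_left by (rule sum_rotate)
    also have "\<dots> = (\<Sum>k\<in>idxL m n. if k = k' then c k' * O1 k' k' else 0)"
      using off k' by (intro sum.cong refl) auto
    also have "\<dots> = c k' * O1 k' k'" using k' finite_idxL[OF m n] by simp
    finally show ?thesis using diag[of k'] by simp
  qed
  show ?thesis
  proof
    fix z
    have "q z = (\<Sum>(k, l)\<in>idxL m n. c (k, l) * cheb k (fst z) * cheb l (snd z))"
      using c[of "fst z" "snd z"] by simp
    then show "q z = 0" using c0 by (auto intro!: sum.neutral)
  qed
qed

lemma PiL_diff: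
  assumes "p \<in> PiL m n" "q \<in> PiL m n"
  shows "(\<lambda>z. p z - q z) \<in> PiL m n"
proof -
  obtain c where c: "\<And>x y. p (x, y) = (\<Sum>(k, l)\<in>idxL m n. c (k, l) * cheb k x * cheb l y)"
    using assms unfolding PiL_def by blast
  obtain d where d: "\<And>x y. q (x, y) = (\<Sum>(k, l)\<in>idxL m n. d (k, l) * cheb k x * cheb l y)"
    using assms unfolding PiL_def by blast
  show ?thesis unfolding PiL_def mem_Collect_eq
    by (rule exI[of _ "\<lambda>k. c k - d k"])
       (simp add: c d sum_subtractf[symmetric] left_diff_distrib case_prod_unfold)
qed

text \<open>Supplies the constant competitors that a bounded function has in one-sided
  approximation.\<close>

lemma const_in_PiL:
  assumes "1 \<le> m" "1 \<le> n"
  shows "(\<lambda>z. a) \<in> PiL m n"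
proof -
  have "(\<Sum>(k, l)\<in>idxL m n. (if (k, l) = (0, 0) then a else 0) * cheb k x * cheb l y) = a" for x y
  proof -
    have "(\<Sum>(k, l)\<in>idxL m n. (if (k, l) = (0, 0) then a else 0) * cheb k x * cheb l y) = (\<Sum>z\<in>idxL m n. if z = (0, 0) then a else 0)"
      by (intro sum.cong refl) (auto simp: cheb_def split: if_splits)
    also have "\<dots> = a" using finite_idxL[OF assms] assms by (simp add: idxL_eq)
    finally show ?thesis .
  qed
  then show ?thesis unfolding PiL_def mem_Collect_eq
    by (intro exI[of _ "\<lambda>k. if k = (0, 0) then a else 0"]) simp
qed

lemma PiL_unique:
  assumes "1 \<le> m" "1 \<le> n" "p \<in> PiL m n" "q \<in> PiL m n" "\<And>z. z \<in> LC m n \<Longrightarrow> p z = q z"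
  shows "p = q"
proof -
  have "(\<lambda>z. p z - q z) = (\<lambda>z. 0)"
    by (rule PiL_zero[OF assms(1,2) PiL_diff[OF assms(3,4)]]) (use assms(5) in simp)
  then show ?thesis by (simp add: fun_eq_iff)
qed

lemma Lint_eq:
  assumes "1 \<le> m" "1 \<le> n" "coprime m n"
  shows "Lint m n f = interp m n (dat m n f)"
  unfolding Lint_def
  by (rule the_equality)
     (use interp_LC[OF assms] interp_in_PiL PiL_unique[OF assms(1,2)] in auto)

text \<open>Interpolation is linear and reproduces \<open>q\<close>: both
  \<open>Lint m n f - q\<close> and the interpolant of \<open>f - q\<close> lie in
  \<open>PiL\<close> and agree at the nodes.\<close>

lemma Lint_diff:
  assumes "1 \<le> m" "1 \<le> n" "coprime m n" "q \<in> PiL m n"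
  shows "Lint m n f z = q z + interp m n (dat m n (\<lambda>z. f z - q z)) z"
proof -
  have "(\<lambda>z. Lint m n f z - q z) = interp m n (dat m n (\<lambda>z. f z - q z))"
    by (rule PiL_unique[OF assms(1,2)])
       (use interp_LC[OF assms(1-3)] interp_in_PiL PiL_diff assms(4) in \<open>auto simp: Lint_eq[OF assms(1-3)]\<close>)
  then show ?thesis by (metis add_diff_cancel_left' add.commute diff_add_cancel)
qed

section \<open>Norm bounds for the interpolant\<close>

lemma continuous_on_cos_real:
  fixes f :: "'a::topological_space \<Rightarrow> real"
  assumes "continuous_on S f"
  shows "continuous_on S (\<lambda>x. cos (f x))"
  using continuous_on_Re[OF continuous_on_cis'[OF assms]] by simp

lemma continuous_on_ekr [continuous_intros]:
  "continuous_on S u \<Longrightarrow> continuous_on S v \<Longrightarrow> continuous_on S (\<lambda>z. ekr m n (u z) (v z))"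
  unfolding ekr_def by (intro continuous_intros continuous_on_cos_real)

lemma ekr_periodic: "ekr m n (x + 2*pi) y = ekr m n x y" "ekr m n x (y + 2*pi) = ekr m n x y"
proof -
  have "cos (real k * (t + 2*pi)) = cos (real k * t)" for k t
    by (rule cos_mult_cong) simp
  then show "ekr m n (x + 2*pi) y = ekr m n x y" "ekr m n x (y + 2*pi) = ekr m n x y"
    by (simp_all only: ekr_def)
qed

lemma continuous_on_lam:
  "continuous_on S u \<Longrightarrow> continuous_on S v \<Longrightarrow> continuous_on S (\<lambda>z. lam m n F (u z) (v z))"
  unfolding lam_def times_divide_eq_right divide_inverse by (intro continuous_intros)

lemma lam_periodic: "lam m n F (x + 2*pi) y = lam m n F x y" "lam m n F x (y + 2*pi) = lam m n F x y"
proof -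
  have "x + 2*pi - a = x - a + 2*pi" for x a :: real by simp
  then show "lam m n F (x + 2*pi) y = lam m n F x y" "lam m n F x (y + 2*pi) = lam m n F x y"
    by (simp_all only: lam_def ekr_periodic)
qed

lemma continuous_on_abs_powr:
  fixes f :: "'a::topological_space \<Rightarrow> real"
  assumes "continuous_on A f" "0 < p"
  shows "continuous_on A (\<lambda>t. \<bar>f t\<bar> powr p)"
  using assms by (intro continuous_on_powr' continuous_intros) auto

text \<open>The triangle inequality and translation invariance reduce everything to the mean of
  \<open>\<bar>ekr\<bar>\<close>, which exceeds that of \<open>cmod rker\<close> by at most
  1.\<close>

lemma tmean2_lam_le_L1:
  "\<exists>C>0. \<forall>m n F. 1 \<le> m \<longrightarrow> 1 \<le> n \<longrightarrow>
    real (2*m) * real (2*n) * tmean2 (\<lambda>x y. \<bar>lam m n F x y\<bar>) \<le> C * (ln (real m + 1) * ln (real n + 1)) * (\<Sum>i<2*m. \<Sum>j<2*n. \<bar>F i j\<bar>)"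
proof -
  obtain C where C: "C > 0" and R: "\<And>m n. 1 \<le> m \<Longrightarrow> 1 \<le> n \<Longrightarrow>
     tmean2 (\<lambda>x y. cmod (rker m n x y)) \<le> C * (ln (real m + 1) * ln (real n + 1))"
    using rker_L1 by blast
  \<comment> \<open>The factor 2 is the ratio of the grid size \<open>4*m*n\<close> to the number
    \<open>2*m*n\<close> of lattice points; \<open>1 / (ln 2)\<^sup>2\<close> absorbs the bound 1
    for the boundary cosine, as both logarithms are at least \<open>ln 2\<close>.\<close>
  define D where "D = 2 * (C + 1 / (ln 2)\<^sup>2)"
  have "real (2*m) * real (2*n) * tmean2 (\<lambda>x y. \<bar>lam m n F x y\<bar>) \<le> D * (ln (real m + 1) * ln (real n + 1)) * (\<Sum>i<2*m. \<Sum>j<2*n. \<bar>F i j\<bar>)"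
    if m: "1 \<le> m" and n: "1 \<le> n" for m n and F :: "nat \<Rightarrow> nat \<Rightarrow> real"
  proof -
    define K where "K = tmean2 (\<lambda>x y. \<bar>ekr m n x y\<bar>)"
    have ce: "continuous_on UNIV (\<lambda>(x, y). \<bar>ekr m n (x + a) (y + b)\<bar>)" for a b
      unfolding case_prod_unfold by (intro continuous_intros)
    have K: "K \<le> (C + 1 / (ln 2)\<^sup>2) * (ln (real m + 1) * ln (real n + 1))"
    proof -
      have "K \<le> tmean2 (\<lambda>x y. cmod (rker m n x y) + 1)"
        unfolding K_def
      proof (rule tmean2_mono)
        show "continuous_on UNIV (\<lambda>(x, y). \<bar>ekr m n x y\<bar>)" using ce[of 0 0] by simp
        fix x y
        have "\<bar>ekr m n x y\<bar> = cmod (rker m n x y + of_real (cos (real n * y)))"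
          unfolding ekr_eq[OF m n, symmetric] by simp
        also have "\<dots> \<le> cmod (rker m n x y) + \<bar>cos (real n * y)\<bar>"
          using norm_triangle_ineq[of "rker m n x y" "of_real (cos (real n * y))"] by simp
        also have "\<dots> \<le> cmod (rker m n x y) + 1" by simp
        finally show "\<bar>ekr m n x y\<bar> \<le> cmod (rker m n x y) + 1" .
      qed (unfold case_prod_unfold, intro continuous_intros)
      also have "\<dots> = tmean2 (\<lambda>x y. cmod (rker m n x y)) + 1"
        by (subst tmean2_add) (unfold case_prod_unfold, auto intro!: continuous_intros)
      also have "\<dots> \<le> C * (ln (real m + 1) * ln (real n + 1)) + (1 / (ln 2)\<^sup>2) * (ln (real m + 1) * ln (real n + 1))"
      proof (intro add_mono R m n)
        have "ln 2 * ln 2 \<le> ln (real m + 1) * ln (real n + 1)"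
          using m n by (intro mult_mono) auto
        then show "1 \<le> (1 / (ln 2)\<^sup>2) * (ln (real m + 1) * ln (real n + 1))"
          by (simp add: power2_eq_square field_simps)
      qed
      finally show ?thesis by (simp add: distrib_right)
    qed
    have shift: "tmean2 (\<lambda>x y. \<bar>ekr m n (x - a) (y - b)\<bar>) = K" for a b
      unfolding K_def using tmean2_shift[of "\<lambda>x y. \<bar>ekr m n x y\<bar>" "-a" "-b"] ce[of 0 0]
      by (simp add: ekr_periodic)
    have ce': "continuous_on UNIV (\<lambda>(x, y). c * \<bar>ekr m n (x - a) (y - b)\<bar>)" for a b c
      unfolding case_prod_unfold by (intro continuous_intros)
    have "tmean2 (\<lambda>x y. \<bar>lam m n F x y\<bar>) \<le> tmean2 (\<lambda>x y. \<Sum>z\<in>{..<2*m}\<times>{..<2*n}. (\<bar>F (fst z) (snd z)\<bar> / (2 * real m * real n)) * \<bar>ekr m n (x - pi * real (fst z) / real m) (y - pi * real (snd z) / real n)\<bar>)"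
    proof (rule tmean2_mono)
      show "continuous_on UNIV (\<lambda>(x, y). \<bar>lam m n F x y\<bar>)"
        unfolding case_prod_unfold by (intro continuous_intros continuous_on_lam)
      show "continuous_on UNIV (\<lambda>(x, y). \<Sum>z\<in>{..<2*m}\<times>{..<2*n}. (\<bar>F (fst z) (snd z)\<bar> / (2 * real m * real n)) * \<bar>ekr m n (x - pi * real (fst z) / real m) (y - pi * real (snd z) / real n)\<bar>)"
        unfolding case_prod_unfold using m n by (intro continuous_intros) auto
      show "\<bar>lam m n F x y\<bar> \<le> (\<Sum>z\<in>{..<2*m}\<times>{..<2*n}. (\<bar>F (fst z) (snd z)\<bar> / (2 * real m * real n)) * \<bar>ekr m n (x - pi * real (fst z) / real m) (y - pi * real (snd z) / real n)\<bar>)" for x y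
        unfolding lam_def sum.cartesian_product case_prod_unfold sum_divide_distrib
        by (rule order_trans[OF sum_abs]) (simp add: abs_mult)
    qed
    also have "\<dots> = (\<Sum>z\<in>{..<2*m}\<times>{..<2*n}. (\<bar>F (fst z) (snd z)\<bar> / (2 * real m * real n)) * K)"
      by (subst tmean2_sum, simp, rule ce') (simp only: tmean2_cmult shift)
    also have "\<dots> = (\<Sum>i<2*m. \<Sum>j<2*n. \<bar>F i j\<bar>) / (2 * real m * real n) * K"
      unfolding sum.cartesian_product case_prod_unfold by (simp only: sum_distrib_right sum_divide_distrib)
    finally have "real (2*m) * real (2*n) * tmean2 (\<lambda>x y. \<bar>lam m n F x y\<bar>) \<le> real (2*m) * real (2*n) * ((\<Sum>i<2*m. \<Sum>j<2*n. \<bar>F i j\<bar>) / (2 * real m * real n) * K)"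
      by (rule mult_left_mono) simp
    also have "\<dots> = (\<Sum>i<2*m. \<Sum>j<2*n. \<bar>F i j\<bar>) * (2 * K)" using m n by (simp add: field_simps)
    also have "\<dots> \<le> (\<Sum>i<2*m. \<Sum>j<2*n. \<bar>F i j\<bar>) * (2 * ((C + 1 / (ln 2)\<^sup>2) * (ln (real m + 1) * ln (real n + 1))))"
      using K by (intro mult_left_mono) (auto intro!: sum_nonneg)
    also have "\<dots> = D * (ln (real m + 1) * ln (real n + 1)) * (\<Sum>i<2*m. \<Sum>j<2*n. \<bar>F i j\<bar>)"
      by (simp only: D_def mult_ac)
    finally show ?thesis .
  qed
  moreover have "D > 0" unfolding D_def using C by (intro mult_pos_pos add_pos_nonneg) auto
  ultimately show ?thesis by blast
qed

text \<open>\<open>lam\<close> is twice the sum of a rhombic part \<open>A\<close>, covered by the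
  multiplier theorem, and a part \<open>E\<close> from the boundary frequency \<open>(0, n)\<close>.
  Jensen's inequality bounds \<open>E\<close> pointwise by the average of the data.\<close>

lemma tmean2_lam_le_Lp:
  assumes p: "1 < p"
  shows "\<exists>C>0. \<forall>m n F. 1 \<le> m \<longrightarrow> 1 \<le> n \<longrightarrow>
    real (2*m) * real (2*n) * tmean2 (\<lambda>x y. \<bar>lam m n F x y\<bar> powr p) \<le> C * (\<Sum>i<2*m. \<Sum>j<2*n. \<bar>F i j\<bar> powr p)"
proof -
  obtain C where C: "C \<ge> 0" and R: "\<And>m n (F :: nat \<Rightarrow> nat \<Rightarrow> complex). m > 0 \<Longrightarrow> n > 0 \<Longrightarrow>
    real (2*m) * real (2*n) * tmean2 (\<lambda>x y. cmod ((\<Sum>i<2*m. \<Sum>j<2*n. F i j * rker m n (x - pi * real i / real m) (y - pi * real j / real n)) / (of_nat (2*m) * of_nat (2*n))) powr p)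
    \<le> C * (\<Sum>i<2*m. \<Sum>j<2*n. cmod (F i j) powr p)"
    using rker_sum_bound[OF p] by blast
  define D where "D = 4 powr p * (C + 1)"
  have "real (2*m) * real (2*n) * tmean2 (\<lambda>x y. \<bar>lam m n F x y\<bar> powr p) \<le> D * (\<Sum>i<2*m. \<Sum>j<2*n. \<bar>F i j\<bar> powr p)"
    if m: "1 \<le> m" and n: "1 \<le> n" for m n and F :: "nat \<Rightarrow> nat \<Rightarrow> real"
  proof -
    define N where "N = real (2*m) * real (2*n)"
    have N: "N > 0" using m n by (simp add: N_def)
    define S where "S = (\<Sum>i<2*m. \<Sum>j<2*n. \<bar>F i j\<bar> powr p)"
    define A where "A = (\<lambda>x y. (\<Sum>i<2*m. \<Sum>j<2*n. of_real (F i j) * rker m n (x - pi * real i / real m) (y - pi * real j / real n)) / (of_nat (2*m) * of_nat (2*n)))"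
    define E where "E = (\<lambda>y. (\<Sum>i<2*m. \<Sum>j<2*n. F i j * cos (real n * (y - pi * real j / real n))) / N)"
    have cA: "continuous_on UNIV (\<lambda>(x, y). cmod (A x y) powr p)"
      unfolding A_def case_prod_unfold using p m n by (intro continuous_on_cmod_powr continuous_intros) auto
    have lamAE: "of_real (lam m n F x y) = 2 * (A x y + of_real (E y))" for x y
    proof -
      have "of_real (lam m n F x y) = (\<Sum>i<2*m. \<Sum>j<2*n. of_real (F i j) * (rker m n (x - pi * real i / real m) (y - pi * real j / real n) + of_real (cos (real n * (y - pi * real j / real n))))) / (2 * of_nat m * of_nat n)"
        by (simp add: lam_def ekr_eq[OF m n, symmetric])
      also have "\<dots> = 2 * (A x y + of_real (E y))"
        unfolding A_def E_def N_def using m n by (simp add: distrib_left sum.distrib field_simps)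
      finally show ?thesis .
    qed
    have EN: "\<bar>E y\<bar> powr p \<le> S / N" for y
    proof -
      have "\<bar>E y\<bar> \<le> (\<Sum>z\<in>{..<2*m}\<times>{..<2*n}. (1 / N) * \<bar>F (fst z) (snd z)\<bar>)"
        unfolding E_def sum.cartesian_product case_prod_unfold sum_divide_distrib
      proof (rule order_trans[OF sum_abs], rule sum_mono)
        fix z :: "nat \<times> nat"
        have "\<bar>F (fst z) (snd z)\<bar> * \<bar>cos (real n * (y - pi * real (snd z) / real n))\<bar> \<le> \<bar>F (fst z) (snd z)\<bar> * 1"
          by (intro mult_left_mono) auto
        then show "\<bar>F (fst z) (snd z) * cos (real n * (y - pi * real (snd z) / real n)) / N\<bar> \<le> (1 / N) * \<bar>F (fst z) (snd z)\<bar>"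
          using N by (simp add: abs_mult divide_right_mono)
      qed
      then have "\<bar>E y\<bar> powr p \<le> (\<Sum>z\<in>{..<2*m}\<times>{..<2*n}. (1 / N) * \<bar>F (fst z) (snd z)\<bar>) powr p"
        using p by (intro powr_mono2) auto
      also have "\<dots> \<le> (\<Sum>z\<in>{..<2*m}\<times>{..<2*n}. (1 / N) * \<bar>F (fst z) (snd z)\<bar> powr p)"
        using p N m n by (intro jensen_sum_powr) (auto simp: N_def)
      also have "\<dots> = S / N"
        unfolding S_def sum.cartesian_product case_prod_unfold by (simp add: sum_divide_distrib)
      finally show ?thesis .
    qed
    have "tmean2 (\<lambda>x y. \<bar>lam m n F x y\<bar> powr p) \<le> tmean2 (\<lambda>x y. 4 powr p * (cmod (A x y) powr p + S / N))"
    proof (rule tmean2_mono)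
      show "continuous_on UNIV (\<lambda>(x, y). \<bar>lam m n F x y\<bar> powr p)"
        unfolding case_prod_unfold using p by (intro continuous_on_abs_powr continuous_on_lam continuous_intros) auto
      show "continuous_on UNIV (\<lambda>(x, y). 4 powr p * (cmod (A x y) powr p + S / N))"
        unfolding case_prod_unfold
        by (intro continuous_on_mult_left continuous_on_add continuous_on_const cA[unfolded case_prod_unfold])
      fix x y
      have "\<bar>lam m n F x y\<bar> = cmod (2 * (A x y + of_real (E y)))"
        unfolding lamAE[symmetric] by simp
      also have "\<dots> = 2 * cmod (A x y + of_real (E y))" by (simp only: norm_mult) simp
      also have "\<dots> \<le> 2 * (cmod (A x y) + \<bar>E y\<bar>)"
        using norm_triangle_ineq[of "A x y" "of_real (E y)"] by simp
      finally have "\<bar>lam m n F x y\<bar> powr p \<le> 4 powr p * (cmod (A x y) powr p + \<bar>E y\<bar> powr p)"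
        using p by (intro powr_le_twice_add) auto
      also have "\<dots> \<le> 4 powr p * (cmod (A x y) powr p + S / N)"
        using EN by (intro mult_left_mono add_left_mono) auto
      finally show "\<bar>lam m n F x y\<bar> powr p \<le> 4 powr p * (cmod (A x y) powr p + S / N)" .
    qed
    also have "\<dots> = 4 powr p * (tmean2 (\<lambda>x y. cmod (A x y) powr p) + S / N)"
      unfolding tmean2_cmult by (subst tmean2_add[OF cA]) auto
    finally have "N * tmean2 (\<lambda>x y. \<bar>lam m n F x y\<bar> powr p) \<le> N * (4 powr p * (tmean2 (\<lambda>x y. cmod (A x y) powr p) + S / N))"
      using N by (intro mult_left_mono) auto
    also have "\<dots> = 4 powr p * (N * tmean2 (\<lambda>x y. cmod (A x y) powr p) + S)"
      using N by (simp add: field_simps)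
    also have "\<dots> \<le> 4 powr p * (C * S + S)"
      using R[of m n "\<lambda>i j. of_real (F i j)"] m n
      by (intro mult_left_mono add_right_mono) (auto simp: A_def N_def S_def)
    finally show ?thesis by (simp add: N_def S_def D_def algebra_simps)
  qed
  moreover have "D > 0" unfolding D_def using C by (intro mult_pos_pos add_nonneg_pos) auto
  ultimately show ?thesis by blast
qed

section \<open>The weighted norm in trigonometric coordinates\<close>

text \<open>Nonnegative integrals handle the singular weight without prior integrability. The
  substitution \<open>x = - cos t\<close> is increasing on \<open>[0, pi]\<close>, as the
  substitution rule requires; evenness then turns the half period into the mean over a full
  one.\<close>

lemma cheb_nn_integral:
  fixes h :: "real \<Rightarrow> real"
  assumes h: "continuous_on {-1..1} h" and h0: "\<And>x. x \<in> {-1..1} \<Longrightarrow> 0 \<le> h x"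
  shows "(\<integral>\<^sup>+x. ennreal (h x / sqrt (1 - x\<^sup>2)) * indicator {-1..1} x \<partial>lborel) = ennreal (pi * tmean (\<lambda>t. h (cos t)))"
proof -
  define u where "u = (\<lambda>t. h (- cos t))"
  have r: "- cos t \<in> {-1..1}" "cos t \<in> {-1..1}" for t :: real by auto
  have cu: "continuous_on S u" for S
    unfolding u_def by (rule continuous_on_compose2[OF h]) (use r in \<open>auto intro!: continuous_intros\<close>)
  have chc: "continuous_on S (\<lambda>t. h (cos t))" for S
    by (rule continuous_on_compose2[OF h]) (use r in \<open>auto intro!: continuous_intros\<close>)
  have int: "u integrable_on {a..b}" for a b by (intro integrable_continuous_real cu)
  have meas: "set_borel_measurable borel {- cos 0..- cos pi} (\<lambda>x. h x / sqrt (1 - x\<^sup>2))"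
  proof -
    have "(\<lambda>x. indicator {-1..1} x *\<^sub>R h x) \<in> borel_measurable borel"
      by (rule borel_measurable_continuous_on_indicator) (use h in auto)
    then have "(\<lambda>x. (indicator {-1..1} x *\<^sub>R h x) / sqrt (1 - x\<^sup>2)) \<in> borel_measurable borel"
      by measurable
    then show ?thesis by (simp add: set_borel_measurable_def)
  qed
  have "(\<integral>\<^sup>+x. ennreal ((h x / sqrt (1 - x\<^sup>2)) * indicator {- cos 0..- cos pi} x) \<partial>lborel)
     = (\<integral>\<^sup>+t. ennreal ((h (- cos t) / sqrt (1 - (- cos t)\<^sup>2)) * sin t * indicator {0..pi} t) \<partial>lborel)"
    by (rule nn_integral_substitution[where g = "\<lambda>t. - cos t" and g' = sin and a = 0 and b = pi])
       (use meas in \<open>auto intro!: derivative_eq_intros continuous_intros sin_ge_zero\<close>)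
  then have "(\<integral>\<^sup>+x. ennreal (h x / sqrt (1 - x\<^sup>2)) * indicator {-1..1} x \<partial>lborel)
     = (\<integral>\<^sup>+t. ennreal (h (- cos t) / sqrt (1 - (- cos t)\<^sup>2) * sin t) * indicator {0..pi} t \<partial>lborel)"
    by (simp add: nn_integral_set_ennreal)
  also have "\<dots> = (\<integral>\<^sup>+t. ennreal (u t) * indicator {0..pi} t \<partial>lborel)"
  proof (rule nn_integral_cong_AE)
    \<comment> \<open>At the endpoints \<open>sin t = 0\<close> and the quotient is 0 by the
      division convention, so the two integrands may differ there.\<close>
    have "AE t in lborel. t \<noteq> 0 \<and> t \<noteq> (pi::real)"
      using AE_lborel_singleton[of "0::real"] AE_lborel_singleton[of "pi::real"] by eventually_elim simp
    then show "AE t in lborel. ennreal (h (- cos t) / sqrt (1 - (- cos t)\<^sup>2) * sin t) * indicator {0..pi} t = ennreal (u t) * indicator {0..pi} t"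
    proof eventually_elim
      case (elim t)
      show ?case
      proof (cases "t \<in> {0..pi}")
        case True
        then have s: "sin t > 0" using elim by (intro sin_gt_zero) auto
        have "sqrt (1 - (- cos t)\<^sup>2) = sqrt ((sin t)\<^sup>2)" by (simp add: sin_squared_eq)
        then have "sqrt (1 - (- cos t)\<^sup>2) = sin t" using s by simp
        then show ?thesis using s by (simp add: u_def)
      qed simp
    qed
  qed
  also have "\<dots> = ennreal (integral {0..pi} u)"
    by (rule nn_integral_has_integral_lebesgue')
       (use h0 r int in \<open>auto simp: u_def has_integral_integral[symmetric]\<close>)
  also have "integral {0..pi} u = pi * tmean (\<lambda>t. h (cos t))"
  proof -
    have "tmean (\<lambda>t. h (cos t)) = tmean (\<lambda>t. h (cos (t + pi)))"
      by (rule tmean_shift[symmetric]) (auto intro: chc)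
    also have "\<dots> = tmean u" by (simp add: u_def)
    finally have t: "tmean (\<lambda>t. h (cos t)) = integral {0..2*pi} u / (2*pi)" by (simp add: tmean_def)
    have "integral {0..2*pi} u = integral {-pi..pi} u"
      using integral_periodic_shift[of u "-pi"] cu by (simp add: u_def)
    also have "\<dots> = integral {-pi..0} u + integral {0..pi} u"
      using Henstock_Kurzweil_Integration.integral_combine[of "-pi" 0 pi u] int by simp
    also have "integral {-pi..0} u = integral {0..pi} (\<lambda>t. u (- t))"
      using Henstock_Kurzweil_Integration.integral_reflect_real[of 0 "-pi" u] by simp
    also have "(\<lambda>t. u (- t)) = u" by (simp add: u_def)
    finally show ?thesis unfolding t by simp
  qed
  finally show ?thesis .
qed

definition chebw :: "real \<times> real \<Rightarrow> real" where
  "chebw z = 1 / (sqrt (1 - (fst z)\<^sup>2) * sqrt (1 - (snd z)\<^sup>2))"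

lemma J2_eq: "J2 = {-1..1} \<times> {-1..1}"
  by (simp add: J2_def J_def)

lemma cos_cos_in_J2: "(cos x, cos y) \<in> J2"
  by (simp add: J2_eq)

lemma chebw_nonneg: "z \<in> J2 \<Longrightarrow> 0 \<le> chebw z"
  unfolding chebw_def by (auto simp: J2_eq abs_square_le_1 abs_le_iff)

text \<open>Tonelli's theorem for the zero extension \<open>f\<close> on \<open>lborel\<close>
  applies the one-variable formula in each coordinate. Since \<open>f\<close> is Borel, the
  completion has the same integral, and finiteness of the nonnegative integral yields
  integrability.\<close>

lemma chebw_integral:
  fixes G :: "real \<times> real \<Rightarrow> real"
  assumes G: "continuous_on J2 G" and G0: "\<And>z. z \<in> J2 \<Longrightarrow> 0 \<le> G z"
  shows "integrable (lebesgue_on J2) (\<lambda>z. G z * chebw z)"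
    and "integral\<^sup>L (lebesgue_on J2) (\<lambda>z. G z * chebw z) = pi\<^sup>2 * tmean2 (\<lambda>x y. G (cos x, cos y))"
proof -
  define f where "f = (\<lambda>z. indicator J2 z *\<^sub>R (G z * chebw z))"
  have closed: "closed J2" unfolding J2_eq by (intro closed_Times) auto
  have J2b: "J2 \<in> sets borel" using closed by auto
  have mf: "f \<in> borel_measurable borel"
  proof -
    have "(\<lambda>z. indicator J2 z *\<^sub>R G z) \<in> borel_measurable borel"
      by (rule borel_measurable_continuous_on_indicator[OF J2b G])
    moreover have "chebw \<in> borel_measurable borel"
      unfolding chebw_def[abs_def] borel_prod[symmetric] by measurable
    ultimately have "(\<lambda>z. (indicator J2 z *\<^sub>R G z) * chebw z) \<in> borel_measurable borel" by measurable
    then show ?thesis by (simp add: f_def mult.assoc)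
  qed
  have f0: "0 \<le> f z" for z
  proof (cases "z \<in> J2")
    case True
    then show ?thesis using G0 chebw_nonneg by (simp add: f_def)
  qed (simp add: f_def)
  define H where "H = (\<lambda>x. pi * tmean (\<lambda>t. G (x, cos t)))"
  have cG: "continuous_on S (\<lambda>z. G (u z, v z))"
    if "continuous_on S u" "continuous_on S v" "\<And>z. z \<in> S \<Longrightarrow> (u z, v z) \<in> J2" for S :: "'c::topological_space set" and u v
    by (rule continuous_on_compose2[OF G]) (use that in \<open>auto intro!: continuous_intros\<close>)
  have cH: "continuous_on {-1..1} H"
  proof -
    have "continuous_on {-1..1} (\<lambda>x. integral (cbox 0 (2*pi)) (\<lambda>t. G (x, cos t)))"
    proof (rule integral_continuous_on_param)
      show "continuous_on ({-1..1} \<times> cbox 0 (2*pi)) (\<lambda>(x, t). G (x, cos t))"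
        unfolding case_prod_unfold by (rule cG) (auto intro!: continuous_intros simp: J2_eq)
    qed
    then show ?thesis unfolding H_def tmean_def by (auto intro!: continuous_intros)
  qed
  have H0: "0 \<le> H x" if "x \<in> {-1..1}" for x
    unfolding H_def using that
    by (intro mult_nonneg_nonneg tmean_nonneg cG continuous_intros) (auto simp: J2_eq intro!: G0)
  have inner: "(\<integral>\<^sup>+y. ennreal (f (x, y)) \<partial>lborel) = ennreal (H x / sqrt (1 - x\<^sup>2)) * indicator {-1..1} x" for x
  proof (cases "x \<in> {-1..1}")
    case True
    then have sq: "0 \<le> sqrt (1 - x\<^sup>2)" by (auto simp: abs_square_le_1 abs_le_iff)
    have "(\<integral>\<^sup>+y. ennreal (f (x, y)) \<partial>lborel) = (\<integral>\<^sup>+y. ennreal ((G (x, y) / sqrt (1 - x\<^sup>2)) / sqrt (1 - y\<^sup>2)) * indicator {-1..1} y \<partial>lborel)"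
      using True by (intro nn_integral_cong) (auto simp: f_def J2_eq chebw_def indicator_def)
    also have "\<dots> = ennreal (pi * tmean (\<lambda>t. G (x, cos t) / sqrt (1 - x\<^sup>2)))"
    proof (rule cheb_nn_integral)
      have "continuous_on {-1..1} (\<lambda>y. G (x, y))"
        by (rule cG) (use True in \<open>auto intro!: continuous_intros simp: J2_eq\<close>)
      then show "continuous_on {-1..1} (\<lambda>y. G (x, y) / sqrt (1 - x\<^sup>2))"
        unfolding divide_inverse by (intro continuous_on_mult_right)
      show "0 \<le> G (x, y) / sqrt (1 - x\<^sup>2)" if "y \<in> {-1..1}" for y
        using True that sq by (intro divide_nonneg_nonneg G0) (auto simp: J2_eq)
    qed
    also have "pi * tmean (\<lambda>t. G (x, cos t) / sqrt (1 - x\<^sup>2)) = H x / sqrt (1 - x\<^sup>2)"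
      using tmean_cmult[of "1 / sqrt (1 - x\<^sup>2)" "\<lambda>t. G (x, cos t)"] by (simp add: H_def)
    finally show ?thesis using True by simp
  next
    case False
    then show ?thesis by (auto simp: f_def J2_eq)
  qed
  define V where "V = pi\<^sup>2 * tmean2 (\<lambda>x y. G (cos x, cos y))"
  have "(\<integral>\<^sup>+z. ennreal (f z) \<partial>lborel) = (\<integral>\<^sup>+z. ennreal (f z) \<partial>(lborel \<Otimes>\<^sub>M lborel))"
    by (simp only: lborel_prod)
  also have "\<dots> = (\<integral>\<^sup>+x. \<integral>\<^sup>+y. ennreal (f (x, y)) \<partial>lborel \<partial>lborel)"
    by (rule lborel.nn_integral_fst[symmetric]) (use mf in \<open>simp add: lborel_prod\<close>)
  also have "\<dots> = (\<integral>\<^sup>+x. ennreal (H x / sqrt (1 - x\<^sup>2)) * indicator {-1..1} x \<partial>lborel)"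
    by (simp only: inner)
  also have "\<dots> = ennreal (pi * tmean (\<lambda>s. H (cos s)))"
    by (rule cheb_nn_integral[OF cH H0])
  also have "pi * tmean (\<lambda>s. H (cos s)) = V"
    unfolding H_def V_def tmean2_def tmean_cmult by (simp add: power2_eq_square)
  finally have nn: "(\<integral>\<^sup>+z. ennreal (f z) \<partial>lborel) = ennreal V" .
  have V0: "0 \<le> V"
  proof -
    have "0 \<le> tmean2 (\<lambda>x y. G (cos x, cos y))"
      by (rule tmean2_nonneg)
         (unfold case_prod_unfold, auto intro!: cG continuous_on_cos_real continuous_intros G0 cos_cos_in_J2)
    then show ?thesis by (simp add: V_def)
  qed
  have intf: "integrable lborel f"
    using mf f0 nn by (intro integrableI_nonneg) auto
  have valf: "integral\<^sup>L lborel f = V"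
    using integral_eq_nn_integral[of f lborel] mf f0 nn V0 by simp
  have mf': "f \<in> lborel \<rightarrow>\<^sub>M borel" using mf by simp
  have J2l: "J2 \<inter> space lebesgue \<in> sets lebesgue" using J2b by simp
  show "integrable (lebesgue_on J2) (\<lambda>z. G z * chebw z)"
    unfolding integrable_restrict_space[OF J2l] f_def[symmetric] integrable_completion[OF mf'] by (rule intf)
  show "integral\<^sup>L (lebesgue_on J2) (\<lambda>z. G z * chebw z) = pi\<^sup>2 * tmean2 (\<lambda>x y. G (cos x, cos y))"
    unfolding integral_restrict_space[OF J2l] f_def[symmetric] integral_completion[OF mf'] valf V_def ..
qed

text \<open>On the boundary of the square both sides vanish, because \<open>0 powr a = 0\<close> and \<open>1 / 0 = 0\<close>.\<close>

lemma wgt_powr: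
  assumes "z \<in> J2" "0 < p"
  shows "\<bar>a * wgt p z\<bar> powr p = \<bar>a\<bar> powr p * chebw z"
proof -
  define s where "s = sqrt (1 - (fst z)\<^sup>2) * sqrt (1 - (snd z)\<^sup>2)"
  have s: "0 \<le> s" using assms unfolding s_def by (auto simp: J2_eq abs_square_le_1 abs_le_iff)
  have "\<bar>a * wgt p z\<bar> powr p = \<bar>a\<bar> powr p * (s powr (- 1 / p)) powr p"
    by (simp add: wgt_def s_def[symmetric] abs_mult powr_mult)
  also have "(s powr (- 1 / p)) powr p = 1 / s"
  proof (cases "s = 0")
    case False
    then have "s > 0" using s by simp
    have "(s powr (- 1 / p)) powr p = s powr (- 1)" using assms by (simp only: powr_powr) simp
    also have "\<dots> = 1 / s" using \<open>s > 0\<close> by (simp add: powr_minus_divide)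
    finally show ?thesis .
  qed simp
  finally show ?thesis by (simp add: chebw_def s_def)
qed

lemma normLpw_eq:
  assumes g: "continuous_on J2 g" and p: "0 < p"
  shows "normLpw p g = (pi\<^sup>2 * tmean2 (\<lambda>x y. \<bar>g (cos x, cos y)\<bar> powr p)) powr (1 / p)"
proof -
  have "integral\<^sup>L (lebesgue_on J2) (\<lambda>z. \<bar>g z * wgt p z\<bar> powr p) = integral\<^sup>L (lebesgue_on J2) (\<lambda>z. \<bar>g z\<bar> powr p * chebw z)"
    by (rule Bochner_Integration.integral_cong) (auto simp: space_restrict_space wgt_powr p)
  also have "\<dots> = pi\<^sup>2 * tmean2 (\<lambda>x y. \<bar>g (cos x, cos y)\<bar> powr p)"
    by (rule chebw_integral(2)) (use g p in \<open>auto intro!: continuous_on_abs_powr\<close>)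
  finally show ?thesis by (simp add: normLpw_def)
qed

lemma PiL_continuous:
  assumes "q \<in> PiL m n"
  shows "continuous_on J2 q"
proof -
  obtain c where c: "\<And>x y. q (x, y) = (\<Sum>(k, l)\<in>idxL m n. c (k, l) * cheb k x * cheb l y)"
    using assms unfolding PiL_def by blast
  have "q = (\<lambda>z. \<Sum>k\<in>idxL m n. c k * cheb (fst k) (fst z) * cheb (snd k) (snd z))"
  proof
    show "q z = (\<Sum>k\<in>idxL m n. c k * cheb (fst k) (fst z) * cheb (snd k) (snd z))" for z
      using c[of "fst z" "snd z"] by (simp add: case_prod_unfold)
  qed
  then show ?thesis unfolding cheb_def
    by (simp only:) (intro continuous_intros continuous_on_cos_real continuous_on_arccos; auto simp: J2_eq)
qed

lemma PiL_trig2: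
  assumes m: "1 \<le> m" and n: "1 \<le> n" and q: "q \<in> PiL m n"
  shows "\<exists>d. \<forall>x y. complex_of_real (q (cos x, cos y)) = trig2 ({-int m..int m} \<times> {-int n..int n}) d x y"
proof -
  obtain c where c: "\<And>x y. q (x, y) = (\<Sum>(k, l)\<in>idxL m n. c (k, l) * cheb k x * cheb l y)"
    using q unfolding PiL_def by blast
  \<comment> \<open>The coefficients of \<open>2 * cos (k * t)\<close>. For \<open>k = 0\<close>
    both indicators hit the same frequency and give 2, so the factor \<open>1/4\<close> in
    \<open>d\<close> is right in every case.\<close>
  define e where "e = (\<lambda>(k::nat) (a::int). (if a = int k then 1 else 0) + (if a = - int k then 1 else (0::complex)))"
  have e: "(\<Sum>a\<in>{-int M..int M}. e k a * cis (of_int a * t)) = 2 * of_real (cos (real k * t))" if "k \<le> M" for k M t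
  proof -
    have "(\<Sum>a\<in>{-int M..int M}. e k a * cis (of_int a * t)) = (\<Sum>a\<in>{-int M..int M}. if a = int k then cis (of_int a * t) else 0) + (\<Sum>a\<in>{-int M..int M}. if a = - int k then cis (of_int a * t) else 0)"
      unfolding e_def distrib_right sum.distrib by (intro arg_cong2[where f = "(+)"] sum.cong refl) auto
    also have "\<dots> = cis (real k * t) + cis (- (real k * t))" using that by simp
    finally show ?thesis by (simp add: complex_eq_iff)
  qed
  define d where "d = (\<lambda>z :: int \<times> int. \<Sum>k\<in>idxL m n. of_real (c k / 4) * (e (fst k) (fst z) * e (snd k) (snd z)))"
  have "complex_of_real (q (cos x, cos y)) = trig2 ({-int m..int m} \<times> {-int n..int n}) d x y" for x y
  proof -
    have "trig2 ({-int m..int m} \<times> {-int n..int n}) d x y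
      = (\<Sum>z\<in>{-int m..int m} \<times> {-int n..int n}. \<Sum>k\<in>idxL m n. of_real (c k / 4) * ((e (fst k) (fst z) * cis (of_int (fst z) * x)) * (e (snd k) (snd z) * cis (of_int (snd z) * y))))"
      unfolding trig2_def d_def sum_distrib_right cis_mult[symmetric] by (intro sum.cong refl) (simp only: mult_ac)
    also have "\<dots> = (\<Sum>k\<in>idxL m n. of_real (c k / 4) * (\<Sum>z\<in>{-int m..int m} \<times> {-int n..int n}. (e (fst k) (fst z) * cis (of_int (fst z) * x)) * (e (snd k) (snd z) * cis (of_int (snd z) * y))))"
      by (subst sum.swap) (simp only: sum_distrib_left)
    also have "\<dots> = (\<Sum>k\<in>idxL m n. of_real (c k / 4) * ((\<Sum>a\<in>{-int m..int m}. e (fst k) a * cis (of_int a * x)) * (\<Sum>b\<in>{-int n..int n}. e (snd k) b * cis (of_int b * y))))"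
      unfolding sum_product sum.cartesian_product case_prod_unfold ..
    also have "\<dots> = (\<Sum>k\<in>idxL m n. of_real (c k / 4) * ((2 * of_real (cos (real (fst k) * x))) * (2 * of_real (cos (real (snd k) * y)))))"
    proof (intro sum.cong refl)
      fix k assume "k \<in> idxL m n"
      then have "fst k \<le> m" "snd k \<le> n" using idxL_subset[OF m n] by auto
      then show "of_real (c k / 4) * ((\<Sum>a\<in>{-int m..int m}. e (fst k) a * cis (of_int a * x)) * (\<Sum>b\<in>{-int n..int n}. e (snd k) b * cis (of_int b * y)))
         = of_real (c k / 4) * ((2 * of_real (cos (real (fst k) * x))) * (2 * of_real (cos (real (snd k) * y))))"
        by (simp only: e)
    qed
    also have "\<dots> = of_real (q (cos x, cos y))"
      unfolding c cheb_cos of_real_sum by (intro sum.cong refl) (auto simp: case_prod_unfold)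
    finally show ?thesis ..
  qed
  then show ?thesis by blast
qed

section \<open>The one-sided estimate\<close>

lemma tmean2_lam_le:
  assumes "1 \<le> p"
  shows "\<exists>C>0. \<forall>m n F. 1 \<le> m \<longrightarrow> 1 \<le> n \<longrightarrow>
    real (2*m) * real (2*n) * tmean2 (\<lambda>x y. \<bar>lam m n F x y\<bar> powr p) \<le> C * Kp p m n * (\<Sum>i<2*m. \<Sum>j<2*n. \<bar>F i j\<bar> powr p)"
proof (cases "p = 1")
  case True
  then show ?thesis using tmean2_lam_le_L1 by (simp add: Kp_def)
next
  case False
  then show ?thesis using tmean2_lam_le_Lp[of p] assms by (simp add: Kp_def)
qed

text \<open>The mean over the torus is invariant under both reflections, so the four terms of the
  symmetrisation have equal norms.\<close>

lemma tmean2_interp_le: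
  assumes p: "1 \<le> p"
  shows "tmean2 (\<lambda>x y. \<bar>interp m n F (cos x, cos y)\<bar> powr p) \<le> 4 * 4 powr p * tmean2 (\<lambda>x y. \<bar>lam m n F x y\<bar> powr p)"
proof -
  define f where "f = (\<lambda>x y. \<bar>lam m n F x y\<bar> powr p)"
  have cf: "continuous_on UNIV (\<lambda>(x, y). f (u x) (v y))" if "continuous_on UNIV u" "continuous_on UNIV v" for u v :: "real \<Rightarrow> real"
  proof -
    have "continuous_on UNIV (\<lambda>z::real \<times> real. u (fst z))"
      by (rule continuous_on_compose2[OF that(1)]) (auto intro!: continuous_intros)
    moreover have "continuous_on UNIV (\<lambda>z::real \<times> real. v (snd z))"
      by (rule continuous_on_compose2[OF that(2)]) (auto intro!: continuous_intros)
    ultimately show ?thesis unfolding f_def case_prod_unfold using p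
      by (intro continuous_on_abs_powr continuous_on_lam) auto
  qed
  have cm: "continuous_on UNIV (uminus :: real \<Rightarrow> real)" "continuous_on UNIV (\<lambda>x :: real. x)"
    by (auto intro!: continuous_intros)
  have c: "continuous_on UNIV (\<lambda>(x, y). f x y)" "continuous_on UNIV (\<lambda>(x, y). f (- x) y)"
    "continuous_on UNIV (\<lambda>(x, y). f x (- y))" "continuous_on UNIV (\<lambda>(x, y). f (- x) (- y))"
    using cf[OF cm(2) cm(2)] cf[OF cm(1) cm(2)] cf[OF cm(2) cm(1)] cf[OF cm(1) cm(1)] by simp_all
  have per: "f (x + 2*pi) y = f x y" "f x (y + 2*pi) = f x y" for x y
    unfolding f_def lam_periodic by simp_all
  have per': "f (- (x + 2*pi)) y = f (- x) y" "f (- x) (y + 2*pi) = f (- x) y" for x y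
    using per(1)[of "- (x + 2*pi)" y] per(2) by simp_all
  have r1: "tmean2 (\<lambda>x y. f (- x) y) = tmean2 f" "tmean2 (\<lambda>x y. f x (- y)) = tmean2 f"
    by (rule tmean2_reflect[OF c(1) per])+
  have r2: "tmean2 (\<lambda>x y. f (- x) (- y)) = tmean2 f"
    using tmean2_reflect(2)[OF c(2) per'] r1 by simp
  have "tmean2 (\<lambda>x y. \<bar>interp m n F (cos x, cos y)\<bar> powr p) \<le>
     tmean2 (\<lambda>x y. 4 powr p * ((f x y + f (- x) y) + (f x (- y) + f (- x) (- y))))"
  proof (rule tmean2_mono)
    show "continuous_on UNIV (\<lambda>(x, y). \<bar>interp m n F (cos x, cos y)\<bar> powr p)"
      unfolding interp_cos case_prod_unfold using p
      by (intro continuous_on_abs_powr continuous_intros continuous_on_lam) auto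
    show "continuous_on UNIV (\<lambda>(x, y). 4 powr p * ((f x y + f (- x) y) + (f x (- y) + f (- x) (- y))))"
      unfolding case_prod_unfold
      by (intro continuous_on_mult_left continuous_on_add c[unfolded case_prod_unfold])
    fix x y
    let ?a = "lam m n F x y" and ?b = "lam m n F (- x) y" and ?c = "lam m n F x (- y)" and ?d = "lam m n F (- x) (- y)"
    have "\<bar>interp m n F (cos x, cos y)\<bar> \<le> (\<bar>?a\<bar> + \<bar>?b\<bar>) + (\<bar>?c\<bar> + \<bar>?d\<bar>)"
    proof -
      have "\<bar>?a + ?b + ?c + ?d\<bar> \<le> (\<bar>?a\<bar> + \<bar>?b\<bar>) + (\<bar>?c\<bar> + \<bar>?d\<bar>)"
        using abs_triangle_ineq[of "?a + ?b" "?c + ?d"] abs_triangle_ineq[of ?a ?b] abs_triangle_ineq[of ?c ?d]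
        by (simp add: add.assoc)
      moreover have "\<bar>s\<bar> \<le> t \<Longrightarrow> \<bar>s / 4\<bar> \<le> t" for s t :: real by linarith
      ultimately show ?thesis unfolding interp_cos by blast
    qed
    then have "\<bar>interp m n F (cos x, cos y)\<bar> powr p \<le> 2 powr p * ((\<bar>?a\<bar> + \<bar>?b\<bar>) powr p + (\<bar>?c\<bar> + \<bar>?d\<bar>) powr p)"
      using p by (intro powr_le_add) auto
    also have "\<dots> \<le> 2 powr p * (2 powr p * (f x y + f (- x) y) + 2 powr p * (f x (- y) + f (- x) (- y)))"
      unfolding f_def using p by (intro mult_left_mono add_mono powr_add_le) auto
    also have "\<dots> = 4 powr p * ((f x y + f (- x) y) + (f x (- y) + f (- x) (- y)))"
      unfolding distrib_left[symmetric] mult.assoc[symmetric] two_powr_mult_self ..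
    finally show "\<bar>interp m n F (cos x, cos y)\<bar> powr p \<le> 4 powr p * ((f x y + f (- x) y) + (f x (- y) + f (- x) (- y)))" .
  qed
  also have "\<dots> = 4 powr p * ((tmean2 f + tmean2 (\<lambda>x y. f (- x) y)) + (tmean2 (\<lambda>x y. f x (- y)) + tmean2 (\<lambda>x y. f (- x) (- y))))"
    unfolding tmean2_cmult
    by (subst tmean2_add, unfold case_prod_unfold, (intro continuous_on_add c[unfolded case_prod_unfold])+)
       (simp add: tmean2_add c)
  also have "\<dots> = 4 * 4 powr p * tmean2 f" unfolding r1 r2 by simp
  finally show ?thesis by (simp add: f_def)
qed

text \<open>Only the node values of \<open>g\<close> enter its interpolant, and they are dominated
  by those of \<open>T\<close>. The sampling inequality applies to the polynomial \<open>T\<close>,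
  whereas the arbitrary function \<open>g\<close> satisfies none.\<close>

lemma tmean2_interp_majorant:
  assumes p: "1 \<le> p"
  shows "\<exists>C>0. \<forall>m n g T. 1 \<le> m \<longrightarrow> 1 \<le> n \<longrightarrow> T \<in> PiL m n \<longrightarrow> (\<forall>z\<in>J2. \<bar>g z\<bar> \<le> T z) \<longrightarrow>
    tmean2 (\<lambda>x y. \<bar>interp m n (dat m n g) (cos x, cos y)\<bar> powr p) \<le> C * Kp p m n * tmean2 (\<lambda>x y. \<bar>T (cos x, cos y)\<bar> powr p)"
proof -
  obtain C where C: "C > 0" and R: "\<And>m n F. 1 \<le> m \<Longrightarrow> 1 \<le> n \<Longrightarrow>
    real (2*m) * real (2*n) * tmean2 (\<lambda>x y. \<bar>lam m n F x y\<bar> powr p) \<le> C * Kp p m n * (\<Sum>i<2*m. \<Sum>j<2*n. \<bar>F i j\<bar> powr p)"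
    using tmean2_lam_le[OF p] by blast
  define D where "D = 4 * 4 powr p * (C * (2 * 4 powr p)\<^sup>2)"
  have "tmean2 (\<lambda>x y. \<bar>interp m n (dat m n g) (cos x, cos y)\<bar> powr p) \<le> D * Kp p m n * tmean2 (\<lambda>x y. \<bar>T (cos x, cos y)\<bar> powr p)"
    if m: "1 \<le> m" and n: "1 \<le> n" and T: "T \<in> PiL m n" and gT: "\<And>z. z \<in> J2 \<Longrightarrow> \<bar>g z\<bar> \<le> T z" for m n g T
  proof -
    define N where "N = real (2*m) * real (2*n)"
    have N: "N > 0" using m n by (simp add: N_def)
    have K: "Kp p m n \<ge> 0" by (simp add: Kp_def)
    define \<tau> where "\<tau> = tmean2 (\<lambda>x y. \<bar>T (cos x, cos y)\<bar> powr p)"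
    obtain d where d: "\<And>x y. complex_of_real (T (cos x, cos y)) = trig2 ({-int m..int m} \<times> {-int n..int n}) d x y"
      using PiL_trig2[OF m n T] by blast
    have dT: "cmod (trig2 ({-int m..int m} \<times> {-int n..int n}) d x y) = \<bar>T (cos x, cos y)\<bar>" for x y
      unfolding d[symmetric] by simp
    have "(\<Sum>i<2*m. \<Sum>j<2*n. \<bar>dat m n g i j\<bar> powr p) \<le> (\<Sum>i<2*m. \<Sum>j<2*n. \<bar>T (cos (pi * real i / real m), cos (pi * real j / real n))\<bar> powr p)"
    proof (intro sum_mono powr_mono2)
      fix i j
      let ?z = "(cos (pi * real i / real m), cos (pi * real j / real n))"
      have "\<bar>g ?z\<bar> \<le> T ?z" by (rule gT[OF cos_cos_in_J2])
      then show "\<bar>dat m n g i j\<bar> \<le> \<bar>T ?z\<bar>" by (auto simp: dat_def node_eq)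
    qed (use p in auto)
    also have "\<dots> \<le> (2 * 4 powr p)\<^sup>2 * N * \<tau>"
      using marcinkiewicz_zygmund_2d[of m n p d] m n p unfolding dT N_def \<tau>_def by simp
    finally have F: "(\<Sum>i<2*m. \<Sum>j<2*n. \<bar>dat m n g i j\<bar> powr p) \<le> (2 * 4 powr p)\<^sup>2 * N * \<tau>" .
    have "N * tmean2 (\<lambda>x y. \<bar>lam m n (dat m n g) x y\<bar> powr p) \<le> C * Kp p m n * (\<Sum>i<2*m. \<Sum>j<2*n. \<bar>dat m n g i j\<bar> powr p)"
      unfolding N_def by (rule R[OF m n])
    also have "\<dots> \<le> C * Kp p m n * ((2 * 4 powr p)\<^sup>2 * N * \<tau>)"
      using F C K by (intro mult_left_mono) auto
    also have "\<dots> = N * (C * (2 * 4 powr p)\<^sup>2 * Kp p m n * \<tau>)" by (simp only: mult_ac)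
    finally have "tmean2 (\<lambda>x y. \<bar>lam m n (dat m n g) x y\<bar> powr p) \<le> C * (2 * 4 powr p)\<^sup>2 * Kp p m n * \<tau>"
      using N by simp
    then have "4 * 4 powr p * tmean2 (\<lambda>x y. \<bar>lam m n (dat m n g) x y\<bar> powr p) \<le> 4 * 4 powr p * (C * (2 * 4 powr p)\<^sup>2 * Kp p m n * \<tau>)"
      by (rule mult_left_mono) simp
    then show ?thesis using tmean2_interp_le[OF p, of m n "dat m n g"]
      unfolding D_def \<tau>_def by (simp only: mult.assoc)
  qed
  moreover have "D > 0" unfolding D_def using C by simp
  ultimately show ?thesis by blast
qed

text \<open>Lets the term \<open>\<bar>T\<bar>\<close>, which appears in the error without the
  factor \<open>Kp\<close>, be absorbed into the final bound.\<close>

lemma Kp_lower_bound: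
  assumes "1 \<le> m" "1 \<le> n"
  shows "(ln 2)\<^sup>2 \<le> Kp p m n"
proof -
  have "ln 2 \<le> (1::real)" using ln_le_minus_one[of "2::real"] by simp
  then have 1: "(ln 2)\<^sup>2 \<le> (1::real)" by (simp add: power_le_one)
  have "ln 2 * ln 2 \<le> ln (real m + 1) * ln (real n + 1)"
    using assms by (intro mult_mono) auto
  then show ?thesis using 1 by (simp add: Kp_def power2_eq_square)
qed

lemma normLpw_Lint_le:
  fixes p :: real
  assumes p: "1 \<le> p"
  shows "\<exists>C>0. \<forall>f m n q Q. 1 \<le> m \<longrightarrow> 1 \<le> n \<longrightarrow> coprime m n \<longrightarrow> q \<in> PiL m n \<longrightarrow> Q \<in> PiL m n \<longrightarrow>
    (\<forall>z\<in>J2. q z \<le> f z \<and> f z \<le> Q z) \<longrightarrow>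
    normLpw p (\<lambda>z. f z - Lint m n f z) \<le> C * Kp p m n * normLpw p (\<lambda>z. Q z - q z)"
proof -
  obtain C where C: "C > 0" and R: "\<And>m n g T. 1 \<le> m \<Longrightarrow> 1 \<le> n \<Longrightarrow> T \<in> PiL m n \<Longrightarrow> (\<And>z. z \<in> J2 \<Longrightarrow> \<bar>g z\<bar> \<le> T z) \<Longrightarrow>
    tmean2 (\<lambda>x y. \<bar>interp m n (dat m n g) (cos x, cos y)\<bar> powr p) \<le> C * Kp p m n * tmean2 (\<lambda>x y. \<bar>T (cos x, cos y)\<bar> powr p)"
    using tmean2_interp_majorant[OF p] by blast
  \<comment> \<open>\<open>2 powr p\<close> comes from splitting the error into
    \<open>\<bar>T\<bar> + \<bar>P\<bar>\<close>; the summand \<open>1 / (ln 2)\<^sup>2\<close> pays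
    for \<open>T\<close> and \<open>C\<close> for \<open>P\<close>.\<close>
  define D where "D = 2 powr p * (1 / (ln 2)\<^sup>2 + C)"
  have D: "D > 0" unfolding D_def using C by (intro mult_pos_pos add_nonneg_pos) auto
  have "normLpw p (\<lambda>z. f z - Lint m n f z) \<le> D powr (1 / p) * Kp p m n * normLpw p (\<lambda>z. Q z - q z)"
    if m: "1 \<le> m" and n: "1 \<le> n" and cop: "coprime m n" and q: "q \<in> PiL m n" and Q: "Q \<in> PiL m n"
      and b: "\<And>z. z \<in> J2 \<Longrightarrow> q z \<le> f z \<and> f z \<le> Q z" for f m n q Q
  proof -
    define T where "T = (\<lambda>z. Q z - q z)"
    define g where "g = (\<lambda>z. f z - q z)"
    define P where "P = interp m n (dat m n g)"
    have T: "T \<in> PiL m n" unfolding T_def by (rule PiL_diff[OF Q q])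
    have gT: "\<bar>g z\<bar> \<le> T z" if "z \<in> J2" for z using b[OF that] by (simp add: g_def T_def)
    have cT: "continuous_on J2 T" by (rule PiL_continuous[OF T])
    have cP: "continuous_on J2 P" unfolding P_def by (rule PiL_continuous[OF interp_in_PiL])
    define \<tau> where "\<tau> = tmean2 (\<lambda>x y. \<bar>T (cos x, cos y)\<bar> powr p)"
    have cc: "continuous_on UNIV (\<lambda>(x, y). \<bar>h (cos x, cos y)\<bar> powr p)" if "continuous_on J2 h" for h
    proof -
      have "continuous_on UNIV (\<lambda>z::real \<times> real. h (cos (fst z), cos (snd z)))"
        by (rule continuous_on_compose2[OF that])
           (auto intro!: continuous_intros continuous_on_cos_real cos_cos_in_J2)
      then show ?thesis unfolding case_prod_unfold using p by (intro continuous_on_abs_powr) auto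
    qed
    have \<tau>0: "\<tau> \<ge> 0" unfolding \<tau>_def by (rule tmean2_nonneg[OF cc[OF cT]]) simp
    have K: "Kp p m n \<ge> 0" by (simp add: Kp_def)
    have K1: "1 \<le> 1 / (ln 2)\<^sup>2 * Kp p m n" using Kp_lower_bound[OF m n, of p] by (simp add: field_simps)
    have P\<tau>: "tmean2 (\<lambda>x y. \<bar>P (cos x, cos y)\<bar> powr p) \<le> C * Kp p m n * \<tau>"
      unfolding P_def \<tau>_def by (rule R[OF m n T gT])
    define G where "G = (\<lambda>z. 2 powr p * (\<bar>T z\<bar> powr p + \<bar>P z\<bar> powr p))"
    have cG: "continuous_on J2 G"
      unfolding G_def using p by (intro continuous_intros continuous_on_abs_powr cT cP) auto
    have "integral\<^sup>L (lebesgue_on J2) (\<lambda>z. \<bar>(f z - Lint m n f z) * wgt p z\<bar> powr p)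
       \<le> integral\<^sup>L (lebesgue_on J2) (\<lambda>z. G z * chebw z)"
    proof (rule integral_mono')
      show "integrable (lebesgue_on J2) (\<lambda>z. G z * chebw z)"
        by (rule chebw_integral(1)[OF cG]) (simp add: G_def)
      fix z assume "z \<in> space (lebesgue_on J2)"
      then have z: "z \<in> J2" by (simp add: space_restrict_space)
      have "f z - Lint m n f z = g z - P z"
        unfolding Lint_diff[OF m n cop q, of f z] g_def P_def by simp
      then have "\<bar>f z - Lint m n f z\<bar> \<le> \<bar>T z\<bar> + \<bar>P z\<bar>" using gT[OF z] by linarith
      then have "\<bar>f z - Lint m n f z\<bar> powr p \<le> G z"
        unfolding G_def using p by (intro powr_le_add) auto
      then show "\<bar>(f z - Lint m n f z) * wgt p z\<bar> powr p \<le> G z * chebw z"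
        using p z by (subst wgt_powr) (auto intro: mult_right_mono chebw_nonneg)
      show "0 \<le> G z * chebw z" using chebw_nonneg[OF z] by (simp add: G_def)
    qed
    also have "\<dots> = pi\<^sup>2 * tmean2 (\<lambda>x y. G (cos x, cos y))"
      by (rule chebw_integral(2)[OF cG]) (simp add: G_def)
    also have "tmean2 (\<lambda>x y. G (cos x, cos y)) = 2 powr p * (\<tau> + tmean2 (\<lambda>x y. \<bar>P (cos x, cos y)\<bar> powr p))"
      unfolding G_def tmean2_cmult \<tau>_def by (subst tmean2_add[OF cc[OF cT] cc[OF cP]]) (rule refl)
    also have "pi\<^sup>2 * \<dots> \<le> pi\<^sup>2 * (2 powr p * (1 / (ln 2)\<^sup>2 * Kp p m n * \<tau> + C * Kp p m n * \<tau>))"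
      using P\<tau> mult_right_mono[OF K1 \<tau>0] by (intro mult_left_mono add_mono) auto
    also have "\<dots> = D * Kp p m n * (pi\<^sup>2 * \<tau>)" by (simp add: D_def algebra_simps)
    finally have I: "integral\<^sup>L (lebesgue_on J2) (\<lambda>z. \<bar>(f z - Lint m n f z) * wgt p z\<bar> powr p) \<le> D * Kp p m n * (pi\<^sup>2 * \<tau>)" .
    have "normLpw p (\<lambda>z. f z - Lint m n f z) \<le> (D * Kp p m n * (pi\<^sup>2 * \<tau>)) powr (1 / p)"
      unfolding normLpw_def using p by (intro powr_mono2 I) (auto intro!: Bochner_Integration.integral_nonneg)
    also have "\<dots> = D powr (1 / p) * Kp p m n powr (1 / p) * (pi\<^sup>2 * \<tau>) powr (1 / p)"
      by (simp only: powr_mult)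
    \<comment> \<open>Either the exponent is 1 or \<open>Kp\<close> is 1, so taking the p-th root
      does not change this factor.\<close>
    also have "Kp p m n powr (1 / p) = Kp p m n"
      using K by (cases "p = 1") (auto simp: Kp_def)
    also have "(pi\<^sup>2 * \<tau>) powr (1 / p) = normLpw p (\<lambda>z. Q z - q z)"
      using normLpw_eq[OF cT, of p] p unfolding \<tau>_def T_def by simp
    finally show ?thesis .
  qed
  moreover have "D powr (1 / p) > 0" using D by simp
  ultimately show ?thesis by blast
qed

theorem theorem4p1:
  fixes p :: real
  assumes "1 \<le> p"
  shows "\<exists>C>0. \<forall>f m n. f \<in> Bfun \<longrightarrow> m \<ge> 1 \<longrightarrow> n \<ge> 1 \<longrightarrow> coprime m n \<longrightarrow>
           normLpw p (\<lambda>z. f z - Lint m n f z) \<le> C * Kp p m n * onesidedE p f (PiL m n)"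
proof -
  obtain C where C: "C > 0" and R: "\<And>f m n q Q. 1 \<le> m \<Longrightarrow> 1 \<le> n \<Longrightarrow> coprime m n \<Longrightarrow> q \<in> PiL m n \<Longrightarrow> Q \<in> PiL m n \<Longrightarrow>
    (\<And>z. z \<in> J2 \<Longrightarrow> q z \<le> f z \<and> f z \<le> Q z) \<Longrightarrow>
    normLpw p (\<lambda>z. f z - Lint m n f z) \<le> C * Kp p m n * normLpw p (\<lambda>z. Q z - q z)"
    using normLpw_Lint_le[OF assms] by blast
  have "normLpw p (\<lambda>z. f z - Lint m n f z) \<le> C * Kp p m n * onesidedE p f (PiL m n)"
    if f: "f \<in> Bfun" and mn: "1 \<le> m" "1 \<le> n" "coprime m n" for f m n
  proof -
    define S where "S = {normLpw p (\<lambda>z. Q z - q z) | q Q.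
      q \<in> PiL m n \<and> Q \<in> PiL m n \<and> (\<forall>z\<in>J2. q z \<le> f z \<and> f z \<le> Q z)}"
    have "0 < (ln 2 :: real)\<^sup>2" by simp
    then have K: "C * Kp p m n > 0" using C Kp_lower_bound[OF mn(1,2), of p] by (intro mult_pos_pos) linarith+
    obtain B where B: "\<And>z. z \<in> J2 \<Longrightarrow> \<bar>f z\<bar> \<le> B"
      using f unfolding Bfun_def bounded_iff by auto
    \<comment> \<open>Boundedness of \<open>f\<close> makes the constants \<open>-B\<close> and
      \<open>B\<close> an admissible pair, so the infimum is over a nonempty set and the bound for
      each pair passes to it.\<close>
    have "normLpw p (\<lambda>z. B - (- B)) \<in> S"
      unfolding S_def mem_Collect_eq
      by (intro exI[of _ "\<lambda>z. - B"] exI[of _ "\<lambda>z. B"] conjI const_in_PiL[OF mn(1,2)] refl) (use B in \<open>force simp: abs_le_iff\<close>)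
    then have "S \<noteq> {}" by blast
    then have "normLpw p (\<lambda>z. f z - Lint m n f z) / (C * Kp p m n) \<le> Inf S"
    proof (rule cInf_greatest)
      fix s assume "s \<in> S"
      then obtain q Q where s: "s = normLpw p (\<lambda>z. Q z - q z)" "q \<in> PiL m n" "Q \<in> PiL m n"
        "\<And>z. z \<in> J2 \<Longrightarrow> q z \<le> f z \<and> f z \<le> Q z" unfolding S_def by blast
      have "normLpw p (\<lambda>z. f z - Lint m n f z) \<le> C * Kp p m n * s"
        unfolding s(1) by (rule R[OF mn s(2-4)])
      then show "normLpw p (\<lambda>z. f z - Lint m n f z) / (C * Kp p m n) \<le> s"
        using K by (simp add: pos_divide_le_eq mult.commute)
    qed
    then show ?thesis
      unfolding onesidedE_def S_def[symmetric] using K by (simp add: pos_divide_le_eq mult.commute)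
  qed
  then show ?thesis using C by blast
qed

end
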